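(* Let $G$ be a countable group and let $s\ge 1$ be an integer. Suppose that $P=\mathrm{Pol}_s(G)$ is amenable, that the set $\mathrm{Sub}(P)$ of all subgroups of $P$ is countable, and that every almost normal subgroup of $P$ is profinitely closed. Then $G$ is permutation stable of degree $\le s$ ($P_s$-stable).
   Context: For groups $G,H$, a map $f:G\to H$ and $g\in G$, define $\partial_g f:G\to H$ by $(\partial_g f)(x)=f(gx)f(x)^{-1}$, and put $\partial_{g_1,\ldots,g_k}f=\partial_{g_1}(\partial_{g_2}(\cdots\partial_{g_k}f))$. The map $f$ is polynomial of degree $\le s$ if $(\partial_{g_1,\ldots,g_{s+1}}f)(x)=1$ for all $x,g_1,\ldots,g_{s+1}\in G$; it is unital if $f(1)=1$. Universal polynomial group: let $F_G$ be the free group on the symbols $\{x_g : g\in G\setminus\{1\}\}$, set $x_1=1$, and let $\iota:G\to F_G$, $\iota(g)=x_g$. Let $R_s(G)$ be the normal closure in $F_G$ of all elements $(\partial_{g_1,\ldots,g_{s+1}}\iota)(1)$, $g_1,\ldots,g_{s+1}\in G$. Then $\mathrm{Pol}_s(G)=F_G/R_s(G)$. A subgroup $H$ of a group $\Gamma$ is almost normal if it has only finitely many conjugates, i.e. $[\Gamma:N_\Gamma(H)]<\infty$. It is profinitely closed if $H=\bigcap_{i=1}^\infty H_i$ for some finite-index subgroups $H_i\le\Gamma$. $\mathrm{Sym}(n)$ carries the normalized Hamming distance $d_n(\sigma,\tau)=1-\frac1n|\mathrm{Fix}(\sigma^{-1}\tau)|$. A sequence of maps $f_n:G\to\mathrm{Sym}(m_n)$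 ($m_n$ positive integers) is asymptotically unital if $\lim_n d_{m_n}(f_n(1),1)=0$. An asymptotically unital sequence is almost-polynomial of degree $\le s$ if $\lim_n d_{m_n}((\partial_{g_1,\ldots,g_{s+1}}f_n)(1),1)=0$ for all $g_1,\ldots,g_{s+1}\in G$. $G$ is $P_s$-stable if for every almost-polynomial sequence $(f_n)_n$ of degree $\le s$ of $G$ there are unital polynomial maps $\rho_n:G\to\mathrm{Sym}(m_n)$ of degree $\le s$ with $\lim_n d_{m_n}(\rho_n(g),f_n(g))=0$ for all $g\in G$. *)

theory Defs
  imports Complex_Main "HOL-Library.Countable_Set" "HOL-Algebra.Sym_Groups"
begin

section \<open>Polynomial maps between groups\<close>

definition pdiff :: "('a, 'm) monoid_scheme \<Rightarrow> ('b, 'n) monoid_scheme \<Rightarrow> 'a \<Rightarrow> ('a \<Rightarrow> 'b) \<Rightarrow> ('a \<Rightarrow> 'b)"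
  where "pdiff G H g f = (\<lambda>x. f (g \<otimes>\<^bsub>G\<^esub> x) \<otimes>\<^bsub>H\<^esub> inv\<^bsub>H\<^esub> (f x))"

definition pdiffs :: "('a, 'm) monoid_scheme \<Rightarrow> ('b, 'n) monoid_scheme \<Rightarrow> 'a list \<Rightarrow> ('a \<Rightarrow> 'b) \<Rightarrow> ('a \<Rightarrow> 'b)"
  where "pdiffs G H gs f = foldr (pdiff G H) gs f"

definition polynomial_map :: "('a, 'm) monoid_scheme \<Rightarrow> ('b, 'n) monoid_scheme \<Rightarrow> nat \<Rightarrow> ('a \<Rightarrow> 'b) \<Rightarrow> bool"
  where "polynomial_map G H s f \<longleftrightarrow>
    f \<in> carrier G \<rightarrow> carrier H \<and>
    (\<forall>gs x. length gs = s + 1 \<longrightarrow> set gs \<subseteq> carrier G \<longrightarrow> x \<in> carrier G \<longrightarrow>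
       pdiffs G H gs f x = \<one>\<^bsub>H\<^esub>)"

definition unital_map :: "('a, 'm) monoid_scheme \<Rightarrow> ('b, 'n) monoid_scheme \<Rightarrow> ('a \<Rightarrow> 'b) \<Rightarrow> bool"
  where "unital_map G H f \<longleftrightarrow> f \<one>\<^bsub>G\<^esub> = \<one>\<^bsub>H\<^esub>"


section \<open>Free groups\<close>

text \<open>The free group on a set \<open>X\<close> consists of the reduced words in the letters \<open>(x, True)\<close>
  (standing for \<open>x\<close>) and \<open>(x, False)\<close> (standing for the inverse of \<open>x\<close>), \<open>x \<in> X\<close>; the product
  is concatenation followed by free reduction.\<close>

definition inv_letter :: "'a \<times> bool \<Rightarrow> 'a \<times> bool"
  where "inv_letter l = (fst l, \<not> snd l)"

definition reduced_word :: "('a \<times> bool) list \<Rightarrow> bool"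
  where "reduced_word w \<longleftrightarrow> successively (\<lambda>k l. l \<noteq> inv_letter k) w"

fun push_letter :: "'a \<times> bool \<Rightarrow> ('a \<times> bool) list \<Rightarrow> ('a \<times> bool) list"
  where
    "push_letter k [] = [k]"
  | "push_letter k (l # w) = (if l = inv_letter k then w else k # l # w)"

definition free_group :: "'a set \<Rightarrow> ('a \<times> bool) list monoid"
  where "free_group X =
    \<lparr> carrier = {w. reduced_word w \<and> fst ` set w \<subseteq> X},
      mult = (\<lambda>u v. foldr push_letter u v),
      one = [] \<rparr>"

lemma inv_letter_inv_letter [simp]: "inv_letter (inv_letter l) = l"
  by (simp add: inv_letter_def)

lemma fst_inv_letter [simp]: "fst (inv_letter l) = fst l"
  by (simp add: inv_letter_def)

lemma inv_letter_eq_iff: "inv_letter k = l \<longleftrightarrow> k = inv_letter l"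
  by (auto simp: inv_letter_def)

lemma reduced_word_Nil [simp]: "reduced_word []"
  by (simp add: reduced_word_def)

lemma reduced_word_Cons:
  "reduced_word (k # w) \<longleftrightarrow> reduced_word w \<and> (w = [] \<or> hd w \<noteq> inv_letter k)"
  by (auto simp: reduced_word_def successively_Cons)

lemma reduced_word_push: "reduced_word w \<Longrightarrow> reduced_word (push_letter k w)"
  by (cases w) (auto simp: reduced_word_Cons)

lemma set_push_letter: "set (push_letter k w) \<subseteq> insert k (set w)"
  by (cases w) auto

lemma push_inv_letter:
  assumes "reduced_word w"
  shows "push_letter (inv_letter k) (push_letter k w) = w"
proof (cases w)
  case (Cons l v)
  then show ?thesis
    using assms by (cases v) (auto simp: reduced_word_Cons)
qed simp

lemma push_letter_inv:
  "reduced_word w \<Longrightarrow> push_letter k (push_letter (inv_letter k) w) = w"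
  using push_inv_letter[of w "inv_letter k"] by simp

lemma reduced_word_foldr: "reduced_word v \<Longrightarrow> reduced_word (foldr push_letter u v)"
  by (induction u) (auto intro: reduced_word_push)

lemma set_foldr_push_letter: "set (foldr push_letter u v) \<subseteq> set u \<union> set v"
proof (induction u)
  case (Cons k u)
  then show ?case using set_push_letter[of k "foldr push_letter u v"] by auto
qed simp

lemma foldr_push_push:
  assumes "reduced_word v"
  shows "foldr push_letter (push_letter k u) v = push_letter k (foldr push_letter u v)"
proof (cases u)
  case (Cons l w)
  then show ?thesis
    using assms by (auto simp: push_letter_inv reduced_word_foldr)
qed simp

lemma foldr_push_assoc:
  assumes "reduced_word w"
  shows "foldr push_letter (foldr push_letter u v) w = foldr push_letter u (foldr push_letter v w)"
  by (induction u) (simp_all add: foldr_push_push assms)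

lemma foldr_push_Nil: "reduced_word u \<Longrightarrow> foldr push_letter u [] = u"
proof (induction u)
  case (Cons k u)
  then show ?case by (cases u) (auto simp: reduced_word_Cons)
qed simp

lemma foldr_push_inverse:
  assumes "reduced_word v"
  shows "foldr push_letter (rev (map inv_letter u)) (foldr push_letter u v) = v"
  using assms
  by (induction u arbitrary: v) (simp_all add: push_inv_letter reduced_word_foldr)

lemma group_free_group: "group (free_group X)"
proof (rule groupI)
  fix u v assume "u \<in> carrier (free_group X)" "v \<in> carrier (free_group X)"
  then show "u \<otimes>\<^bsub>free_group X\<^esub> v \<in> carrier (free_group X)"
    using set_foldr_push_letter[of u v]
    by (auto simp: free_group_def reduced_word_foldr image_subset_iff)
next
  fix u assume u: "u \<in> carrier (free_group X)"
  define v where "v = foldr push_letter (rev (map inv_letter u)) []"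
  have "set v \<subseteq> inv_letter ` set u"
    unfolding v_def using set_foldr_push_letter[of "rev (map inv_letter u)" "[]"] by auto
  then have "fst ` set v \<subseteq> X"
    using u by (fastforce simp: free_group_def)
  then have "v \<in> carrier (free_group X)"
    by (simp add: v_def free_group_def reduced_word_foldr)
  moreover have "v \<otimes>\<^bsub>free_group X\<^esub> u = \<one>\<^bsub>free_group X\<^esub>"
    using u foldr_push_assoc[of u "rev (map inv_letter u)" "[]"]
      foldr_push_inverse[of "[]" u]
    by (simp add: free_group_def v_def foldr_push_Nil)
  ultimately show "\<exists>v\<in>carrier (free_group X). v \<otimes>\<^bsub>free_group X\<^esub> u = \<one>\<^bsub>free_group X\<^esub>"
    by blast
qed (auto simp: free_group_def foldr_push_assoc)


section \<open>The universal polynomial group\<close>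

definition normal_closure :: "('a, 'm) monoid_scheme \<Rightarrow> 'a set \<Rightarrow> 'a set"
  where "normal_closure G S = \<Inter> {N. N \<lhd> G \<and> S \<subseteq> N}"

definition pol_free :: "('a, 'm) monoid_scheme \<Rightarrow> ('a \<times> bool) list monoid"
  where "pol_free G = free_group (carrier G - {\<one>\<^bsub>G\<^esub>})"

definition pol_iota :: "('a, 'm) monoid_scheme \<Rightarrow> 'a \<Rightarrow> ('a \<times> bool) list"
  where "pol_iota G g = (if g = \<one>\<^bsub>G\<^esub> then \<one>\<^bsub>pol_free G\<^esub> else [(g, True)])"

definition pol_relations :: "('a, 'm) monoid_scheme \<Rightarrow> nat \<Rightarrow> ('a \<times> bool) list set"
  where "pol_relations G s = normal_closure (pol_free G)
    {pdiffs G (pol_free G) gs (pol_iota G) \<one>\<^bsub>G\<^esub> | gs. length gs = s + 1 \<and> set gs \<subseteq> carrier G}"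

definition Pol :: "nat \<Rightarrow> ('a, 'm) monoid_scheme \<Rightarrow> ('a \<times> bool) list set monoid"
  where "Pol s G = pol_free G Mod pol_relations G s"

lemma normal_normal_closure:
  assumes "group G" and "S \<subseteq> carrier G"
  shows "normal_closure G S \<lhd> G"
proof -
  interpret group G by fact
  have top: "carrier G \<lhd> G"
    by (simp add: normal_inv_iff subgroup_self)
  have "subgroup (normal_closure G S) G"
    unfolding normal_closure_def
    using top assms(2) by (intro subgroups_Inter) (auto intro: normal_imp_subgroup)
  then show ?thesis
    unfolding normal_inv_iff by (auto simp: normal_closure_def normal_inv_iff)
qed

lemma pdiffs_closed:
  assumes "group G" and "group H" and "f \<in> carrier G \<rightarrow> carrier H" and "set gs \<subseteq> carrier G"
  shows "pdiffs G H gs f \<in> carrier G \<rightarrow> carrier H"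
proof -
  interpret G: group G by fact
  interpret H: group H by fact
  show ?thesis
    using assms(4)
  proof (induction gs)
    case Nil
    then show ?case using assms(3) by (simp add: pdiffs_def)
  next
    case (Cons g gs)
    then have "pdiffs G H gs f \<in> carrier G \<rightarrow> carrier H" and "g \<in> carrier G" by auto
    then show ?case by (auto simp: pdiffs_def pdiff_def Pi_iff)
  qed
qed

lemma group_Pol:
  assumes "group G"
  shows "group (Pol s G)"
proof -
  interpret G: group G by fact
  have F: "group (pol_free G)" by (simp add: pol_free_def group_free_group)
  have iota: "pol_iota G \<in> carrier G \<rightarrow> carrier (pol_free G)"
    by (auto simp: pol_iota_def pol_free_def free_group_def reduced_word_Cons)
  have "pol_relations G s \<lhd> pol_free G"
    unfolding pol_relations_def
    using pdiffs_closed[OF assms F iota]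
    by (intro normal_normal_closure F) (auto simp: Pi_iff)
  then show ?thesis
    unfolding Pol_def by (rule normal.factorgroup_is_group)
qed


section \<open>Amenability, almost normal and profinitely closed subgroups\<close>

text \<open>Amenability of a discrete group: existence of a finitely additive, left-invariant
  probability measure defined on all subsets.\<close>

definition amenable_group :: "('a, 'm) monoid_scheme \<Rightarrow> bool"
  where "amenable_group G \<longleftrightarrow> group G \<and>
    (\<exists>\<mu> :: 'a set \<Rightarrow> real.
      \<mu> (carrier G) = 1 \<and>
      (\<forall>A. A \<subseteq> carrier G \<longrightarrow> 0 \<le> \<mu> A) \<and>
      (\<forall>A B. A \<subseteq> carrier G \<longrightarrow> B \<subseteq> carrier G \<longrightarrow> A \<inter> B = {} \<longrightarrow> \<mu> (A \<union> B) = \<mu> A + \<mu> B) \<and>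
      (\<forall>g A. g \<in> carrier G \<longrightarrow> A \<subseteq> carrier G \<longrightarrow> \<mu> (g <#\<^bsub>G\<^esub> A) = \<mu> A))"

definition almost_normal :: "('a, 'm) monoid_scheme \<Rightarrow> 'a set \<Rightarrow> bool"
  where "almost_normal G H \<longleftrightarrow> subgroup H G \<and>
    finite {g <#\<^bsub>G\<^esub> H #>\<^bsub>G\<^esub> inv\<^bsub>G\<^esub> g | g. g \<in> carrier G}"

definition profinitely_closed :: "('a, 'm) monoid_scheme \<Rightarrow> 'a set \<Rightarrow> bool"
  where "profinitely_closed G H \<longleftrightarrow>
    (\<exists>K :: nat \<Rightarrow> 'a set. (\<forall>i. subgroup (K i) G \<and> finite (rcosets\<^bsub>G\<^esub> (K i))) \<and> H = (\<Inter>i. K i))"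


section \<open>Stability in permutations\<close>

definition hamming_dist :: "nat \<Rightarrow> (nat \<Rightarrow> nat) \<Rightarrow> (nat \<Rightarrow> nat) \<Rightarrow> real"
  where "hamming_dist n \<sigma> \<tau> =
    1 - real (card {i \<in> {1..n}. (inv\<^bsub>sym_group n\<^esub> \<sigma> \<otimes>\<^bsub>sym_group n\<^esub> \<tau>) i = i}) / real n"

definition asymptotically_unital ::
    "('a, 'm) monoid_scheme \<Rightarrow> (nat \<Rightarrow> nat) \<Rightarrow> (nat \<Rightarrow> 'a \<Rightarrow> nat \<Rightarrow> nat) \<Rightarrow> bool"
  where "asymptotically_unital G m f \<longleftrightarrow>
    (\<forall>n. 0 < m n) \<and> (\<forall>n. f n \<in> carrier G \<rightarrow> carrier (sym_group (m n))) \<and>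
    (\<lambda>n. hamming_dist (m n) (f n \<one>\<^bsub>G\<^esub>) \<one>\<^bsub>sym_group (m n)\<^esub>) \<longlonglongrightarrow> 0"

definition almost_polynomial ::
    "('a, 'm) monoid_scheme \<Rightarrow> nat \<Rightarrow> (nat \<Rightarrow> nat) \<Rightarrow> (nat \<Rightarrow> 'a \<Rightarrow> nat \<Rightarrow> nat) \<Rightarrow> bool"
  where "almost_polynomial G s m f \<longleftrightarrow> asymptotically_unital G m f \<and>
    (\<forall>gs. length gs = s + 1 \<longrightarrow> set gs \<subseteq> carrier G \<longrightarrow>
      (\<lambda>n. hamming_dist (m n) (pdiffs G (sym_group (m n)) gs (f n) \<one>\<^bsub>G\<^esub>)
             \<one>\<^bsub>sym_group (m n)\<^esub>) \<longlonglongrightarrow> 0)"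

definition P_stable :: "nat \<Rightarrow> ('a, 'm) monoid_scheme \<Rightarrow> bool"
  where "P_stable s G \<longleftrightarrow>
    (\<forall>m f. almost_polynomial G s m f \<longrightarrow>
      (\<exists>\<rho> :: nat \<Rightarrow> 'a \<Rightarrow> nat \<Rightarrow> nat.
        (\<forall>n. polynomial_map G (sym_group (m n)) s (\<rho> n) \<and> unital_map G (sym_group (m n)) (\<rho> n)) \<and>
        (\<forall>g\<in>carrier G. (\<lambda>n. hamming_dist (m n) (\<rho> n g) (f n g)) \<longlonglongrightarrow> 0)))"

end

theory Submission
  imports Defs "HOL-Analysis.Function_Topology"
begin

text \<open>Unital polynomial maps of degree \<open>\<le> s\<close> on \<open>G\<close> are homomorphisms on \<open>P = Pol s G\<close>, and almost-polynomial
  sequences are asymptotic homomorphisms on \<open>P\<close>; so what has to be shown is that asymptotic actions of \<open>P\<close>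
  on finite sets are close to actions. Pass to a limit of the distributions of point stabilizers. The
  limit is a conjugation-invariant probability measure on the countable compact space of subgroups
  of \<open>P\<close>, hence purely atomic, and each atom \<open>H\<close> has finitely many conjugates. Where the
  stabilizer looks like \<open>H\<close>, the group \<open>\<Gamma> = N(H) / H\<close> acts almost freely. It is amenable, and residually
  finite since \<open>H\<close> is profinitely closed; so by Weiss it has Folner sets that are transversals of
  finite-index normal subgroups, and the Ornstein-Weiss quasi-tiling by such sets exhibits the
  action, after induction from \<open>N(H)\<close> to \<open>P\<close>, as an almost disjoint union of finite
  transitive \<open>P\<close>-sets.\<close>


subsection \<open>Compactness and matching\<close>

text \<open>Nothing exact is available at a finite stage: the stabilizer of a point under an almost
  action is only a set that passes finitely many subgroup tests, and the limit distribution is only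
  finitely additive. The mass of a point is therefore an infimum over cylinders, compactness of the
  space of subgroups replaces sigma-additivity, and countability enters through summable error
  budgets, one per subgroup. Uncountably many frequencies have to converge at once, so limits are
  taken along finer filters instead of subsequences. Transversals are wanted as tiles because such a
  tile is a Folner set and also a copy of a finite quotient, on which an exact action exists; only
  its boundary is sacrificed. The coset spaces may be larger than the pieces that they complete, so
  pieces are dropped until the coset spaces fit into the finite set. The room wasted is at most one
  coset space, which is harmless only if the degree tends to infinity; bounded degree is treated
  apart. All estimates concern a finite set of group elements and a fixed error, and a diagonal
  choice over an enumeration of \<open>G\<close> yields one sequence.\<close>

lemma bounded_family_cluster_filter:
  fixes u :: "'j \<Rightarrow> 'i \<Rightarrow> real" and F :: "'i filter"
  assumes F: "F \<noteq> bot" and bound: "\<And>j n. \<bar>u j n\<bar> \<le> c j"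
  obtains F' l where "F' \<noteq> bot" "F' \<le> F" "\<And>j. (u j \<longlongrightarrow> l j) F'"
proof -
  \<comment> \<open>By Tychonoff the product of the intervals is compact. The index type is
    arbitrary, later that of all families of subsets of a group, so a cluster point gives a finer
    filter but in general no subsequence.\<close>
  define K where "K = PiE UNIV (\<lambda>j. {- c j .. c j})"
  have "compactin (product_topology (\<lambda>j. euclideanreal) UNIV) K"
    unfolding K_def by (subst compactin_PiE) auto
  then have "compact K"
    by (simp add: euclidean_product_topology)
  define v where "v = (\<lambda>n j. u j n)"
  have "filtermap v F \<noteq> bot" using F by (simp add: filtermap_bot_iff)
  moreover have "eventually (\<lambda>x. x \<in> K) (filtermap v F)"
    using bound by (auto simp: eventually_filtermap K_def v_def abs_le_iff minus_le_iff PiE_iff intro!: always_eventually)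
  ultimately obtain l where l: "inf (nhds l) (filtermap v F) \<noteq> bot"
    using \<open>compact K\<close> unfolding compact_filter by blast
  \<comment> \<open>\<open>F'\<close> adds to \<open>F\<close> the preimages of the neighbourhoods
    of the cluster point \<open>l\<close>. That \<open>l\<close> clusters says that these preimages
    are compatible with \<open>F\<close>, so \<open>F'\<close> is proper.\<close>
  define F' where "F' = inf F (filtercomap v (nhds l))"
  have "F' \<noteq> bot"
  proof
    assume "F' = bot"
    then have "eventually (\<lambda>_. False) (inf F (filtercomap v (nhds l)))" by (simp add: F'_def)
    then obtain P Q where PQ: "eventually P F" "eventually Q (filtercomap v (nhds l))" "\<And>x. \<not> (P x \<and> Q x)"
      unfolding eventually_inf by blast
    then obtain R where R: "eventually R (nhds l)" "\<And>x. R (v x) \<Longrightarrow> Q x"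
      unfolding eventually_filtercomap by blast
    have "eventually (\<lambda>y. \<not> R y) (filtermap v F)"
      unfolding eventually_filtermap using PQ(1) by eventually_elim (use PQ(3) R(2) in blast)
    with R(1) have "eventually (\<lambda>_. False) (inf (nhds l) (filtermap v F))"
      unfolding eventually_inf by blast
    then show False using l by (simp add: eventually_False)
  qed
  moreover have "F' \<le> F" by (simp add: F'_def)
  moreover have "(u j \<longlongrightarrow> l j) F'" for j
  proof -
    have "(v \<longlongrightarrow> l) F'"
      unfolding F'_def by (rule tendsto_mono[OF inf_le2]) (rule filterlim_filtercomap)
    moreover have "continuous_on UNIV (\<lambda>x :: 'j \<Rightarrow> real. x j)" by simp
    ultimately show ?thesis
      using continuous_on_tendsto_compose[of UNIV "\<lambda>x :: 'j \<Rightarrow> real. x j" v l F']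
      by (simp add: v_def)
  qed
  ultimately show thesis by (rule that)
qed

text \<open>Rado's argument: in a minimal subfamily that satisfies Hall's condition all sets are singletons.\<close>

lemma infinite_Hall:
  fixes R :: "'i \<Rightarrow> 'b set"
  assumes fin: "\<And>i. finite (R i)"
    and Hall: "\<And>I. finite I \<Longrightarrow> I \<subseteq> U \<Longrightarrow> card I \<le> card (\<Union>i\<in>I. R i)"
  obtains f where "inj_on f U" "\<And>i. i \<in> U \<Longrightarrow> f i \<in> R i"
proof -
  define H where "H = (\<lambda>Q :: 'i \<Rightarrow> 'b set. (\<forall>i. Q i \<subseteq> R i) \<and> (\<forall>I. finite I \<longrightarrow> I \<subseteq> U \<longrightarrow> card I \<le> card (\<Union>i\<in>I. Q i)))"
  have "\<exists>M. H M \<and> (\<forall>Q. H Q \<longrightarrow> Q \<le> M \<longrightarrow> Q = M)"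
  proof -
    \<comment> \<open>A family is coded by its graph \<open>Sigma UNIV Q\<close>. Zorn's lemma
      yields maximal sets and is applied to the complements of the graphs, so that it produces a
      minimal family.\<close>
    define A where "A = {Sigma UNIV Q | Q. H Q}"
    define A' where "A' = uminus ` A"
    have "\<exists>M\<in>A'. \<forall>X\<in>A'. M \<subseteq> X \<longrightarrow> X = M"
    proof (rule subset_Zorn_nonempty)
      have "H R" using Hall by (simp add: H_def)
      then show "A' \<noteq> {}" by (auto simp: A'_def A_def)
    next
      fix C assume C: "C \<noteq> {}" "subset.chain A' C"
      have chainC: "\<And>X Y. X \<in> C \<Longrightarrow> Y \<in> C \<Longrightarrow> X \<subseteq> Y \<or> Y \<subseteq> X"
        using C(2) by (simp add: subset_chain_def)
      define D where "D = {Q. H Q \<and> - Sigma UNIV Q \<in> C}"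
      have CD: "C = (\<lambda>Q. - Sigma UNIV Q) ` D"
        using C(2) by (auto simp: D_def subset_chain_def A'_def A_def)
      have "D \<noteq> {}" using CD C(1) by auto
      have lin: "Q \<le> Q' \<or> Q' \<le> Q" if "Q \<in> D" "Q' \<in> D" for Q Q'
      proof -
        have "- Sigma UNIV Q \<in> C" "- Sigma UNIV Q' \<in> C" using that by (simp_all add: D_def)
        then have "- Sigma UNIV Q \<subseteq> - Sigma UNIV Q' \<or> - Sigma UNIV Q' \<subseteq> - Sigma UNIV Q"
          by (rule chainC)
        then have "Sigma UNIV Q' \<subseteq> Sigma UNIV Q \<or> Sigma UNIV Q \<subseteq> Sigma UNIV Q'" by (simp only: Compl_subset_Compl_iff)
        then show ?thesis
        proof
          assume "Sigma UNIV Q' \<subseteq> Sigma UNIV Q"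
          then have "Q' \<le> Q" by (auto intro!: le_funI)
          then show ?thesis ..
        next
          assume "Sigma UNIV Q \<subseteq> Sigma UNIV Q'"
          then have "Q \<le> Q'" by (auto intro!: le_funI)
          then show ?thesis ..
        qed
      qed
      define L where "L = (\<lambda>i. \<Inter>Q\<in>D. Q i)"
      have "H L"
        unfolding H_def
      proof (intro conjI allI impI)
        fix i
        obtain Q where "Q \<in> D" using \<open>D \<noteq> {}\<close> by blast
        then have "L i \<subseteq> Q i" by (auto simp: L_def)
        moreover have "Q i \<subseteq> R i" using \<open>Q \<in> D\<close> by (simp add: D_def H_def)
        ultimately show "L i \<subseteq> R i" by blast
      next
        fix I :: "'i set" assume I: "finite I" "I \<subseteq> U"
        have sub: "Q i \<subseteq> R i" if "Q \<in> D" for Q i using that by (auto simp: D_def H_def)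
        have finU: "finite (Sigma I Q)" if "Q \<in> D" for Q
          using I fin sub[OF that] by (meson finite_SigmaI finite_subset)
        \<comment> \<open>For a fixed finite \<open>I\<close> the finite sets
          \<open>Sigma I Q\<close> attain a least cardinality within the chain. No member of the
          chain is smaller over \<open>I\<close>, so this \<open>Q\<close> agrees with the
          intersection \<open>L\<close> on \<open>I\<close> and hands Hall's inequality over to
          it.\<close>
        obtain Q where Q: "Q \<in> D" "\<And>Q'. Q' \<in> D \<Longrightarrow> card (Sigma I Q) \<le> card (Sigma I Q')"
          using \<open>D \<noteq> {}\<close> ex_has_least_nat[of "\<lambda>Q. Q \<in> D" _ "\<lambda>Q. card (Sigma I Q)"] by blast
        have "Q i = L i" if "i \<in> I" for i
        proof -
          have "Q i \<subseteq> Q' i" if Q': "Q' \<in> D" for Q'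
          proof (cases "Q \<le> Q'")
            case False
            then have "Q' \<le> Q" using lin Q(1) Q' by blast
            then have "Sigma I Q' \<subseteq> Sigma I Q" by (auto simp: le_fun_def)
            then have "Sigma I Q' = Sigma I Q"
              using Q(2)[OF Q'] finU[OF Q(1)] by (meson card_seteq)
            then show ?thesis using \<open>i \<in> I\<close> by blast
          qed (auto simp: le_fun_def)
          then show ?thesis using Q(1) by (auto simp: L_def)
        qed
        then have "(\<Union>i\<in>I. L i) = (\<Union>i\<in>I. Q i)" by auto
        moreover have "H Q" using Q(1) by (simp add: D_def)
        ultimately show "card I \<le> card (\<Union>i\<in>I. L i)" using I by (simp add: H_def)
      qed
      then have "- Sigma UNIV L \<in> A'" by (auto simp: A'_def A_def)
      moreover have "\<Union>C = - Sigma UNIV L" by (auto simp: CD L_def)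
      ultimately show "\<Union>C \<in> A'" by simp
    qed
    then obtain Z where Z: "Z \<in> A'" "\<And>X. X \<in> A' \<Longrightarrow> Z \<subseteq> X \<Longrightarrow> X = Z" by auto
    obtain M where M: "H M" "Z = - Sigma UNIV M" using Z(1) by (auto simp: A'_def A_def)
    have "Q = M" if "H Q" "Q \<le> M" for Q
    proof -
      have "- Sigma UNIV M \<subseteq> - Sigma UNIV Q" using that(2) by (auto simp: le_fun_def)
      moreover have "- Sigma UNIV Q \<in> A'" using that(1) by (auto simp: A'_def A_def)
      ultimately have eq: "Sigma UNIV Q = Sigma UNIV M" using Z(2) M(2) by auto
      have "Q i = M i" for i
      proof -
        have "Q i = Sigma UNIV Q `` {i}" by auto
        also have "\<dots> = M i" unfolding eq by auto
        finally show ?thesis .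
      qed
      then show ?thesis by (rule HOL.ext)
    qed
    then show ?thesis using M(1) by blast
  qed
  then obtain M where M: "H M" and minM: "\<And>Q. H Q \<Longrightarrow> Q \<le> M \<Longrightarrow> Q = M" by blast
  have finM: "finite (M i)" for i using M fin by (meson H_def finite_subset)
  have hallM: "card I \<le> card (\<Union>i\<in>I. M i)" if "finite I" "I \<subseteq> U" for I
    using M that by (simp add: H_def)
  have uniq: "x = y" if i: "i \<in> U" and xy: "x \<in> M i" "y \<in> M i" for x y i
  proof (rule ccontr)
    assume ne: "x \<noteq> y"
    \<comment> \<open>By minimality, deleting \<open>z\<close> from \<open>M i\<close> breaks Hall's
      condition, and the violating index set must contain \<open>i\<close>. Dropping
      \<open>i\<close> from it turns the strict inequality into \<open>\<le>\<close>.\<close>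
    have ex: "\<exists>I. finite I \<and> I \<subseteq> U \<and> i \<notin> I \<and> card ((\<Union>j\<in>I. M j) \<union> (M i - {z})) \<le> card I" if z: "z \<in> M i" for z
    proof -
      define Q where "Q = M(i := M i - {z})"
      have Qi: "Q i = M i - {z}" by (simp add: Q_def)
      then have "Q i \<noteq> M i" using z by blast
      then have "Q \<noteq> M" by blast
      moreover have "Q \<le> M" by (auto simp: Q_def le_fun_def)
      ultimately have "\<not> H Q" using minM by blast
      then obtain J where J: "finite J" "J \<subseteq> U" "card (\<Union>j\<in>J. Q j) < card J"
        using M \<open>Q \<le> M\<close> by (force simp: H_def le_fun_def not_le)
      have "i \<in> J"
      proof (rule ccontr)
        assume "i \<notin> J"
        then have "(\<Union>j\<in>J. Q j) = (\<Union>j\<in>J. M j)" by (auto simp: Q_def)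
        then show False using J hallM[of J] by simp
      qed
      then have "(\<Union>j\<in>J. Q j) = (\<Union>j\<in>J - {i}. Q j) \<union> Q i"
        by blast
      also have "(\<Union>j\<in>J - {i}. Q j) = (\<Union>j\<in>J - {i}. M j)"
        by (rule SUP_cong) (simp_all add: Q_def)
      finally have "(\<Union>j\<in>J. Q j) = (\<Union>j\<in>J - {i}. M j) \<union> (M i - {z})"
        by (simp only: Qi)
      moreover have "card J = Suc (card (J - {i}))" using card_Suc_Diff1[OF J(1) \<open>i \<in> J\<close>] by simp
      ultimately show ?thesis using J by (intro exI[of _ "J - {i}"]) auto
    qed
    obtain I where I: "finite I" "I \<subseteq> U" "i \<notin> I" "card ((\<Union>j\<in>I. M j) \<union> (M i - {x})) \<le> card I" using ex[OF xy(1)] by blast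
    obtain J where J: "finite J" "J \<subseteq> U" "i \<notin> J" "card ((\<Union>j\<in>J. M j) \<union> (M i - {y})) \<le> card J" using ex[OF xy(2)] by blast
    define A where "A = (\<Union>j\<in>I. M j) \<union> (M i - {x})"
    define B where "B = (\<Union>j\<in>J. M j) \<union> (M i - {y})"
    have fAB: "finite A" "finite B" using I J finM by (auto simp: A_def B_def)
    \<comment> \<open>Submodularity: since \<open>x\<close> and \<open>y\<close> differ,
      \<open>A \<union> B\<close> contains all of \<open>M i\<close> and serves one index more than
      \<open>I \<union> J\<close>, while \<open>A \<inter> B\<close> serves
      \<open>I \<inter> J\<close>. Adding up contradicts the bounds on \<open>A\<close> and
      \<open>B\<close>.\<close>
    have "card (insert i (I \<union> J)) \<le> card (\<Union>j\<in>insert i (I \<union> J). M j)" using I J i by (intro hallM) auto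
    also have "(\<Union>j\<in>insert i (I \<union> J). M j) = A \<union> B" 
    proof -
      have "M i \<subseteq> A \<union> B" using ne by (auto simp: A_def B_def)
      then show ?thesis by (auto simp: A_def B_def)
    qed
    finally have 1: "Suc (card (I \<union> J)) \<le> card (A \<union> B)" using I J by simp
    have "card (I \<inter> J) \<le> card (\<Union>j\<in>I \<inter> J. M j)" using I by (intro hallM) auto
    also have "\<dots> \<le> card (A \<inter> B)" using fAB by (intro card_mono) (auto simp: A_def B_def)
    finally have 2: "card (I \<inter> J) \<le> card (A \<inter> B)" .
    have "card A + card B = card (A \<union> B) + card (A \<inter> B)" using fAB by (rule card_Un_Int)
    moreover have "card I + card J = card (I \<union> J) + card (I \<inter> J)" using I J by (intro card_Un_Int) auto
    ultimately show False using 1 2 I(4) J(4) unfolding A_def[symmetric] B_def[symmetric] by linarith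
  qed
  have "M i \<noteq> {}" if "i \<in> U" for i using that hallM[of "{i}"] by auto
  then have "\<forall>i\<in>U. \<exists>y. y \<in> M i" by blast
  from bchoice[OF this] obtain f where f: "\<And>i. i \<in> U \<Longrightarrow> f i \<in> M i" by auto
  have "inj_on f U"
  proof (rule inj_onI, rule ccontr)
    fix i j assume U: "i \<in> U" "j \<in> U" and ij: "f i = f j" "i \<noteq> j"
    have "M i \<subseteq> {f i}" using f[of i] uniq[of i] U by blast
    moreover have "M j \<subseteq> {f j}" using f[of j] uniq[of j] U by blast
    ultimately have "(\<Union>k\<in>{i, j}. M k) \<subseteq> {f i}" using ij(1) by simp
    then have "card (\<Union>k\<in>{i, j}. M k) \<le> 1" using card_mono[of "{f i}"] by simp
    then show False using hallM[of "{i, j}"] ij(2) U by simp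
  qed
  then show thesis using that f M by (meson H_def subsetD)
qed


subsection \<open>Folner sets\<close>

text \<open>Amenability with the mean as a parameter, so that a mean can be carried over to a
  subquotient.\<close>

definition invariant_mean :: "('a, 'm) monoid_scheme \<Rightarrow> ('a set \<Rightarrow> real) \<Rightarrow> bool"
  where "invariant_mean G \<mu> \<longleftrightarrow>
      \<mu> (carrier G) = 1 \<and>
      (\<forall>A. A \<subseteq> carrier G \<longrightarrow> 0 \<le> \<mu> A) \<and>
      (\<forall>A B. A \<subseteq> carrier G \<longrightarrow> B \<subseteq> carrier G \<longrightarrow> A \<inter> B = {} \<longrightarrow> \<mu> (A \<union> B) = \<mu> A + \<mu> B) \<and>
      (\<forall>g A. g \<in> carrier G \<longrightarrow> A \<subseteq> carrier G \<longrightarrow> \<mu> (g <#\<^bsub>G\<^esub> A) = \<mu> A)"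

lemma invariant_meanD:
  assumes "invariant_mean G \<mu>"
  shows "\<mu> (carrier G) = 1"
    and "A \<subseteq> carrier G \<Longrightarrow> 0 \<le> \<mu> A"
    and "A \<subseteq> carrier G \<Longrightarrow> B \<subseteq> carrier G \<Longrightarrow> A \<inter> B = {} \<Longrightarrow> \<mu> (A \<union> B) = \<mu> A + \<mu> B"
    and "g \<in> carrier G \<Longrightarrow> A \<subseteq> carrier G \<Longrightarrow> \<mu> (g <#\<^bsub>G\<^esub> A) = \<mu> A"
  using assms unfolding invariant_mean_def by blast+

lemma invariant_mean_UN:
  assumes \<mu>: "invariant_mean G \<mu>" and fin: "finite I"
    and sub: "\<And>i. i \<in> I \<Longrightarrow> A i \<subseteq> carrier G" and disj: "disjoint_family_on A I"
  shows "\<mu> (\<Union>i\<in>I. A i) = (\<Sum>i\<in>I. \<mu> (A i))"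
  using fin sub disj
proof (induction I)
  case empty
  have "\<mu> ({} \<union> {}) = \<mu> {} + \<mu> {}" using \<mu> by (intro invariant_meanD) auto
  then show ?case by simp
next
  case (insert i I)
  have "A i \<inter> (\<Union>i\<in>I. A i) = {}" using insert.prems(2) insert.hyps(2)
    by (auto simp: disjoint_family_on_def)
  then have "\<mu> (A i \<union> (\<Union>i\<in>I. A i)) = \<mu> (A i) + \<mu> (\<Union>i\<in>I. A i)"
    using insert.prems(1) by (intro invariant_meanD(3)[OF \<mu>]) auto
  also have "\<mu> (\<Union>i\<in>I. A i) = (\<Sum>i\<in>I. \<mu> (A i))"
    using insert.prems by (intro insert.IH) (auto simp: disjoint_family_on_def)
  finally show ?case using insert.hyps by simp
qed

lemma invariant_mean_le:
  assumes \<mu>: "invariant_mean G \<mu>" and "A \<subseteq> B" "B \<subseteq> carrier G"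
  shows "\<mu> A \<le> \<mu> B"
proof -
  have "\<mu> (A \<union> (B - A)) = \<mu> A + \<mu> (B - A)"
    using assms(2,3) by (intro invariant_meanD(3)[OF \<mu>]) auto
  moreover have "A \<union> (B - A) = B" using assms(2) by blast
  moreover have "0 \<le> \<mu> (B - A)" using assms(3) by (intro invariant_meanD(2)[OF \<mu>]) auto
  ultimately show ?thesis by simp
qed

definition folner_set :: "('a, 'm) monoid_scheme \<Rightarrow> 'a set \<Rightarrow> real \<Rightarrow> 'a set \<Rightarrow> bool"
  where "folner_set G E \<epsilon> T \<longleftrightarrow> finite T \<and> T \<noteq> {} \<and> T \<subseteq> carrier G \<and>
    (\<forall>e\<in>E. real (card {t \<in> T. e \<otimes>\<^bsub>G\<^esub> t \<notin> T}) \<le> \<epsilon> * real (card T))"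

text \<open>If no Folner set exists, products with a suitable finite set double cardinalities, and Hall's
  theorem yields a paradoxical decomposition, which the mean excludes.\<close>

lemma (in group) folner_set_exists:
  assumes \<mu>: "invariant_mean G \<mu>" and E: "finite E" "E \<subseteq> carrier G" and "\<epsilon> > 0"
  obtains T where "folner_set G E \<epsilon> T"
proof (rule ccontr)
  assume "\<not> thesis"
  then have no: "\<not> folner_set G E \<epsilon> T" for T using that by blast
  define E' where "E' = insert \<one> E"
  have E': "finite E'" "E' \<subseteq> carrier G" using E by (auto simp: E'_def)
  \<comment> \<open>With \<one> among the multipliers \<open>ex T\<close> contains \<open>T\<close>,
    so a failure of the Folner condition makes it larger than \<open>T\<close> by the factor 1 +
    \<epsilon>.\<close>
  define ex where "ex = (\<lambda>T. \<Union>e\<in>E'. (\<lambda>t. e \<otimes> t) ` T)"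
  have ex_fin: "finite (ex T)" if "finite T" for T using that E' by (auto simp: ex_def)
  have ex_sub: "ex T \<subseteq> carrier G" if "T \<subseteq> carrier G" for T using that E' by (auto simp: ex_def)
  have grow: "(1 + \<epsilon>) * card T \<le> card (ex T)" if T: "finite T" "T \<subseteq> carrier G" for T
  proof (cases "T = {}")
    case False
    then obtain e where e: "e \<in> E" "real (card {t \<in> T. e \<otimes> t \<notin> T}) > \<epsilon> * card T"
      using no[of T] T by (auto simp: folner_set_def not_le)
    have "T \<union> (\<lambda>t. e \<otimes> t) ` {t \<in> T. e \<otimes> t \<notin> T} \<subseteq> ex T"
    proof -
      have "T \<subseteq> (\<lambda>t. \<one> \<otimes> t) ` T" using T by force
      then show ?thesis using e(1) by (auto simp: ex_def E'_def)
    qed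
    then have "card (T \<union> (\<lambda>t. e \<otimes> t) ` {t \<in> T. e \<otimes> t \<notin> T}) \<le> card (ex T)"
      using ex_fin T by (intro card_mono) auto
    moreover have "card (T \<union> (\<lambda>t. e \<otimes> t) ` {t \<in> T. e \<otimes> t \<notin> T})
        = card T + card ((\<lambda>t. e \<otimes> t) ` {t \<in> T. e \<otimes> t \<notin> T})"
      using T by (intro card_Un_disjoint) auto
    moreover have "card ((\<lambda>t. e \<otimes> t) ` {t \<in> T. e \<otimes> t \<notin> T}) = card {t \<in> T. e \<otimes> t \<notin> T}"
      using T e(1) E by (intro card_image inj_onI) (auto simp: subset_iff)
    ultimately show ?thesis using e(2) by (simp add: algebra_simps)
  qed simp
  have grow_k: "(1 + \<epsilon>) ^ k * card T \<le> card ((ex ^^ k) T) \<and> finite ((ex ^^ k) T) \<and> (ex ^^ k) T \<subseteq> carrier G"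
    if T: "finite T" "T \<subseteq> carrier G" for T k
  proof (induction k)
    case (Suc k)
    have "(1 + \<epsilon>) ^ Suc k * card T \<le> (1 + \<epsilon>) * card ((ex ^^ k) T)"
      using Suc \<open>\<epsilon> > 0\<close> by (simp add: mult.assoc)
    also have "\<dots> \<le> card (ex ((ex ^^ k) T))" using Suc by (intro grow) auto
    finally show ?case using Suc ex_fin ex_sub by simp
  qed (use T in simp)
  obtain k where "2 < (1 + \<epsilon>) ^ k"
    using real_arch_pow[of "1 + \<epsilon>" 2] \<open>\<epsilon> > 0\<close> by auto
  then have double: "2 * card T \<le> card ((ex ^^ k) T)" if "finite T" "T \<subseteq> carrier G" for T
  proof -
    have "2 * real (card T) \<le> (1 + \<epsilon>) ^ k * card T"
      using \<open>2 < (1 + \<epsilon>) ^ k\<close> by (intro mult_right_mono) auto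
    then have "2 * real (card T) \<le> card ((ex ^^ k) T)" using grow_k[OF that, of k] by linarith
    then show ?thesis by linarith
  qed
  \<comment> \<open>Iterated expansion is left multiplication by one finite set \<open>W\<close>,
    the same for all \<open>T\<close>. This gives each \<open>x\<close> the finite candidate set
    \<open>W x\<close> for the matching.\<close>
  have W: "\<exists>W. finite W \<and> W \<subseteq> carrier G \<and> (\<forall>T. T \<subseteq> carrier G \<longrightarrow> (ex ^^ k) T = (\<Union>x\<in>T. (\<lambda>w. w \<otimes> x) ` W))" for k
  proof (induction k)
    case 0
    show ?case by (intro exI[of _ "{\<one>}"]) (auto simp: subset_iff)
  next
    case (Suc k)
    then obtain W where W: "finite W" "W \<subseteq> carrier G" "\<And>T. T \<subseteq> carrier G \<Longrightarrow> (ex ^^ k) T = (\<Union>x\<in>T. (\<lambda>w. w \<otimes> x) ` W)"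
      by auto
    have "(ex ^^ Suc k) T = (\<Union>x\<in>T. (\<lambda>w. w \<otimes> x) ` ex W)" if T: "T \<subseteq> carrier G" for T
    proof -
      have "(ex ^^ Suc k) T = (\<Union>x\<in>T. \<Union>e\<in>E'. \<Union>w\<in>W. {e \<otimes> (w \<otimes> x)})"
        using W(3)[OF T] by (auto simp: ex_def)
      also have "\<dots> = (\<Union>x\<in>T. \<Union>e\<in>E'. \<Union>w\<in>W. {(e \<otimes> w) \<otimes> x})"
        using T E' W(2) by (intro SUP_cong refl) (simp add: m_assoc subset_iff)
      also have "\<dots> = (\<Union>x\<in>T. (\<lambda>w. w \<otimes> x) ` ex W)" by (auto simp: ex_def)
      finally show ?thesis .
    qed
    then show ?case using W ex_fin ex_sub by (intro exI[of _ "ex W"]) auto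
  qed
  obtain W where W: "finite W" "W \<subseteq> carrier G" "\<And>T. T \<subseteq> carrier G \<Longrightarrow> (ex ^^ k) T = (\<Union>x\<in>T. (\<lambda>w. w \<otimes> x) ` W)"
    using W[of k] by auto
  \<comment> \<open>Every \<open>x\<close> is taken twice, once for each truth value. Doubling is
    Hall's condition, and an injective choice gives two disjoint copies of the group inside
    itself.\<close>
  define R where "R = (\<lambda>(x, b :: bool). (\<lambda>w. w \<otimes> x) ` W)"
  obtain f where f: "inj_on f (carrier G \<times> UNIV)" "\<And>i. i \<in> carrier G \<times> UNIV \<Longrightarrow> f i \<in> R i"
  proof (rule infinite_Hall[of R "carrier G \<times> UNIV"])
    fix i show "finite (R i)" using W by (auto simp: R_def split_beta)
  next
    fix I :: "('a \<times> bool) set" assume I: "finite I" "I \<subseteq> carrier G \<times> UNIV"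
    have "I \<subseteq> fst ` I \<times> UNIV" by force
    then have "card I \<le> card (fst ` I \<times> (UNIV :: bool set))" using I by (intro card_mono) auto
    also have "\<dots> = 2 * card (fst ` I)" by (simp add: card_cartesian_product)
    also have "\<dots> \<le> card ((ex ^^ k) (fst ` I))" using I by (intro double) auto
    also have "(ex ^^ k) (fst ` I) = (\<Union>i\<in>I. R i)" using I by (subst W(3)) (auto simp: R_def split_beta)
    finally show "card I \<le> card (\<Union>i\<in>I. R i)" .
  qed (use that in blast)
  have "\<forall>i\<in>carrier G \<times> UNIV. \<exists>w. w \<in> W \<and> f i = w \<otimes> fst i" using f(2) by (force simp: R_def split_beta)
  from bchoice[OF this] obtain c where "\<forall>i\<in>carrier G \<times> UNIV. c i \<in> W \<and> f i = c i \<otimes> fst i" ..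
  then have c: "c i \<in> W \<and> f i = c i \<otimes> fst i" if "i \<in> carrier G \<times> UNIV" for i using that by (rule bspec)
  \<comment> \<open>The copy with label \<open>b\<close> is cut up by the multiplier that was used.
    On each of the finitely many parts the map is a left translation and preserves the mean, so both
    copies have mean 1.\<close>
  define A where "A = (\<lambda>b w. {x \<in> carrier G. c (x, b) = w})"
  have A: "A b w \<subseteq> carrier G" for b w by (auto simp: A_def)
  have lc: "w <# A b w = (\<lambda>x. f (x, b)) ` A b w" for b w
    using c by (auto simp: l_coset_def A_def)
  have fcl: "f (x, b) \<in> carrier G" if "x \<in> carrier G" for x b
    using c[of "(x, b)"] that W(2) by auto
  have one: "\<mu> ((\<lambda>x. f (x, b)) ` carrier G) = 1" for b
  proof -
    have "(\<lambda>x. f (x, b)) ` carrier G = (\<Union>w\<in>W. (\<lambda>x. f (x, b)) ` A b w)"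
      using c by (force simp: A_def)
    also have "\<mu> \<dots> = (\<Sum>w\<in>W. \<mu> ((\<lambda>x. f (x, b)) ` A b w))"
    proof (rule invariant_mean_UN[OF \<mu> W(1)])
      show "disjoint_family_on (\<lambda>w. (\<lambda>x. f (x, b)) ` A b w) W"
        using f(1) by (auto simp: disjoint_family_on_def A_def inj_on_def)
    next
      show "(\<lambda>x. f (x, b)) ` A b w \<subseteq> carrier G" for w using fcl A[of b w] by blast
    qed
    also have "\<dots> = (\<Sum>w\<in>W. \<mu> (A b w))"
    proof (rule sum.cong)
      fix w assume "w \<in> W"
      then show "\<mu> ((\<lambda>x. f (x, b)) ` A b w) = \<mu> (A b w)"
        using A[of b w] W(2) unfolding lc[symmetric] by (intro invariant_meanD(4)[OF \<mu>]) auto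
    qed simp
    also have "\<dots> = \<mu> (\<Union>w\<in>W. A b w)"
      by (rule invariant_mean_UN[OF \<mu> W(1), symmetric]) (auto simp: A_def disjoint_family_on_def)
    also have "(\<Union>w\<in>W. A b w) = carrier G" using c by (auto simp: A_def)
    finally show ?thesis by (simp add: invariant_meanD(1)[OF \<mu>])
  qed
  have "(\<Sum>b\<in>UNIV. \<mu> ((\<lambda>x. f (x, b)) ` carrier G)) = \<mu> (\<Union>b\<in>UNIV. (\<lambda>x. f (x, b)) ` carrier G)"
    using f(1) fcl
    by (intro invariant_mean_UN[OF \<mu>, symmetric]) (auto simp: disjoint_family_on_def inj_on_def)
  also have "\<dots> \<le> \<mu> (carrier G)" using fcl by (intro invariant_mean_le[OF \<mu>]) auto
  also have "\<dots> = 1" by (simp add: invariant_meanD(1)[OF \<mu>])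
  finally show False by (simp add: one)
qed


subsection \<open>Quasi-tilings\<close>

text \<open>\<open>X\<close> carries only a partial action: staying inside, composition and freeness
  are required at the points of \<open>A\<close> alone. This form survives the removal of a covered
  region from \<open>X\<close>, on which the induction for the quasi-tiling depends.\<close>

definition approx_free :: "('g, 'm) monoid_scheme \<Rightarrow> 'g set \<Rightarrow> ('g \<Rightarrow> 'x \<Rightarrow> 'x) \<Rightarrow> 'x set \<Rightarrow> 'x set \<Rightarrow> bool"
  where "approx_free G B a X A \<longleftrightarrow> finite X \<and> A \<subseteq> X \<and> (\<forall>g\<in>B. inj_on (a g) X) \<and>
    (\<forall>x\<in>A. (\<forall>d\<in>B. a d x \<in> X) \<and> (\<forall>g\<in>B. \<forall>d\<in>B. a g (a d x) = a (g \<otimes>\<^bsub>G\<^esub> d) x) \<and>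
       inj_on (\<lambda>g. a g x) B)"

text \<open>The middle component is a label: the untrimmed tile in a tiling, a subgroup in an orbit
  piece.\<close>

definition piece :: "('g \<Rightarrow> 'x \<Rightarrow> 'x) \<Rightarrow> 'x \<times> 'g set \<times> 'g set \<Rightarrow> 'x set"
  where "piece a z = (\<lambda>d. a d (fst z)) ` snd (snd z)"

text \<open>A triple \<open>(c, T, D)\<close> places the tile \<open>T\<close> at the centre
  \<open>c\<close> and keeps the part \<open>D\<close> of it. Trimming, at a loss of at most the
  fraction \<epsilon>, makes the pieces exactly disjoint although full translates may
  overlap.\<close>

definition tiling :: "('g \<Rightarrow> 'x \<Rightarrow> 'x) \<Rightarrow> 'x set \<Rightarrow> 'x set \<Rightarrow> 'g set set \<Rightarrow> real \<Rightarrow> ('x \<times> 'g set \<times> 'g set) set \<Rightarrow> bool"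
  where "tiling a X A L \<epsilon> Z \<longleftrightarrow> finite Z \<and> disjoint_family_on (piece a) Z \<and>
    (\<forall>(c, T, D)\<in>Z. c \<in> A \<and> T \<in> L \<and> D \<subseteq> T \<and> (1 - \<epsilon>) * card T \<le> card D \<and>
       inj_on (\<lambda>d. a d c) T \<and> (\<lambda>d. a d c) ` T \<subseteq> X \<and> (\<lambda>d. a d c) ` D \<subseteq> X)"

lemma sum_card_swap:
  assumes "finite A" "finite T"
  shows "(\<Sum>x\<in>A. card {t \<in> T. P x t}) = (\<Sum>t\<in>T. card {x \<in> A. P x t})"
proof -
  have "(\<Sum>x\<in>A. card {t \<in> T. P x t}) = (\<Sum>x\<in>A. \<Sum>t\<in>T. if P x t then 1 else 0)"
    using assms by (intro sum.cong refl) (simp add: sum.If_cases Int_def)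
  also have "\<dots> = (\<Sum>t\<in>T. \<Sum>x\<in>A. if P x t then 1 else 0)" by (rule sum.swap)
  also have "\<dots> = (\<Sum>t\<in>T. card {x \<in> A. P x t})"
    using assms by (intro sum.cong refl) (simp add: sum.If_cases Int_def)
  finally show ?thesis .
qed

lemma (in group) card_Diff_translate:
  assumes "finite T" "T \<subseteq> carrier G" "b \<in> carrier G"
  shows "card (T - (\<lambda>t. b \<otimes> t) ` T) = card {t \<in> T. b \<otimes> t \<notin> T}"
proof -
  let ?b = "\<lambda>t. b \<otimes> t"
  have inj: "inj_on ?b S" if "S \<subseteq> T" for S
    using that assms by (intro inj_onI) (auto simp: subset_iff)
  have "card (T - ?b ` T) = card T - card (T \<inter> ?b ` T)"
    using assms by (intro card_Diff_subset_Int) auto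
  also have "\<dots> = card (?b ` T) - card (?b ` T \<inter> T)"
    using card_image[OF inj[of T]] by (simp add: Int_commute)
  also have "\<dots> = card (?b ` T - T)"
    using assms by (intro card_Diff_subset_Int[symmetric]) auto
  also have "?b ` T - T = ?b ` {t \<in> T. b \<otimes> t \<notin> T}" by auto
  also have "card \<dots> = card {t \<in> T. b \<otimes> t \<notin> T}" by (intro card_image inj) auto
  finally show ?thesis .
qed

lemma tilingD:
  assumes "tiling a X A L \<epsilon> Z" "(c, T, D) \<in> Z"
  shows "c \<in> A" "T \<in> L" "D \<subseteq> T" "(1 - \<epsilon>) * card T \<le> card D" "inj_on (\<lambda>d. a d c) T"
    "(\<lambda>d. a d c) ` T \<subseteq> X" "(\<lambda>d. a d c) ` D \<subseteq> X"
proof -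
  have "\<forall>(c, T, D)\<in>Z. c \<in> A \<and> T \<in> L \<and> D \<subseteq> T \<and> (1 - \<epsilon>) * card T \<le> card D \<and>
       inj_on (\<lambda>d. a d c) T \<and> (\<lambda>d. a d c) ` T \<subseteq> X \<and> (\<lambda>d. a d c) ` D \<subseteq> X"
    using assms(1) unfolding tiling_def by (elim conjE)
  from bspec[OF this assms(2)]
  show "c \<in> A" "T \<in> L" "D \<subseteq> T" "(1 - \<epsilon>) * card T \<le> card D" "inj_on (\<lambda>d. a d c) T"
    "(\<lambda>d. a d c) ` T \<subseteq> X" "(\<lambda>d. a d c) ` D \<subseteq> X"
    by simp_all
qed

lemma piece_subset:
  assumes "tiling a X A L \<epsilon> Z" "z \<in> Z"
  shows "piece a z \<subseteq> X"
proof -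
  obtain c T D where z: "z = (c, T, D)" by (cases z)
  then show ?thesis using tilingD(7)[OF assms(1), of c T D] assms(2) by (simp add: piece_def)
qed

lemma card_piece:
  assumes "tiling a X A L \<epsilon> Z" "z \<in> Z"
  shows "card (piece a z) = card (snd (snd z))"
proof -
  obtain c T D where z: "z = (c, T, D)" by (cases z)
  have "inj_on (\<lambda>d. a d c) T" "D \<subseteq> T" using tilingD[OF assms(1), of c T D] assms(2) z by auto
  then have "inj_on (\<lambda>d. a d c) D" by (rule inj_on_subset)
  then show ?thesis unfolding piece_def z by (simp add: card_image)
qed

text \<open>For a maximal family every translate of the tile meets the covered set in a proportion at least
  \<open>\<epsilon>\<close>; now count these incidences in two ways.\<close>

lemma (in group) greedy_tiling:
  assumes af: "approx_free G B a X A" and T: "finite T" "T \<noteq> {}" "T \<subseteq> B" and \<epsilon>: "0 < \<epsilon>" "\<epsilon> < 1"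
  obtains Z where "tiling a X A {T} \<epsilon> Z" "\<epsilon> * card A \<le> card (\<Union> (piece a ` Z))"
    "\<And>z. z \<in> Z \<Longrightarrow> (\<lambda>t. a t (fst z)) ` T \<subseteq> \<Union> (piece a ` Z)"
proof -
  have X: "finite X" "A \<subseteq> X" "\<And>g. g \<in> T \<Longrightarrow> inj_on (a g) X" using af T unfolding approx_free_def by auto
  have aX: "a t x \<in> X" if "x \<in> A" "t \<in> T" for x t using af T that unfolding approx_free_def by auto
  have injT: "inj_on (\<lambda>t. a t x) T" if "x \<in> A" for x
    using af T(3) that unfolding approx_free_def by (meson inj_on_subset)
  \<comment> \<open>The full translates of the tile, not only the trimmed pieces, have to be
    covered. The boundary count in the quasi-tiling relies on this: an uncovered point lies outside
    every full translate.\<close>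
  define Q where "Q = (\<lambda>Z. tiling a X A {T} \<epsilon> Z \<and> (\<forall>z\<in>Z. (\<lambda>t. a t (fst z)) ` T \<subseteq> \<Union> (piece a ` Z)))"
  have subX: "\<Union> (piece a ` Z) \<subseteq> X" if "Q Z" for Z
    using that piece_subset unfolding Q_def by (intro UN_least) fast
  have "Q {}" by (simp add: Q_def tiling_def disjoint_family_on_def)
  moreover have "\<forall>Z. Q Z \<longrightarrow> card (\<Union> (piece a ` Z)) \<le> card X"
    using subX X by (auto intro!: card_mono)
  ultimately obtain Z where Z: "Q Z" and maxZ: "\<And>Z'. Q Z' \<Longrightarrow> card (\<Union> (piece a ` Z')) \<le> card (\<Union> (piece a ` Z))"
    using ex_has_greatest_nat[of Q "{}" "\<lambda>Z. card (\<Union> (piece a ` Z))" "Suc (card X)"] by (auto simp: le_imp_less_Suc)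
  define C where "C = \<Union> (piece a ` Z)"
  have C: "finite C" "C \<subseteq> X" using subX[OF Z] X finite_subset by (auto simp: C_def)
  have many: "\<epsilon> * card T \<le> card {t \<in> T. a t x \<in> C}" if x: "x \<in> A" for x
  proof (rule ccontr)
    assume "\<not> ?thesis"
    then have less: "card {t \<in> T. a t x \<in> C} < \<epsilon> * card T" by simp
    \<comment> \<open>The uncovered part of the translate at \<open>x\<close> is an admissible
      trimmed tile and nonempty since \<epsilon> < 1, so adding it would enlarge the covered
      set.\<close>
    define D where "D = {t \<in> T. a t x \<notin> C}"
    have "card T = card D + card {t \<in> T. a t x \<in> C}"
      unfolding D_def using T by (subst card_Un_disjoint[symmetric]) (auto intro: arg_cong[where f = card])
    then have cD: "(1 - \<epsilon>) * card T \<le> card D" using less by (simp add: algebra_simps)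
    moreover have "0 < card T" using T by (simp add: card_gt_0_iff)
    ultimately have "0 < card D" using \<epsilon> by (smt (verit) mult_pos_pos of_nat_0_less_iff)
    then have D: "D \<noteq> {}" by auto
    define Z' where "Z' = insert (x, T, D) Z"
    have pz: "piece a (x, T, D) = (\<lambda>d. a d x) ` D" by (simp add: piece_def)
    have UZ': "\<Union> (piece a ` Z') = (\<lambda>d. a d x) ` D \<union> C" by (simp add: Z'_def C_def pz)
    have dis: "(\<lambda>d. a d x) ` D \<inter> C = {}" by (auto simp: D_def)
    have "Q Z'"
      unfolding Q_def
    proof (intro conjI ballI)
      show "tiling a X A {T} \<epsilon> Z'"
        unfolding tiling_def
      proof (intro conjI)
        show "finite Z'" using Z by (simp add: Z'_def Q_def tiling_def)
        have dz: "disjoint_family_on (piece a) Z" using Z by (simp add: Q_def tiling_def)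
        show "disjoint_family_on (piece a) Z'"
          unfolding disjoint_family_on_def
        proof (intro ballI impI)
          fix z z' assume zz: "z \<in> Z'" "z' \<in> Z'" "z \<noteq> z'"
          have "piece a w \<inter> piece a (x, T, D) = {}" if "w \<in> Z" for w
            using dis that unfolding pz C_def by blast
          moreover have "z \<in> Z \<and> z' \<in> Z \<or> z \<in> Z \<and> z' = (x, T, D) \<or> z = (x, T, D) \<and> z' \<in> Z"
            using zz unfolding Z'_def by blast
          ultimately show "piece a z \<inter> piece a z' = {}"
            using dz zz(3) unfolding disjoint_family_on_def by (elim disjE) (simp_all add: Int_commute)
        qed
        have new: "x \<in> A \<and> T \<in> {T} \<and> D \<subseteq> T \<and> (1 - \<epsilon>) * card T \<le> card D \<and>
          inj_on (\<lambda>d. a d x) T \<and> (\<lambda>d. a d x) ` T \<subseteq> X \<and> (\<lambda>d. a d x) ` D \<subseteq> X"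
          using x cD injT[OF x] aX[OF x] by (auto simp: D_def)
        show "\<forall>(c, T', D)\<in>Z'. c \<in> A \<and> T' \<in> {T} \<and> D \<subseteq> T' \<and> (1 - \<epsilon>) * card T' \<le> card D \<and>
          inj_on (\<lambda>d. a d c) T' \<and> (\<lambda>d. a d c) ` T' \<subseteq> X \<and> (\<lambda>d. a d c) ` D \<subseteq> X"
          using Z new unfolding Z'_def Q_def tiling_def by simp
      qed
    next
      fix z assume "z \<in> Z'"
      then consider "z = (x, T, D)" | "z \<in> Z" by (auto simp: Z'_def)
      then show "(\<lambda>t. a t (fst z)) ` T \<subseteq> \<Union> (piece a ` Z')"
      proof cases
        case 1
        then show ?thesis unfolding UZ' by (auto simp: D_def)
      next
        case 2
        then have "(\<lambda>t. a t (fst z)) ` T \<subseteq> C" using Z unfolding Q_def C_def by blast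
        then show ?thesis unfolding UZ' by (rule le_supI2)
      qed
    qed
    from maxZ[OF this] have "card ((\<lambda>d. a d x) ` D \<union> C) \<le> card C"
      by (simp only: UZ' C_def[symmetric])
    moreover have "card ((\<lambda>d. a d x) ` D \<union> C) = card ((\<lambda>d. a d x) ` D) + card C"
      using T C dis by (intro card_Un_disjoint) (auto simp: D_def)
    moreover have "card ((\<lambda>d. a d x) ` D) > 0" using D T by (auto simp: card_gt_0_iff D_def)
    ultimately show False by linarith
  qed
  have finA: "finite A" using X finite_subset by auto
  have "card A * (\<epsilon> * card T) = (\<Sum>x\<in>A. \<epsilon> * card T)" by simp
  also have "\<dots> \<le> (\<Sum>x\<in>A. real (card {t \<in> T. a t x \<in> C}))" by (intro sum_mono many)
  also have "\<dots> = real (\<Sum>t\<in>T. card {x \<in> A. a t x \<in> C})"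
    using sum_card_swap[OF finA T(1), of "\<lambda>x t. a t x \<in> C"] by (simp only: of_nat_sum[symmetric])
  \<comment> \<open>For a fixed \<open>t\<close> injectivity of \<open>a t\<close> allows at most
    \<open>card C\<close> points \<open>x\<close> with \<open>a t x\<close> in
    \<open>C\<close>.\<close>
  also have "\<dots> \<le> real (\<Sum>t\<in>T. card C)"
  proof (intro of_nat_mono sum_mono)
    fix t assume "t \<in> T"
    then have "inj_on (a t) {x \<in> A. a t x \<in> C}" using X(2) by (intro inj_on_subset[OF X(3)]) auto
    then show "card {x \<in> A. a t x \<in> C} \<le> card C" by (rule card_inj_on_le) (use C in auto)
  qed
  also have "\<dots> = card T * real (card C)" by simp
  finally have "card T * (\<epsilon> * card A) \<le> card T * real (card C)" by (simp add: mult_ac)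
  moreover have "0 < card T" using T by (simp add: card_gt_0_iff)
  ultimately have "\<epsilon> * card A \<le> card C" by simp
  then show thesis using that[of Z] Z unfolding C_def Q_def by blast
qed

lemma tiling_Un:
  assumes Z: "tiling a X A L \<epsilon> Z" and Z': "tiling a X' A' L' \<epsilon> Z'"
    and sub: "X' \<subseteq> X - \<Union> (piece a ` Z)" "A' \<subseteq> A"
  shows "tiling a X A (L \<union> L') \<epsilon> (Z \<union> Z')"
  unfolding tiling_def
proof (intro conjI ballI)
  show "finite (Z \<union> Z')" using Z Z' by (simp add: tiling_def)
  have d: "disjoint_family_on (piece a) Z" "disjoint_family_on (piece a) Z'" using Z Z' by (simp_all add: tiling_def)
  have ZZ': "piece a z \<inter> piece a z' = {}" "piece a z' \<inter> piece a z = {}" if "z \<in> Z" "z' \<in> Z'" for z z'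
    using piece_subset[OF Z' that(2)] sub(1) that(1) by fast+
  show "disjoint_family_on (piece a) (Z \<union> Z')"
    unfolding disjoint_family_on_def
  proof (intro ballI impI)
    fix z z' assume "z \<in> Z \<union> Z'" "z' \<in> Z \<union> Z'" and ne: "z \<noteq> z'"
    then consider "z \<in> Z" "z' \<in> Z" | "z \<in> Z" "z' \<in> Z'" | "z \<in> Z'" "z' \<in> Z" | "z \<in> Z'" "z' \<in> Z'" by blast
    then show "piece a z \<inter> piece a z' = {}"
      using d ne ZZ' by cases (simp_all add: disjoint_family_on_def)
  qed
next
  fix z assume z: "z \<in> Z \<union> Z'"
  obtain c T D where zz: "z = (c, T, D)" by (cases z)
  show "case z of (c, T, D) \<Rightarrow> c \<in> A \<and> T \<in> L \<union> L' \<and> D \<subseteq> T \<and> (1 - \<epsilon>) * card T \<le> card D \<and>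
       inj_on (\<lambda>d. a d c) T \<and> (\<lambda>d. a d c) ` T \<subseteq> X \<and> (\<lambda>d. a d c) ` D \<subseteq> X"
  proof (cases "z \<in> Z")
    case True
    then show ?thesis using tilingD[OF Z, of c T D] zz by simp
  next
    case False
    then have "(c, T, D) \<in> Z'" using z zz by blast
    from tilingD[OF Z' this] show ?thesis using sub zz by auto
  qed
qed

lemma card_covered:
  assumes "tiling a X A L \<epsilon> Z" "finite X"
  shows "card (\<Union> (piece a ` Z)) = (\<Sum>z\<in>Z. card (piece a z))"
proof (rule card_UN_disjoint)
  show "finite Z" using assms(1) by (simp add: tiling_def)
  show "\<forall>z\<in>Z. finite (piece a z)" using piece_subset[OF assms(1)] assms(2) finite_subset by blast
  show "\<forall>z\<in>Z. \<forall>z'\<in>Z. z \<noteq> z' \<longrightarrow> piece a z \<inter> piece a z' = {}"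
    using assms(1) by (simp add: tiling_def disjoint_family_on_def)
qed

text \<open>If \<open>x\<close> lands at \<open>t c\<close> with \<open>t = b t'\<close> and
  \<open>t'\<close> in \<open>T\<close>, injectivity of \<open>a b\<close> forces \<open>x\<close>
  to be \<open>t' c\<close>, a point of the translate. Points that enter from outside thus land at
  \<open>t c\<close> with \<open>t\<close> in \<open>T\<close> but not in \<open>b T\<close>, and
  there are as many such \<open>t\<close> as elements of \<open>T\<close> that \<open>b\<close>
  moves out of \<open>T\<close>.\<close>

lemma (in group) boundary_count:
  assumes inj: "inj_on (a b) X" and b: "b \<in> carrier G" and X: "finite X" and T: "finite T" "T \<subseteq> carrier G"
    and comp: "\<And>t. t \<in> T \<Longrightarrow> a t c \<in> X \<and> a b (a t c) = a (b \<otimes> t) c"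
  shows "card {x \<in> X - (\<lambda>t. a t c) ` T. a b x \<in> (\<lambda>t. a t c) ` T} \<le> card {t \<in> T. b \<otimes> t \<notin> T}"
proof -
  let ?S = "{x \<in> X - (\<lambda>t. a t c) ` T. a b x \<in> (\<lambda>t. a t c) ` T}"
  let ?U = "T - (\<lambda>t. b \<otimes> t) ` T"
  have "a b ` ?S \<subseteq> (\<lambda>t. a t c) ` ?U"
  proof
    fix y assume "y \<in> a b ` ?S"
    then obtain x t where x: "x \<in> X" "x \<notin> (\<lambda>t. a t c) ` T" "y = a b x" and t: "t \<in> T" "a b x = a t c" by auto
    have "t \<notin> (\<lambda>t. b \<otimes> t) ` T"
    proof
      assume "t \<in> (\<lambda>t. b \<otimes> t) ` T"
      then obtain t' where t': "t' \<in> T" "t = b \<otimes> t'" by auto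
      then have "a b x = a b (a t' c)" using t comp by simp
      then have "x = a t' c" using inj x comp[OF t'(1)] by (meson inj_onD)
      then show False using x t' by blast
    qed
    then show "y \<in> (\<lambda>t. a t c) ` ?U" using t x by blast
  qed
  then have "card (a b ` ?S) \<le> card ((\<lambda>t. a t c) ` ?U)" using T by (intro card_mono) auto
  also have "\<dots> \<le> card ?U" using T by (intro card_image_le) auto
  also have "\<dots> = card {t \<in> T. b \<otimes> t \<notin> T}" using T b by (rule card_Diff_translate)
  finally have "card (a b ` ?S) \<le> card {t \<in> T. b \<otimes> t \<notin> T}" .
  moreover have "card (a b ` ?S) = card ?S"
    by (rule card_image) (rule inj_on_subset[OF inj], auto)
  ultimately show ?thesis by simp
qed

text \<open>The quasi-tiling theorem of Ornstein and Weiss, with the scales chosen from the smallest to the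
  largest: the largest one is used first, and what it leaves uncovered is still almost
  invariant at the smaller scales.\<close>

theorem (in group) quasi_tiling:
  assumes tile: "\<And>T. T \<in> \<T> \<Longrightarrow> finite T \<and> T \<noteq> {} \<and> T \<subseteq> carrier G"
    and folner: "\<And>B \<kappa>. finite B \<Longrightarrow> B \<subseteq> carrier G \<Longrightarrow> 0 < \<kappa> \<Longrightarrow> \<exists>T\<in>\<T>. folner_set G B \<kappa> T"
    and \<epsilon>: "0 < \<epsilon>" "\<epsilon> < (1 :: real)"
  shows "\<exists>L B \<eta>. finite L \<and> L \<subseteq> \<T> \<and> finite B \<and> B \<subseteq> carrier G \<and> 0 < (\<eta> :: real) \<and>
    (\<forall>a (X :: 'x set) A. approx_free G B a X A \<longrightarrow> real (card (X - A)) \<le> \<eta> * card X \<longrightarrow>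
      (\<exists>Z. tiling a X A L \<epsilon> Z \<and> real (card (X - \<Union> (piece a ` Z))) \<le> (1 - \<epsilon> / 2) ^ k * card X))"
proof (induction k)
  case 0
  show ?case
  proof (rule exI[of _ "{}"], rule exI[of _ "{}"], rule exI[of _ 1], intro conjI allI impI)
    fix a and X A :: "'x set"
    show "\<exists>Z. tiling a X A {} \<epsilon> Z \<and> real (card (X - \<Union> (piece a ` Z))) \<le> (1 - \<epsilon> / 2) ^ 0 * card X"
      by (intro exI[of _ "{}"]) (simp add: tiling_def disjoint_family_on_def)
  qed simp_all
next
  case (Suc k)
  then obtain L B \<eta> where L: "finite L" "L \<subseteq> \<T>" and B: "finite B" "B \<subseteq> carrier G" and \<eta>: "0 < (\<eta> :: real)"
    and IH: "\<And>a (X :: 'x set) A. approx_free G B a X A \<Longrightarrow> real (card (X - A)) \<le> \<eta> * card X \<Longrightarrow>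
      \<exists>Z. tiling a X A L \<epsilon> Z \<and> real (card (X - \<Union> (piece a ` Z))) \<le> (1 - \<epsilon> / 2) ^ k * card X"
    by (elim exE conjE) blast
  \<comment> \<open>\<open>q\<close> is the target of this stage. If more than the fraction
    \<open>q\<close> of \<open>X\<close> stays uncovered after the greedy step, an error of \<eta> q
    relative to \<open>X\<close> is at most \<eta> relative to the rest. Half of \<eta> q is granted
    to the tile boundaries, which fixes \<kappa>; \<open>card B + 1\<close> keeps the divisor
    positive when \<open>B\<close> is empty.\<close>
  define q where "q = (1 - \<epsilon> / 2) ^ Suc k"
  have q: "0 < q" using \<epsilon> by (simp add: q_def)
  define \<kappa> where "\<kappa> = \<eta> * q * (1 - \<epsilon>) / (2 * (card B + 1))"
  have \<kappa>: "0 < \<kappa>" using \<eta> q \<epsilon> by (simp add: \<kappa>_def)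
  obtain T where T: "T \<in> \<T>" "folner_set G B \<kappa> T" using folner[OF B \<kappa>] by blast
  have finT: "finite T" "T \<noteq> {}" "T \<subseteq> carrier G" using tile[OF T(1)] by auto
  \<comment> \<open>The bound 1 / 2 keeps half of \<open>X\<close> in \<open>A\<close>, so that the
    greedy step covers the fraction \<epsilon> / 2 of \<open>X\<close>. The other bound is the
    second half of the allowance \<eta> q, spent on \<open>X - A\<close>.\<close>
  define \<eta>' where "\<eta>' = min (1 / 2) (\<eta> * q / 2)"
  have \<eta>': "0 < \<eta>'" "\<eta>' \<le> 1 / 2" "\<eta>' \<le> \<eta> * q / 2" using \<eta> q by (auto simp: \<eta>'_def)
  show ?case
  proof (rule exI[of _ "{T} \<union> L"], rule exI[of _ "B \<union> T"], rule exI[of _ \<eta>'], intro conjI allI impI)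
    show "finite ({T} \<union> L)" "{T} \<union> L \<subseteq> \<T>" "finite (B \<union> T)" "B \<union> T \<subseteq> carrier G" "0 < \<eta>'"
      using L B T finT \<eta>' by auto
    fix a and X A :: "'x set"
    assume af: "approx_free G (B \<union> T) a X A" and small: "real (card (X - A)) \<le> \<eta>' * card X"
    have X: "finite X" "A \<subseteq> X" and injX: "\<And>g. g \<in> B \<union> T \<Longrightarrow> inj_on (a g) X"
      and aX: "\<And>x d. x \<in> A \<Longrightarrow> d \<in> B \<union> T \<Longrightarrow> a d x \<in> X"
      and acomp: "\<And>x g d. x \<in> A \<Longrightarrow> g \<in> B \<union> T \<Longrightarrow> d \<in> B \<union> T \<Longrightarrow> a g (a d x) = a (g \<otimes> d) x"
      and ainj: "\<And>x. x \<in> A \<Longrightarrow> inj_on (\<lambda>g. a g x) (B \<union> T)"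
      using af unfolding approx_free_def by auto
    obtain Z where Z: "tiling a X A {T} \<epsilon> Z" and cov: "\<epsilon> * card A \<le> card (\<Union> (piece a ` Z))"
      and full: "\<And>z. z \<in> Z \<Longrightarrow> (\<lambda>t. a t (fst z)) ` T \<subseteq> \<Union> (piece a ` Z)"
      using greedy_tiling[OF af finT(1,2) _ \<epsilon>] by blast
    define C where "C = \<Union> (piece a ` Z)"
    have CX: "C \<subseteq> X" unfolding C_def using piece_subset[OF Z] by (rule UN_least)
    have cC: "\<epsilon> / 2 * card X \<le> card C"
    proof -
      have "card (X - A) = card X - card A" using X finite_subset[OF X(2,1)] by (intro card_Diff_subset)
      moreover have "card A \<le> card X" using X by (intro card_mono)
      ultimately have "real (card A) = card X - real (card (X - A))" by simp
      moreover have "\<eta>' * card X \<le> 1 / 2 * card X" using \<eta>'(2) by (rule mult_right_mono) simp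
      ultimately have "1 / 2 * card X \<le> real (card A)" using small by linarith
      then have "\<epsilon> * (1 / 2 * card X) \<le> \<epsilon> * card A" using \<epsilon> by (intro mult_left_mono) auto
      then show ?thesis using cov C_def by simp
    qed
    define X' where "X' = X - C"
    have cX': "real (card X') = card X - real (card C)"
      unfolding X'_def using CX X card_mono[OF X(1) CX] by (simp add: card_Diff_subset finite_subset)
    then have X'le: "real (card X') \<le> (1 - \<epsilon> / 2) * card X" using cC by (simp add: algebra_simps)
    show "\<exists>Z. tiling a X A ({T} \<union> L) \<epsilon> Z \<and> real (card (X - \<Union> (piece a ` Z))) \<le> (1 - \<epsilon> / 2) ^ Suc k * card X"
    proof (cases "real (card X') \<le> q * card X")
      case True
      have "tiling a X A ({T} \<union> L) \<epsilon> (Z \<union> {})"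
        by (rule tiling_Un[OF Z, of "{}" "{}"]) (auto simp: tiling_def disjoint_family_on_def)
      then show ?thesis using True unfolding X'_def C_def q_def by (intro exI[of _ Z]) simp
    next
      case False
      define A' where "A' = {x \<in> A - C. \<forall>b\<in>B. a b x \<in> X'}"
      have "approx_free G B a X' A'"
        unfolding approx_free_def
      proof (intro conjI ballI)
        show "finite X'" using X by (simp add: X'_def)
        show "A' \<subseteq> X'" using X by (auto simp: A'_def X'_def)
        show "inj_on (a g) X'" if "g \<in> B" for g using injX[of g] that by (auto simp: X'_def inj_on_def)
        show "a d x \<in> X'" if "x \<in> A'" "d \<in> B" for x d using that by (simp add: A'_def)
        show "a g (a d x) = a (g \<otimes> d) x" if "x \<in> A'" "g \<in> B" "d \<in> B" for x g d
          using that by (intro acomp) (auto simp: A'_def)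
        show "inj_on (\<lambda>g. a g x) B" if "x \<in> A'" for x
          using ainj[of x] that by (auto simp: A'_def inj_on_def)
      qed
      moreover have "real (card (X' - A')) \<le> \<eta> * card X'"
      proof -
        \<comment> \<open>An uncovered point of \<open>A\<close> that drops out of \<open>A'\<close>
          is moved by some \<open>b\<close> into a piece, hence into a full translate of the tile,
          while it lies outside that translate because full translates are covered. So
          \<open>boundary_count\<close> applies.\<close>
        define S where "S = (\<lambda>b (z :: 'x \<times> 'a set \<times> 'a set). {x \<in> X - (\<lambda>t. a t (fst z)) ` T. a b x \<in> (\<lambda>t. a t (fst z)) ` T})"
        have "X' - A' \<subseteq> (X - A) \<union> (\<Union>b\<in>B. \<Union>z\<in>Z. S b z)"
        proof
          fix x assume x: "x \<in> X' - A'"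
          show "x \<in> (X - A) \<union> (\<Union>b\<in>B. \<Union>z\<in>Z. S b z)"
          proof (cases "x \<in> A")
            case True
            then obtain b where b: "b \<in> B" "a b x \<notin> X'" using x by (auto simp: A'_def X'_def)
            then have "a b x \<in> C" using aX[OF True, of b] by (simp add: X'_def)
            then obtain z where z: "z \<in> Z" "a b x \<in> piece a z" by (auto simp: C_def)
            obtain c T' D where zz: "z = (c, T', D)" by (cases z)
            have "T' = T" "D \<subseteq> T'" using tilingD[OF Z, of c T' D] z zz by auto
            then have "a b x \<in> (\<lambda>t. a t (fst z)) ` T" using z(2) zz by (auto simp: piece_def)
            moreover have "x \<notin> (\<lambda>t. a t (fst z)) ` T" using full[OF z(1)] x unfolding X'_def C_def by blast
            ultimately have "x \<in> S b z" using x unfolding S_def X'_def by blast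
            then show ?thesis using b z by blast
          qed (use x in \<open>simp add: X'_def\<close>)
        qed
        then have "card (X' - A') \<le> card ((X - A) \<union> (\<Union>b\<in>B. \<Union>z\<in>Z. S b z))"
          using X B Z by (intro card_mono) (auto simp: S_def tiling_def)
        also have "\<dots> \<le> card (X - A) + card (\<Union>b\<in>B. \<Union>z\<in>Z. S b z)" by (rule card_Un_le)
        also have "card (\<Union>b\<in>B. \<Union>z\<in>Z. S b z) \<le> (\<Sum>b\<in>B. card (\<Union>z\<in>Z. S b z))"
          using B by (intro card_UN_le) auto
        also have "\<dots> \<le> (\<Sum>b\<in>B. \<Sum>z\<in>Z. card (S b z))"
          using Z by (intro sum_mono card_UN_le) (auto simp: tiling_def)
        finally have 1: "real (card (X' - A')) \<le> real (card (X - A)) + (\<Sum>b\<in>B. \<Sum>z\<in>Z. real (card (S b z)))"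
          by (simp add: of_nat_sum[symmetric] del: of_nat_sum)
        have cS: "real (card (S b z)) \<le> \<kappa> * card T" if "b \<in> B" "z \<in> Z" for b z
        proof -
          obtain c T' D where zz: "z = (c, T', D)" by (cases z)
          have c: "c \<in> A" using tilingD[OF Z, of c T' D] that zz by auto
          have "card (S b z) \<le> card {t \<in> T. b \<otimes> t \<notin> T}"
            unfolding S_def zz fst_conv
            using that B finT X c injX aX acomp by (intro boundary_count) auto
          also have "real \<dots> \<le> \<kappa> * card T" using T(2) that by (simp add: folner_set_def)
          finally show ?thesis by simp
        qed
        have "(\<Sum>b\<in>B. \<Sum>z\<in>Z. real (card (S b z))) \<le> (\<Sum>b\<in>B. \<Sum>z\<in>Z. \<kappa> * card T)"
          by (intro sum_mono cS)
        also have "\<dots> = card B * (card Z * (\<kappa> * card T))" by simp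
        \<comment> \<open>The number of pieces is controlled by disjointness: each has at least (1 -
          \<epsilon>) \<open>card T\<close> points of \<open>X\<close>.\<close>
        also have "\<dots> = card B * \<kappa> / (1 - \<epsilon>) * (card Z * ((1 - \<epsilon>) * card T))" using \<epsilon> by simp
        also have "\<dots> \<le> card B * \<kappa> / (1 - \<epsilon>) * card X"
        proof (rule mult_left_mono)
          have "card Z * ((1 - \<epsilon>) * card T) = (\<Sum>z\<in>Z. (1 - \<epsilon>) * card T)" by simp
          also have "\<dots> \<le> (\<Sum>z\<in>Z. real (card (piece a z)))"
          proof (rule sum_mono)
            fix z assume z: "z \<in> Z"
            obtain c T' D where zz: "z = (c, T', D)" by (cases z)
            then show "(1 - \<epsilon>) * card T \<le> real (card (piece a z))"
              using tilingD[OF Z, of c T' D] card_piece[OF Z z] z by simp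
          qed
          also have "\<dots> = real (card C)"
            using card_covered[OF Z X(1)] by (simp add: C_def)
          also have "\<dots> \<le> card X" using CX X by (simp add: card_mono)
          finally show "card Z * ((1 - \<epsilon>) * card T) \<le> real (card X)" .
        qed (use \<epsilon> \<kappa> in auto)
        also have "\<dots> \<le> \<eta> * q / 2 * card X"
        proof (rule mult_right_mono)
          have "\<kappa> / (1 - \<epsilon>) = \<eta> * q / (2 * (card B + 1))" using \<epsilon> by (simp add: \<kappa>_def)
          then have "card B * \<kappa> / (1 - \<epsilon>) = card B * (\<eta> * q / (2 * (card B + 1)))"
            by (metis times_divide_eq_right)
          also have "\<dots> = \<eta> * q / 2 * (card B / (card B + 1))" by simp
          finally have "card B * \<kappa> / (1 - \<epsilon>) = \<eta> * q / 2 * (card B / (card B + 1))" .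
          also have "\<dots> \<le> \<eta> * q / 2 * 1" using \<eta> q by (intro mult_left_mono) auto
          finally show "card B * \<kappa> / (1 - \<epsilon>) \<le> \<eta> * q / 2" by simp
        qed simp
        finally have 2: "(\<Sum>b\<in>B. \<Sum>z\<in>Z. real (card (S b z))) \<le> \<eta> * q / 2 * card X" .
        have "\<eta>' * card X \<le> \<eta> * q / 2 * card X" using \<eta>'(3) by (rule mult_right_mono) simp
        then have "real (card (X' - A')) \<le> \<eta> * (q * card X)" using 1 2 small by (simp add: algebra_simps)
        also have "\<dots> \<le> \<eta> * card X'" using False \<eta> by (intro mult_left_mono) auto
        finally show ?thesis .
      qed
      ultimately obtain Z' where Z': "tiling a X' A' L \<epsilon> Z'" "real (card (X' - \<Union> (piece a ` Z'))) \<le> (1 - \<epsilon> / 2) ^ k * card X'"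
        using IH by blast
      have "tiling a X A ({T} \<union> L) \<epsilon> (Z \<union> Z')"
        by (rule tiling_Un[OF Z Z'(1)]) (auto simp: X'_def C_def A'_def)
      moreover have "X - \<Union> (piece a ` (Z \<union> Z')) = X' - \<Union> (piece a ` Z')" by (auto simp: X'_def C_def)
      moreover have "(1 - \<epsilon> / 2) ^ k * card X' \<le> (1 - \<epsilon> / 2) ^ k * ((1 - \<epsilon> / 2) * card X)"
        using X'le \<epsilon> by (intro mult_left_mono) auto
      ultimately show ?thesis using Z'(2) by (intro exI[of _ "Z \<union> Z'"]) (simp add: mult_ac)
    qed
  qed
qed


subsection \<open>Folner transversals\<close>

lemma (in group) left_cancel:
  "x \<in> carrier G \<Longrightarrow> y \<in> carrier G \<Longrightarrow> z \<in> carrier G \<Longrightarrow> x \<otimes> y = x \<otimes> z \<longleftrightarrow> y = z"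
  by simp

lemma (in group) rcos_eq_iff:
  assumes "subgroup K G" "x \<in> carrier G" "y \<in> carrier G"
  shows "K #> x = K #> y \<longleftrightarrow> x \<otimes> inv y \<in> K"
proof -
  interpret K: subgroup K G by fact
  have "K #> x = K #> y \<longleftrightarrow> x \<in> K #> y"
    using repr_independence[OF _ assms(3,1), of x] rcos_self[OF assms(2,1)] by auto
  also have "\<dots> \<longleftrightarrow> x \<otimes> inv y \<in> K" using assms by (simp add: K.rcos_module is_group)
  finally show ?thesis .
qed

lemma tiling_inj:
  assumes "tiling a X A L \<epsilon> Z" "z \<in> Z" "z' \<in> Z" "x \<in> piece a z" "x \<in> piece a z'"
  shows "z = z'"
proof (rule ccontr)
  assume "z \<noteq> z'"
  then have "piece a z \<inter> piece a z' = {}" using assms(1-3) by (simp add: tiling_def disjoint_family_on_def)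
  then show False using assms(4,5) by blast
qed

lemma folner_set_mono:
  assumes "folner_set G E \<epsilon> T" "E' \<subseteq> E" "\<epsilon> \<le> \<epsilon>'"
  shows "folner_set G E' \<epsilon>' T"
proof -
  have "\<epsilon> * card T \<le> \<epsilon>' * card T" using assms(3) by (rule mult_right_mono) simp
  then show ?thesis using assms(1,2) unfolding folner_set_def by force
qed

text \<open>A point of \<open>D\<close> that leaves \<open>D\<close> either leaves \<open>T\<close>
  or is moved into \<open>T - D\<close>; the latter is counted by injectivity of the
  translation.\<close>

lemma (in group) card_boundary_subset:
  assumes "finite T" "T \<subseteq> carrier G" "D \<subseteq> T" "e \<in> carrier G"
  shows "card {d \<in> D. e \<otimes> d \<notin> D} \<le> card {t \<in> T. e \<otimes> t \<notin> T} + (card T - card D)"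
proof -
  have fin: "finite D" "D \<subseteq> carrier G" using assms finite_subset by auto
  have "{d \<in> D. e \<otimes> d \<notin> D} \<subseteq> {t \<in> T. e \<otimes> t \<notin> T} \<union> {d \<in> D. e \<otimes> d \<in> T - D}" using assms by blast
  then have "card {d \<in> D. e \<otimes> d \<notin> D} \<le> card ({t \<in> T. e \<otimes> t \<notin> T} \<union> {d \<in> D. e \<otimes> d \<in> T - D})"
    using assms fin by (intro card_mono) auto
  also have "\<dots> \<le> card {t \<in> T. e \<otimes> t \<notin> T} + card {d \<in> D. e \<otimes> d \<in> T - D}" by (rule card_Un_le)
  also have "card {d \<in> D. e \<otimes> d \<in> T - D} \<le> card (T - D)"
    using assms fin by (intro card_inj_on_le[of "\<lambda>d. e \<otimes> d"] inj_onI) (auto simp: subset_iff)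
  also have "card (T - D) = card T - card D" using assms fin by (intro card_Diff_subset)
  finally show ?thesis by simp
qed

text \<open>Weiss: a quasi-tiling of a large finite quotient lifts piece by piece to a Folner
  transversal.\<close>

theorem (in group) folner_transversal:
  assumes folner: "\<And>E \<epsilon>. finite E \<Longrightarrow> E \<subseteq> carrier G \<Longrightarrow> 0 < \<epsilon> \<Longrightarrow> \<exists>T. folner_set G E \<epsilon> T"
    and rf: "\<And>B. finite B \<Longrightarrow> B \<subseteq> carrier G \<Longrightarrow> \<one> \<notin> B \<Longrightarrow> \<exists>K. K \<lhd> G \<and> finite (rcosets K) \<and> K \<inter> B = {}"
    and E: "finite E" "E \<subseteq> carrier G" and \<delta>: "0 < \<delta>"
  shows "\<exists>T K. folner_set G E \<delta> T \<and> K \<lhd> G \<and> finite (rcosets K) \<and> bij_betw (\<lambda>t. K #> t) T (rcosets K)"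
proof -
  \<comment> \<open>Uncovered cosets cost \<epsilon>. The boundary of a trimmed tile costs 2
    \<epsilon> \<open>card T\<close>, at most 4 \<epsilon> times its own size because \<epsilon>
    \<le> 1 / 2. The total 5 \<epsilon> stays below \<delta>.\<close>
  define \<epsilon> where "\<epsilon> = min (1 / 2) (\<delta> / 8)"
  have \<epsilon>: "0 < \<epsilon>" "\<epsilon> < 1" "\<epsilon> \<le> 1 / 2" "8 * \<epsilon> \<le> \<delta>" using \<delta> by (auto simp: \<epsilon>_def)
  define \<T> where "\<T> = {T. folner_set G E \<epsilon> T}"
  obtain k where k: "(1 - \<epsilon> / 2) ^ k < \<epsilon>" using real_arch_pow_inv[of \<epsilon> "1 - \<epsilon> / 2"] \<epsilon> by auto
  have "\<exists>L B \<eta>. finite L \<and> L \<subseteq> \<T> \<and> finite B \<and> B \<subseteq> carrier G \<and> 0 < (\<eta> :: real) \<and>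
    (\<forall>a (X :: 'a set set) A. approx_free G B a X A \<longrightarrow> real (card (X - A)) \<le> \<eta> * card X \<longrightarrow>
      (\<exists>Z. tiling a X A L \<epsilon> Z \<and> real (card (X - \<Union> (piece a ` Z))) \<le> (1 - \<epsilon> / 2) ^ k * card X))"
  proof (rule quasi_tiling)
    fix B and \<kappa> :: real assume "finite B" "B \<subseteq> carrier G" "0 < \<kappa>"
    then obtain T where "folner_set G (E \<union> B) (min \<epsilon> \<kappa>) T" using folner[of "E \<union> B" "min \<epsilon> \<kappa>"] E \<epsilon> by auto
    then show "\<exists>T\<in>\<T>. folner_set G B \<kappa> T"
      unfolding \<T>_def by (intro bexI[of _ T]) (auto elim!: folner_set_mono)
  qed (use \<epsilon> in \<open>auto simp: \<T>_def folner_set_def\<close>)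
  then obtain L B \<eta> where L: "L \<subseteq> \<T>" and B: "finite B" "B \<subseteq> carrier G" and \<eta>: "0 < (\<eta> :: real)"
    and Q: "\<And>a (X :: 'a set set) A. approx_free G B a X A \<Longrightarrow> real (card (X - A)) \<le> \<eta> * card X \<Longrightarrow>
      \<exists>Z. tiling a X A L \<epsilon> Z \<and> real (card (X - \<Union> (piece a ` Z))) \<le> (1 - \<epsilon> / 2) ^ k * card X"
    by (elim exE conjE) blast
  \<comment> \<open>\<open>K\<close> avoids the nontrivial quotients of elements of
    \<open>B\<close>, so \<open>B\<close> embeds into the finite quotient and acts freely there by
    left multiplication. All points are good, and \<open>X\<close> itself serves as
    \<open>A\<close>.\<close>
  obtain K where K: "K \<lhd> G" "finite (rcosets K)" and KB: "K \<inter> ((\<lambda>(g, d). g \<otimes> inv d) ` (B \<times> B) - {\<one>}) = {}"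
    using rf[of "(\<lambda>(g, d). g \<otimes> inv d) ` (B \<times> B) - {\<one>}"] B by force
  interpret K: normal K G by (rule K(1))
  interpret Q: group "G Mod K" by (rule K.factorgroup_is_group)
  define X where "X = rcosets K"
  have X: "finite X" "X = carrier (G Mod K)" using K by (auto simp: X_def FactGroup_def)
  define a where "a = (\<lambda>g C. (K #> g) \<otimes>\<^bsub>G Mod K\<^esub> C)"
  have aK: "a g (K #> x) = K #> (g \<otimes> x)" if "g \<in> carrier G" "x \<in> carrier G" for g x
    using that by (simp add: a_def FactGroup_def K.rcos_sum)
  have cos: "K #> g \<in> X" if "g \<in> carrier G" for g using that by (auto simp: X_def RCOSETS_def)
  have rep: "\<exists>x\<in>carrier G. C = K #> x" if "C \<in> X" for C using that by (auto simp: X_def RCOSETS_def)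
  then obtain r where r: "\<And>C. C \<in> X \<Longrightarrow> r C \<in> carrier G" "\<And>C. C \<in> X \<Longrightarrow> K #> r C = C" by metis
  have ar: "a g C = K #> (g \<otimes> r C)" if "g \<in> carrier G" "C \<in> X" for g C
    using aK[of g "r C"] r that by simp
  have "approx_free G B a X X"
    unfolding approx_free_def
  proof (intro conjI ballI)
    fix g assume "g \<in> B"
    then show "inj_on (a g) X"
    proof (intro inj_onI)
      fix C D assume CD: "C \<in> X" "D \<in> X" "a g C = a g D"
      have "g \<in> carrier G" using \<open>g \<in> B\<close> B by blast
      then have "K #> g \<in> carrier (G Mod K)" using cos X(2) by blast
      then show "C = D" using CD Q.left_cancel[of "K #> g" C D] unfolding a_def X(2) by blast
    qed
  next
    fix C d assume "C \<in> X" "d \<in> B"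
    then show "a d C \<in> X" using B ar[of d C] cos[of "d \<otimes> r C"] r by auto
  next
    fix C g d assume "C \<in> X" "g \<in> B" "d \<in> B"
    then show "a g (a d C) = a (g \<otimes> d) C"
      using B r ar[of d C] ar[of "g \<otimes> d" C] aK[of g "d \<otimes> r C"] by (auto simp: m_assoc subset_iff)
  next
    fix C assume C: "C \<in> X"
    show "inj_on (\<lambda>g. a g C) B"
    proof (rule inj_onI)
      fix g d assume gd: "g \<in> B" "d \<in> B" "a g C = a d C"
      have gc: "g \<in> carrier G" "d \<in> carrier G" using gd B by auto
      have "K #> g = K #> d"
        using gd(3) C cos[OF gc(1)] cos[OF gc(2)] unfolding a_def X(2) by (metis Q.right_cancel)
      then have "g \<otimes> inv d \<in> K" using rcos_eq_iff[OF K.subgroup_axioms gc] by simp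
      moreover have "g \<otimes> inv d \<in> (\<lambda>(g, d). g \<otimes> inv d) ` (B \<times> B)" using gd by force
      ultimately have "g \<otimes> inv d = \<one>" using KB by blast
      then show "g = d" using gc by (metis inv_closed inv_equality inv_inv)
    qed
  qed (use X in auto)
  then obtain Z where Z: "tiling a X X L \<epsilon> Z" and cov: "real (card (X - \<Union> (piece a ` Z))) \<le> \<epsilon> * card X"
    using Q[of a X X] k mult_right_mono[of "(1 - \<epsilon> / 2) ^ k" \<epsilon> "card X"] \<eta> by force
  have Zc: "c \<in> X" "D \<subseteq> T" "T \<in> \<T>" "finite T" "T \<subseteq> carrier G" "D \<subseteq> carrier G" "r c \<in> carrier G" "inj_on (\<lambda>d. a d c) T"
    "(1 - \<epsilon>) * card T \<le> card D"
    if "(c, T, D) \<in> Z" for c T D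
  proof -
    note t = tilingD[OF Z that]
    have "folner_set G E \<epsilon> T" using t(2) L by (auto simp: \<T>_def)
    then have "finite T" "T \<subseteq> carrier G" by (simp_all add: folner_set_def)
    with t \<open>folner_set G E \<epsilon> T\<close> r(1)[OF t(1)]
    show "c \<in> X" "D \<subseteq> T" "T \<in> \<T>" "finite T" "T \<subseteq> carrier G" "D \<subseteq> carrier G" "r c \<in> carrier G" "inj_on (\<lambda>d. a d c) T"
      "(1 - \<epsilon>) * card T \<le> card D"
      by (simp_all add: \<T>_def)
  qed
  define C where "C = \<Union> (piece a ` Z)"
  \<comment> \<open>A covered coset is lifted to the group element read off from its piece. The lift
    of one piece is a right translate of the trimmed tile \<open>D\<close>, so left multiplication
    by \<open>E\<close> acts on it as on \<open>D\<close>.\<close>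
  define Lf where "Lf = (\<lambda>x v. \<exists>(c, T, D)\<in>Z. \<exists>d\<in>D. v = d \<otimes> r c \<and> x = K #> v)"
  have Lf_unique: "v = v'" if v: "Lf x v" and v': "Lf x v'" for x v v'
  proof -
    obtain c T D d where 1: "(c, T, D) \<in> Z" "d \<in> D" "v = d \<otimes> r c" "x = K #> v" using v unfolding Lf_def by blast
    obtain c' T' D' d' where 2: "(c', T', D') \<in> Z" "d' \<in> D'" "v' = d' \<otimes> r c'" "x = K #> v'" using v' unfolding Lf_def by blast
    have "x = a d c" "x = a d' c'" using 1 2 ar Zc by (metis subsetD)+
    then have "x \<in> piece a (c, T, D)" "x \<in> piece a (c', T', D')" using 1 2 by (auto simp: piece_def)
    then have eq: "(c, T, D) = (c', T', D')" using tiling_inj[OF Z 1(1) 2(1)] by simp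
    have "d = d'"
    proof (rule inj_onD[OF Zc(8)[OF 1(1)]])
      show "a d c = a d' c" using \<open>x = a d c\<close> \<open>x = a d' c'\<close> eq by simp
      show "d \<in> T" "d' \<in> T" using Zc(2)[OF 1(1)] 1(2) 2(2) eq by auto
    qed
    then show ?thesis using 1 2 eq by simp
  qed
  have LfC: "\<exists>v. Lf x v" if x: "x \<in> C" for x
  proof -
    obtain z where z: "z \<in> Z" "x \<in> piece a z" using x by (auto simp: C_def)
    obtain c T D where zz: "z = (c, T, D)" by (cases z)
    obtain d where d: "d \<in> D" "x = a d c" using z zz by (auto simp: piece_def)
    then have "x = K #> (d \<otimes> r c)" using Zc[of c T D] z zz ar[of d c] by auto
    then show ?thesis unfolding Lf_def using d z zz by blast
  qed
  have Lfc: "v \<in> carrier G \<and> K #> v = x" if v: "Lf x v" for x v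
  proof -
    obtain c T D d where 1: "(c, T, D) \<in> Z" "d \<in> D" "v = d \<otimes> r c" "x = K #> v" using v unfolding Lf_def by blast
    then show ?thesis using Zc(6,7)[OF 1(1)] by auto
  qed
  \<comment> \<open>The lifted pieces are completed to a transversal by arbitrary representatives of
    the uncovered cosets, which are too few to spoil the Folner condition.\<close>
  define s where "s = (\<lambda>x. if x \<in> C then SOME v. Lf x v else r x)"
  have sLf: "Lf x (s x)" if "x \<in> C" for x using LfC[OF that] that by (simp add: s_def someI_ex)
  have s: "s x \<in> carrier G" "K #> s x = x" if "x \<in> X" for x
    using sLf[of x] Lfc r that by (cases "x \<in> C"; auto simp: s_def)+
  have s_piece: "d \<otimes> r c \<in> s ` X" if "(c, T, D) \<in> Z" "d \<in> D" for c T D d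
  proof -
    let ?x = "K #> (d \<otimes> r c)"
    have dr: "d \<in> carrier G" "c \<in> X" "r c \<in> carrier G" using Zc[OF that(1)] that(2) by auto
    have lf: "Lf ?x (d \<otimes> r c)" unfolding Lf_def using that by blast
    have "?x = a d c" using ar[OF dr(1,2)] by simp
    then have "?x \<in> C" unfolding C_def using that by (force simp: piece_def)
    then have "s ?x = d \<otimes> r c" using Lf_unique sLf lf by blast
    moreover have "?x \<in> X" using cos dr by simp
    ultimately show ?thesis by (metis imageI)
  qed
  define V where "V = s ` X"
  have bij: "bij_betw (\<lambda>t. K #> t) V X"
    unfolding V_def by (rule bij_betw_byWitness[where f' = s]) (use s in auto)
  have cV: "card V = card X" using bij by (rule bij_betw_same_card)
  have "real (card {v \<in> V. e \<otimes> v \<notin> V}) \<le> \<delta> * card V" if e: "e \<in> E" for e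
  proof -
    have ec: "e \<in> carrier G" using e E by auto
    have "{v \<in> V. e \<otimes> v \<notin> V} \<subseteq> s ` (X - C) \<union> (\<Union>z\<in>Z. (\<lambda>d. d \<otimes> r (fst z)) ` {d \<in> snd (snd z). e \<otimes> d \<notin> snd (snd z)})"
    proof
      fix v assume v: "v \<in> {v \<in> V. e \<otimes> v \<notin> V}"
      then obtain x where x: "x \<in> X" "v = s x" by (auto simp: V_def)
      show "v \<in> s ` (X - C) \<union> (\<Union>z\<in>Z. (\<lambda>d. d \<otimes> r (fst z)) ` {d \<in> snd (snd z). e \<otimes> d \<notin> snd (snd z)})"
      proof (cases "x \<in> C")
        case True
        then obtain c T D d where 1: "(c, T, D) \<in> Z" "d \<in> D" "v = d \<otimes> r c" using sLf x unfolding Lf_def by blast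
        have dr: "d \<in> carrier G" "r c \<in> carrier G" using Zc[OF 1(1)] 1(2) by auto
        have "e \<otimes> d \<notin> D"
        proof
          assume "e \<otimes> d \<in> D"
          then have "(e \<otimes> d) \<otimes> r c \<in> V" unfolding V_def using s_piece[OF 1(1)] by blast
          then show False using v 1(3) dr ec by (simp add: m_assoc)
        qed
        then show ?thesis using 1 by force
      qed (use x in blast)
    qed
    moreover have "finite (s ` (X - C) \<union> (\<Union>z\<in>Z. (\<lambda>d. d \<otimes> r (fst z)) ` {d \<in> snd (snd z). e \<otimes> d \<notin> snd (snd z)}))"
    proof (intro finite_UnI finite_UN_I finite_imageI)
      show "finite Z" using Z by (simp add: tiling_def)
      fix z assume z: "z \<in> Z"
      obtain c T D where zz: "z = (c, T, D)" by (cases z)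
      have "finite (snd (snd z))" using finite_subset[OF Zc(2) Zc(4)] z zz by simp
      then show "finite {d \<in> snd (snd z). e \<otimes> d \<notin> snd (snd z)}" by simp
    qed (use X in simp)
    ultimately have "card {v \<in> V. e \<otimes> v \<notin> V} \<le> card (s ` (X - C) \<union> (\<Union>z\<in>Z. (\<lambda>d. d \<otimes> r (fst z)) ` {d \<in> snd (snd z). e \<otimes> d \<notin> snd (snd z)}))"
      by (intro card_mono)
    also have "\<dots> \<le> card (s ` (X - C)) + card (\<Union>z\<in>Z. (\<lambda>d. d \<otimes> r (fst z)) ` {d \<in> snd (snd z). e \<otimes> d \<notin> snd (snd z)})"
      by (rule card_Un_le)
    also have "card (s ` (X - C)) \<le> card (X - C)" using X by (intro card_image_le) auto
    also have "card (\<Union>z\<in>Z. (\<lambda>d. d \<otimes> r (fst z)) ` {d \<in> snd (snd z). e \<otimes> d \<notin> snd (snd z)})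
      \<le> (\<Sum>z\<in>Z. card ((\<lambda>d. d \<otimes> r (fst z)) ` {d \<in> snd (snd z). e \<otimes> d \<notin> snd (snd z)}))"
      using Z by (intro card_UN_le) (auto simp: tiling_def)
    finally have 1: "real (card {v \<in> V. e \<otimes> v \<notin> V}) \<le> real (card (X - C))
      + (\<Sum>z\<in>Z. real (card ((\<lambda>d. d \<otimes> r (fst z)) ` {d \<in> snd (snd z). e \<otimes> d \<notin> snd (snd z)})))"
      by (simp add: of_nat_sum[symmetric] del: of_nat_sum)
    have "(\<Sum>z\<in>Z. real (card ((\<lambda>d. d \<otimes> r (fst z)) ` {d \<in> snd (snd z). e \<otimes> d \<notin> snd (snd z)})))
      \<le> (\<Sum>z\<in>Z. 4 * \<epsilon> * card (piece a z))"
    proof (rule sum_mono)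
      fix z assume z: "z \<in> Z"
      obtain c T D where zz: "z = (c, T, D)" by (cases z)
      have z': "(c, T, D) \<in> Z" using z zz by simp
      have finD: "finite D" using Zc(2,4)[OF z'] finite_subset by blast
      have "card ((\<lambda>d. d \<otimes> r c) ` {d \<in> D. e \<otimes> d \<notin> D}) \<le> card {d \<in> D. e \<otimes> d \<notin> D}"
        using finD by (intro card_image_le) auto
      also have "\<dots> \<le> card {t \<in> T. e \<otimes> t \<notin> T} + (card T - card D)"
        using Zc[OF z'] ec by (intro card_boundary_subset) auto
      finally have "real (card ((\<lambda>d. d \<otimes> r c) ` {d \<in> D. e \<otimes> d \<notin> D})) \<le> card {t \<in> T. e \<otimes> t \<notin> T} + (real (card T) - card D)"
        using card_mono[OF Zc(4)[OF z'] Zc(2)[OF z']] by linarith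
      also have "real (card {t \<in> T. e \<otimes> t \<notin> T}) \<le> \<epsilon> * card T"
        using Zc(3)[OF z'] e by (simp add: \<T>_def folner_set_def)
      also have "real (card T) - card D \<le> \<epsilon> * card T" using Zc(9)[OF z'] by (simp add: algebra_simps)
      also have "\<epsilon> * card T + \<epsilon> * card T \<le> 4 * \<epsilon> * card D"
      proof -
        have "1 / 2 * card T \<le> (1 - \<epsilon>) * card T" using \<epsilon> by (intro mult_right_mono) auto
        then have "card T \<le> 2 * real (card D)" using Zc(9)[OF z'] by linarith
        then have "\<epsilon> * card T \<le> \<epsilon> * (2 * real (card D))" using \<epsilon> by (intro mult_left_mono) auto
        then show ?thesis by simp
      qed
      also have "card D = card (piece a z)" using card_piece[OF Z z] zz by simp
      finally show "real (card ((\<lambda>d. d \<otimes> r (fst z)) ` {d \<in> snd (snd z). e \<otimes> d \<notin> snd (snd z)})) \<le> 4 * \<epsilon> * card (piece a z)"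
        using zz by simp
    qed
    also have "\<dots> = 4 * \<epsilon> * card C" using card_covered[OF Z X(1)] by (simp add: C_def sum_distrib_left[symmetric])
    also have "\<dots> \<le> 4 * \<epsilon> * card X"
    proof -
      have "C \<subseteq> X" unfolding C_def using piece_subset[OF Z] by (rule UN_least)
      then show ?thesis using X \<epsilon> by (intro mult_left_mono) (auto intro: card_mono)
    qed
    finally have "real (card {v \<in> V. e \<otimes> v \<notin> V}) \<le> \<epsilon> * card X + 4 * \<epsilon> * card X"
      using 1 cov unfolding C_def by linarith
    also have "\<dots> = 5 * \<epsilon> * card X" by simp
    also have "\<dots> \<le> \<delta> * card X" using \<epsilon> by (intro mult_right_mono) auto
    finally show ?thesis using cV by simp
  qed
  moreover have "V \<noteq> {}" using cos[OF one_closed] by (auto simp: V_def)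
  moreover have "finite V" "V \<subseteq> carrier G" using X s by (auto simp: V_def)
  ultimately have "folner_set G E \<delta> V" by (simp add: folner_set_def)
  then show ?thesis using K bij unfolding X_def by blast
qed


subsection \<open>From orbit pieces to actions\<close>

text \<open>A piece \<open>(x, K, D)\<close> records that the points \<open>d x\<close> with \<open>d \<in> D\<close> behave like the cosets \<open>d K\<close> in
  \<open>G / K\<close>. The left coset \<open>d K\<close> is encoded by the right coset of the inverse of \<open>d\<close>.\<close>

definition orbit_piece :: "('a, 'm) monoid_scheme \<Rightarrow> ('a \<Rightarrow> 'x \<Rightarrow> 'x) \<Rightarrow> 'a set \<Rightarrow> real \<Rightarrow> nat \<Rightarrow> 'x \<times> 'a set \<times> 'a set \<Rightarrow> bool"
  where "orbit_piece G a E \<epsilon> M z \<longleftrightarrow> (case z of (x, K, D) \<Rightarrow>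
    subgroup K G \<and> finite (rcosets\<^bsub>G\<^esub> K) \<and> card (rcosets\<^bsub>G\<^esub> K) \<le> M \<and> finite D \<and> D \<subseteq> carrier G \<and>
    inj_on (\<lambda>d. K #>\<^bsub>G\<^esub> inv\<^bsub>G\<^esub> d) D \<and> inj_on (\<lambda>d. a d x) D \<and>
    (1 - \<epsilon>) * card (rcosets\<^bsub>G\<^esub> K) \<le> card D \<and>
    (\<forall>e\<in>E. real (card {d \<in> D. \<not> (\<exists>d'\<in>D. K #>\<^bsub>G\<^esub> inv\<^bsub>G\<^esub> d' = K #>\<^bsub>G\<^esub> inv\<^bsub>G\<^esub> (e \<otimes>\<^bsub>G\<^esub> d) \<and> a e (a d x) = a d' x)}) \<le> \<epsilon> * card D))"

text \<open>The region \<open>Y\<close> confines the pieces, so that covers belonging to different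
  conjugacy classes can be kept apart; \<open>r\<close> bounds the number of covered points from
  below.\<close>

definition orbit_cover :: "('a, 'm) monoid_scheme \<Rightarrow> ('a \<Rightarrow> 'x \<Rightarrow> 'x) \<Rightarrow> 'a set \<Rightarrow> real \<Rightarrow> nat \<Rightarrow> 'x set \<Rightarrow> real \<Rightarrow> ('x \<times> 'a set \<times> 'a set) set \<Rightarrow> bool"
  where "orbit_cover G a E \<epsilon> M Y r Z \<longleftrightarrow> finite Z \<and> disjoint_family_on (piece a) Z \<and> (\<forall>z\<in>Z. orbit_piece G a E \<epsilon> M z) \<and>
    (\<forall>z\<in>Z. piece a z \<subseteq> Y) \<and> r \<le> (\<Sum>z\<in>Z. real (card (piece a z)))"

text \<open>The partial bijection from \<open>f u\<close> to \<open>g u\<close> extends to all of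
  \<open>V\<close> since the rest of \<open>V\<close> is no larger than the rest of
  \<open>Y\<close>. It serves to place coset spaces in a finite set while the points of the pieces
  keep their positions.\<close>

lemma common_injection:
  assumes fin: "finite V" "finite Y" and le: "card V \<le> card Y"
    and f: "inj_on f U" "f ` U \<subseteq> V" and g: "inj_on g U" "g ` U \<subseteq> Y"
  obtains h where "inj_on h V" "h ` V \<subseteq> Y" "\<And>u. u \<in> U \<Longrightarrow> h (f u) = g u"
proof -
  have "card (V - f ` U) = card V - card U"
    using card_Diff_subset[OF finite_subset[OF f(2) fin(1)] f(2)] card_image[OF f(1)] by simp
  moreover have "card (Y - g ` U) = card Y - card U"
    using card_Diff_subset[OF finite_subset[OF g(2) fin(2)] g(2)] card_image[OF g(1)] by simp
  ultimately have "card (V - f ` U) \<le> card (Y - g ` U)" using le by simp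
  then obtain h1 where h1: "h1 ` (V - f ` U) \<subseteq> Y - g ` U" "inj_on h1 (V - f ` U)"
    using card_le_inj[of "V - f ` U" "Y - g ` U"] fin by auto
  define h where "h = (\<lambda>v. if v \<in> f ` U then g (inv_into U f v) else h1 v)"
  have hf: "h (f u) = g u" if "u \<in> U" for u using that f(1) by (simp add: h_def inv_into_f_f)
  have hn: "h v \<in> Y - g ` U" if "v \<in> V - f ` U" for v using h1(1) that by (auto simp: h_def)
  have "inj_on h V"
  proof (rule inj_onI)
    fix v w assume vw: "v \<in> V" "w \<in> V" "h v = h w"
    show "v = w"
    proof (cases "v \<in> f ` U"; cases "w \<in> f ` U")
      assume "v \<in> f ` U" "w \<in> f ` U"
      then obtain u u' where "u \<in> U" "v = f u" "u' \<in> U" "w = f u'" by blast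
      then show ?thesis using vw(3) hf g(1) by (auto dest: inj_onD)
    next
      assume "v \<in> f ` U" "w \<notin> f ` U"
      then have "h v \<in> g ` U" "h w \<notin> g ` U" using hf hn[of w] vw(2) by auto
      then show ?thesis using vw(3) by simp
    next
      assume "v \<notin> f ` U" "w \<in> f ` U"
      then have "h v \<notin> g ` U" "h w \<in> g ` U" using hf hn[of v] vw(1) by auto
      then show ?thesis using vw(3) by simp
    next
      assume "v \<notin> f ` U" "w \<notin> f ` U"
      then show ?thesis using vw h1(2) by (auto simp: h_def dest: inj_onD)
    qed
  qed
  moreover have "h ` V \<subseteq> Y"
  proof
    fix y assume "y \<in> h ` V"
    then obtain v where v: "v \<in> V" "y = h v" by blast
    show "y \<in> Y"
    proof (cases "v \<in> f ` U")
      case True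
      then obtain u where "u \<in> U" "v = f u" by blast
      then show ?thesis using v hf g(2) by auto
    qed (use v hn in blast)
  qed
  ultimately show thesis using that hf by blast
qed

lemma (in group) hom_of_action:
  fixes act :: "'a \<Rightarrow> 'v \<Rightarrow> 'v" and h :: "'v \<Rightarrow> nat"
  assumes act: "\<And>g v. g \<in> carrier G \<Longrightarrow> v \<in> V \<Longrightarrow> act g v \<in> V"
    and one: "\<And>v. v \<in> V \<Longrightarrow> act \<one> v = v"
    and comp: "\<And>g g' v. g \<in> carrier G \<Longrightarrow> g' \<in> carrier G \<Longrightarrow> v \<in> V \<Longrightarrow> act (g \<otimes> g') v = act g (act g' v)"
    and h: "inj_on h V" "h ` V \<subseteq> {1..m}"
  obtains \<rho> where "\<rho> \<in> hom G (sym_group m)" "\<And>g v. g \<in> carrier G \<Longrightarrow> v \<in> V \<Longrightarrow> \<rho> g (h v) = h (act g v)"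
proof -
  define \<rho> where "\<rho> = (\<lambda>g i. if i \<in> h ` V then h (act g (inv_into V h i)) else i)"
  have \<rho>h: "\<rho> g (h v) = h (act g v)" if "v \<in> V" for g v using that h(1) by (simp add: \<rho>_def)
  have \<rho>n: "\<rho> g i = i" if "i \<notin> h ` V" for g i using that by (simp add: \<rho>_def)
  have \<rho>comp: "\<rho> (g \<otimes> g') = \<rho> g \<circ> \<rho> g'" if "g \<in> carrier G" "g' \<in> carrier G" for g g'
  proof
    fix i show "\<rho> (g \<otimes> g') i = (\<rho> g \<circ> \<rho> g') i"
    proof (cases "i \<in> h ` V")
      case True
      then obtain v where "v \<in> V" "i = h v" by blast
      then show ?thesis using that act comp \<rho>h by simp
    qed (simp add: \<rho>n)
  qed
  have \<rho>one: "\<rho> \<one> = id"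
  proof
    fix i show "\<rho> \<one> i = id i"
    proof (cases "i \<in> h ` V")
      case True
      then obtain v where "v \<in> V" "i = h v" by blast
      then show ?thesis using one \<rho>h by simp
    qed (simp add: \<rho>n)
  qed
  have "\<rho> g permutes {1..m}" if g: "g \<in> carrier G" for g
  proof -
    have "\<rho> g \<circ> \<rho> (inv g) = id" "\<rho> (inv g) \<circ> \<rho> g = id"
      using \<rho>comp[of g "inv g"] \<rho>comp[of "inv g" g] g \<rho>one by simp_all
    then have "bij (\<rho> g)" by (intro o_bij)
    moreover have "\<rho> g i = i" if "i \<notin> {1..m}" for i using that h(2) by (intro \<rho>n) blast
    ultimately show ?thesis unfolding permutes_def bij_iff by blast
  qed
  then have "\<rho> \<in> hom G (sym_group m)"
    by (auto simp: hom_def sym_group_carrier sym_group_mult \<rho>comp)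
  then show thesis using that \<rho>h by blast
qed

text \<open>The disjoint union of the coset spaces carries an exact action. It is placed in
  \<open>{1..m}\<close> so that the coset of \<open>d\<close> sits at the point \<open>d x\<close>
  of its piece; there the action of \<open>e\<close> agrees with \<open>a e\<close> unless
  \<open>d\<close> is exceptional.\<close>

theorem (in group) hom_of_orbit_pieces:
  fixes a :: "'a \<Rightarrow> nat \<Rightarrow> nat"
  assumes Z: "finite Z" "disjoint_family_on (piece a) Z" "\<Union> (piece a ` Z) \<subseteq> {1..m}"
    and pc: "\<And>z. z \<in> Z \<Longrightarrow> orbit_piece G a E \<epsilon> M z"
    and cov: "(1 - \<epsilon>) * m \<le> (\<Sum>z\<in>Z. real (card (piece a z)))"
    and M: "M \<le> \<epsilon> * m" and \<epsilon>: "0 < \<epsilon>" "\<epsilon> < 1" and E: "E \<subseteq> carrier G"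
  shows "\<exists>\<rho>\<in>hom G (sym_group m). \<forall>e\<in>E. real (card {i \<in> {1..m}. \<rho> e i \<noteq> a e i}) \<le> 3 * \<epsilon> * m"
proof -
  define xx where "xx = (\<lambda>z :: nat \<times> 'a set \<times> 'a set. fst z)"
  define KK where "KK = (\<lambda>z :: nat \<times> 'a set \<times> 'a set. fst (snd z))"
  define DD where "DD = (\<lambda>z :: nat \<times> 'a set \<times> 'a set. snd (snd z))"
  have P: "subgroup (KK z) G" "finite (rcosets (KK z))" "card (rcosets (KK z)) \<le> M" "finite (DD z)" "DD z \<subseteq> carrier G"
    "inj_on (\<lambda>d. KK z #> inv d) (DD z)" "inj_on (\<lambda>d. a d (xx z)) (DD z)"
    "(1 - \<epsilon>) * card (rcosets (KK z)) \<le> card (DD z)"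
    "\<And>e. e \<in> E \<Longrightarrow> real (card {d \<in> DD z. \<not> (\<exists>d'\<in>DD z. KK z #> inv d' = KK z #> inv (e \<otimes> d) \<and> a e (a d (xx z)) = a d' (xx z))}) \<le> \<epsilon> * card (DD z)"
    if "z \<in> Z" for z
    using pc[OF that] by (cases z; simp add: orbit_piece_def xx_def KK_def DD_def)+
  have pz: "piece a z = (\<lambda>d. a d (xx z)) ` DD z" for z by (simp add: piece_def xx_def DD_def)
  have cpz: "card (piece a z) = card (DD z)" if "z \<in> Z" for z using P(7)[OF that] by (simp add: pz card_image)
  \<comment> \<open>All coset spaces together may exceed \<open>m\<close>. Among the subfamilies
    that fit, one with the largest number of members is taken; adding an omitted piece would
    overflow, so the chosen coset spaces fill at least m - M places.\<close>
  define N where "N = (\<lambda>Z'. \<Sum>z\<in>Z'. card (rcosets (KK z)))"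
  define Q where "Q = (\<lambda>Z'. Z' \<subseteq> Z \<and> N Z' \<le> m)"
  have "Q {}" by (simp add: Q_def N_def)
  moreover have "\<forall>Z'. Q Z' \<longrightarrow> card Z' < Suc (card Z)" using Z(1) by (auto simp: Q_def less_Suc_eq_le intro: card_mono)
  ultimately obtain Z' where Z': "Q Z'" and maxZ': "\<And>Z''. Q Z'' \<Longrightarrow> card Z'' \<le> card Z'"
    using ex_has_greatest_nat[of Q "{}" card "Suc (card Z)"] by blast
  have subZ: "Z' \<subseteq> Z" "N Z' \<le> m" using Z' by (simp_all add: Q_def)
  have finZ': "finite Z'" using subZ(1) Z(1) by (rule finite_subset)
  \<comment> \<open>If all pieces fit, the covering hypothesis suffices. Otherwise the coset spaces
    occupy at least (1 - \<epsilon>) m places by \<open>M \<le> \<epsilon> * m\<close>, and each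
    piece has at least the fraction 1 - \<epsilon> of its coset space.\<close>
  have big: "(1 - \<epsilon>) ^ 2 * m \<le> (\<Sum>z\<in>Z'. real (card (DD z)))"
  proof (cases "Z' = Z")
    case True
    have "(1 - \<epsilon>) * ((1 - \<epsilon>) * m) \<le> 1 * ((1 - \<epsilon>) * m)" using \<epsilon> by (intro mult_right_mono) auto
    then show ?thesis using cov cpz True by (simp add: power2_eq_square)
  next
    case False
    then obtain z where z: "z \<in> Z" "z \<notin> Z'" using subZ by blast
    have "\<not> Q (insert z Z')" using maxZ'[of "insert z Z'"] finZ' z by auto
    then have "m < N (insert z Z')" using subZ z by (auto simp: Q_def)
    also have "N (insert z Z') = card (rcosets (KK z)) + N Z'" using z finZ' by (simp add: N_def)
    also have "\<dots> \<le> M + N Z'" using P(3)[OF z(1)] by simp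
    finally have "real m - M \<le> N Z'" by linarith
    then have "(1 - \<epsilon>) * m \<le> N Z'" using M by (simp add: algebra_simps)
    then have "(1 - \<epsilon>) * ((1 - \<epsilon>) * m) \<le> (1 - \<epsilon>) * real (N Z')" using \<epsilon> by (intro mult_left_mono) auto
    also have "\<dots> = (\<Sum>z\<in>Z'. (1 - \<epsilon>) * real (card (rcosets (KK z))))" by (simp add: N_def sum_distrib_left)
    also have "\<dots> \<le> (\<Sum>z\<in>Z'. real (card (DD z)))" using P(8) subZ by (intro sum_mono) auto
    finally show ?thesis by (simp add: power2_eq_square mult.assoc)
  qed
  define V where "V = (SIGMA z:Z'. rcosets (KK z))"
  define U where "U = (SIGMA z:Z'. DD z)"
  define f where "f = (\<lambda>(z, d). (z, KK z #> inv d))"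
  define g where "g = (\<lambda>(z, d). a d (xx z))"
  have finR: "finite (rcosets (KK z))" if "z \<in> Z'" for z using P(2) subZ that by blast
  have finV: "finite V" unfolding V_def by (intro finite_SigmaI finZ' finR)
  have cardV: "card V = N Z'" unfolding V_def N_def by (rule card_SigmaI) (use finZ' finR in auto)
  have finj: "inj_on f U"
  proof (rule inj_onI)
    fix u u' assume u: "u \<in> U" "u' \<in> U" "f u = f u'"
    obtain z d z' d' where uu: "u = (z, d)" "u' = (z', d')" by (cases u; cases u') auto
    then have "z = z'" "z \<in> Z" "d \<in> DD z" "d' \<in> DD z" "KK z #> inv d = KK z #> inv d'"
      using u subZ by (auto simp: f_def U_def)
    then show "u = u'" using P(6)[of z] uu by (auto dest: inj_onD)
  qed
  have ginj: "inj_on g U"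
  proof (rule inj_onI)
    fix u u' assume u: "u \<in> U" "u' \<in> U" "g u = g u'"
    obtain z d z' d' where uu: "u = (z, d)" "u' = (z', d')" by (cases u; cases u') auto
    then have z: "z \<in> Z" "z' \<in> Z" "d \<in> DD z" "d' \<in> DD z'" "a d (xx z) = a d' (xx z')"
      using u subZ by (auto simp: g_def U_def)
    have "a d (xx z) \<in> piece a z" unfolding pz using z(3) by (rule imageI)
    moreover have "a d (xx z) \<in> piece a z'" unfolding z(5) pz using z(4) by (rule imageI)
    ultimately have "z = z'" using Z(2) z(1,2) unfolding disjoint_family_on_def by (metis IntI empty_iff)
    then show "u = u'" using P(7)[of z] uu z by (auto dest: inj_onD)
  qed
  obtain h where h: "inj_on h V" "h ` V \<subseteq> {1..m}" "\<And>u. u \<in> U \<Longrightarrow> h (f u) = g u"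
  proof (rule common_injection[OF finV _ _ finj _ ginj])
    show "finite {1..m}" by simp
    show "card V \<le> card {1..m}" using cardV subZ by simp
    show "f ` U \<subseteq> V" using P(5) subZ by (force simp: f_def U_def V_def RCOSETS_def)
    show "g ` U \<subseteq> {1..m}" using Z(3) subZ by (fastforce simp: g_def U_def pz)
  qed (use that in blast)
  \<comment> \<open>Left multiplication on left cosets, written in terms of right cosets of
    inverses: the coset of \<open>inv d\<close> goes to that of the inverse of
    \<open>e d\<close>.\<close>
  define act where "act = (\<lambda>e (z :: nat \<times> 'a set \<times> 'a set, C). (z, C #> inv e))"
  have coset: "\<exists>p\<in>carrier G. C = KK z #> p" "KK z \<subseteq> carrier G" "C \<subseteq> carrier G" if "(z, C) \<in> V" for z C
  proof -
    have z: "z \<in> Z" "C \<in> rcosets (KK z)" using that subZ by (auto simp: V_def)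
    then show "\<exists>p\<in>carrier G. C = KK z #> p" by (auto simp: RCOSETS_def)
    show "KK z \<subseteq> carrier G" using P(1)[OF z(1)] by (rule subgroup.subset)
    show "C \<subseteq> carrier G" using subgroup.rcosets_carrier[OF P(1)[OF z(1)] is_group z(2)] .
  qed
  obtain \<rho> where \<rho>: "\<rho> \<in> hom G (sym_group m)" "\<And>e v. e \<in> carrier G \<Longrightarrow> v \<in> V \<Longrightarrow> \<rho> e (h v) = h (act e v)"
  proof (rule hom_of_action[of V act h m])
    fix e v assume e: "e \<in> carrier G" and v: "v \<in> V"
    obtain z C where zC: "v = (z, C)" by (cases v)
    obtain p where p: "p \<in> carrier G" "C = KK z #> p" using coset(1) v zC by blast
    have "C #> inv e = KK z #> (p \<otimes> inv e)" using p e coset(2)[of z C] v zC by (simp add: coset_mult_assoc)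
    then show "act e v \<in> V" using v zC p e by (auto simp: act_def V_def RCOSETS_def)
  next
    fix v assume v: "v \<in> V"
    then show "act \<one> v = v" using coset(3)[of "fst v" "snd v"] by (simp add: act_def split_beta)
  next
    fix e e' v assume e: "e \<in> carrier G" "e' \<in> carrier G" and v: "v \<in> V"
    then show "act (e \<otimes> e') v = act e (act e' v)"
      using coset(3)[of "fst v" "snd v"] by (simp add: act_def split_beta coset_mult_assoc inv_mult_group)
  qed (use h that in auto)
  have "real (card {i \<in> {1..m}. \<rho> e i \<noteq> a e i}) \<le> 3 * \<epsilon> * m" if e: "e \<in> E" for e
  proof -
    have ec: "e \<in> carrier G" using e E by blast
    define good where "good = (\<lambda>z. {d \<in> DD z. \<exists>d'\<in>DD z. KK z #> inv d' = KK z #> inv (e \<otimes> d) \<and> a e (a d (xx z)) = a d' (xx z)})"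
    define W where "W = g ` (SIGMA z:Z'. good z)"
    have sub: "(SIGMA z:Z'. good z) \<subseteq> U" by (auto simp: good_def U_def)
    have agree: "\<rho> e i = a e i" if iW: "i \<in> W" for i
    proof -
      obtain z d where zd: "z \<in> Z'" "d \<in> good z" "i = g (z, d)" using iW unfolding W_def by blast
      obtain d' where d': "d' \<in> DD z" "KK z #> inv d' = KK z #> inv (e \<otimes> d)" "a e (a d (xx z)) = a d' (xx z)" "d \<in> DD z"
        using zd by (auto simp: good_def)
      have U: "(z, d) \<in> U" "(z, d') \<in> U" using zd d' by (auto simp: U_def)
      have zZ: "z \<in> Z" using zd subZ by blast
      have dc: "d \<in> carrier G" "KK z \<subseteq> carrier G" using P(5)[OF zZ] d' subgroup.subset[OF P(1)[OF zZ]] by auto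
      have fV: "f (z, d) \<in> V" using zd dc by (auto simp: f_def V_def RCOSETS_def)
      have "\<rho> e i = \<rho> e (h (f (z, d)))" using zd h(3)[OF U(1)] by simp
      also have "\<dots> = h (act e (f (z, d)))" using \<rho>(2)[OF ec fV] .
      also have "act e (f (z, d)) = f (z, d')"
        using d'(2) dc ec by (simp add: act_def f_def coset_mult_assoc inv_mult_group)
      also have "h (f (z, d')) = a d' (xx z)" using h(3)[OF U(2)] by (simp add: g_def)
      finally show ?thesis using d'(3) zd(3) by (simp add: g_def)
    qed
    have W: "W \<subseteq> {1..m}"
    proof
      fix i assume "i \<in> W"
      then obtain u where "u \<in> U" "i = g u" using sub by (auto simp: W_def)
      moreover have "f u \<in> V" using \<open>u \<in> U\<close> P(5) subZ by (force simp: f_def U_def V_def RCOSETS_def)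
      ultimately show "i \<in> {1..m}" using h(2,3) by (metis image_subset_iff)
    qed
    have "card W = card (SIGMA z:Z'. good z)" unfolding W_def by (rule card_image) (rule inj_on_subset[OF ginj sub])
    also have "\<dots> = (\<Sum>z\<in>Z'. card (good z))" using finZ' P(4) subZ by (intro card_SigmaI) (auto simp: good_def)
    finally have "real (card W) = (\<Sum>z\<in>Z'. real (card (good z)))" by simp
    also have "\<dots> \<ge> (\<Sum>z\<in>Z'. (1 - \<epsilon>) * real (card (DD z)))"
    proof (rule sum_mono)
      fix z assume "z \<in> Z'"
      then have z: "z \<in> Z" using subZ by blast
      let ?bad = "{d \<in> DD z. \<not> (\<exists>d'\<in>DD z. KK z #> inv d' = KK z #> inv (e \<otimes> d) \<and> a e (a d (xx z)) = a d' (xx z))}"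
      have "DD z = good z \<union> ?bad" by (auto simp: good_def)
      then have "card (DD z) \<le> card (good z) + card ?bad" using card_Un_le[of "good z" ?bad] by simp
      then show "(1 - \<epsilon>) * real (card (DD z)) \<le> real (card (good z))" using P(9)[OF z e] by (simp add: algebra_simps)
    qed
    finally have "(1 - \<epsilon>) * (\<Sum>z\<in>Z'. real (card (DD z))) \<le> real (card W)" by (simp add: sum_distrib_left)
    moreover have "(1 - \<epsilon>) * ((1 - \<epsilon>) ^ 2 * m) \<le> (1 - \<epsilon>) * (\<Sum>z\<in>Z'. real (card (DD z)))"
      using big \<epsilon> by (intro mult_left_mono) auto
    moreover have "(1 - 3 * \<epsilon>) * m \<le> (1 - \<epsilon>) ^ 3 * m"
      using Bernoulli_inequality[of "- \<epsilon>" 3] \<epsilon> by (intro mult_right_mono) auto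
    ultimately have cW: "(1 - 3 * \<epsilon>) * m \<le> real (card W)" by (simp add: power2_eq_square power3_eq_cube mult.assoc)
    have "{i \<in> {1..m}. \<rho> e i \<noteq> a e i} \<subseteq> {1..m} - W" using agree by blast
    then have "card {i \<in> {1..m}. \<rho> e i \<noteq> a e i} \<le> card ({1..m} - W)" by (intro card_mono) auto
    also have "\<dots> = m - card W" using W by (subst card_Diff_subset) (auto intro: finite_subset)
    finally have "real (card {i \<in> {1..m}. \<rho> e i \<noteq> a e i}) \<le> m - real (card W)"
      using card_mono[OF _ W] by simp
    then show ?thesis using cW by (simp add: algebra_simps)
  qed
  then show ?thesis using \<rho>(1) by blast
qed


subsection \<open>Asymptotic homomorphisms and stabilizers\<close>

definition freq :: "nat \<Rightarrow> (nat \<Rightarrow> bool) \<Rightarrow> real"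
  where "freq m P = real (card {x \<in> {1..m}. P x}) / real m"

lemma freq_nonneg [simp]: "0 \<le> freq m P"
  by (simp add: freq_def)

lemma freq_le_1: "freq m P \<le> 1"
proof -
  have "card {x \<in> {1..m}. P x} \<le> card {1..m}" by (intro card_mono) auto
  then show ?thesis by (simp add: freq_def divide_le_eq)
qed

lemma freq_mono:
  assumes "\<And>x. x \<in> {1..m} \<Longrightarrow> P x \<Longrightarrow> Q x"
  shows "freq m P \<le> freq m Q"
proof -
  have "card {x \<in> {1..m}. P x} \<le> card {x \<in> {1..m}. Q x}" using assms by (intro card_mono) auto
  then show ?thesis unfolding freq_def by (intro divide_right_mono) auto
qed

lemma freq_disj_le: "freq m (\<lambda>x. P x \<or> Q x) \<le> freq m P + freq m Q"
proof -
  have "{x \<in> {1..m}. P x \<or> Q x} = {x \<in> {1..m}. P x} \<union> {x \<in> {1..m}. Q x}" by auto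
  then have "card {x \<in> {1..m}. P x \<or> Q x} \<le> card {x \<in> {1..m}. P x} + card {x \<in> {1..m}. Q x}"
    by (simp only: card_Un_le)
  then have "real (card {x \<in> {1..m}. P x \<or> Q x}) / m \<le> (real (card {x \<in> {1..m}. P x}) + card {x \<in> {1..m}. Q x}) / m"
    by (intro divide_right_mono) auto
  then show ?thesis by (simp add: freq_def add_divide_distrib)
qed

lemma freq_disj_eq:
  assumes "\<And>x. \<not> (P x \<and> Q x)"
  shows "freq m (\<lambda>x. P x \<or> Q x) = freq m P + freq m Q"
proof -
  have "{x \<in> {1..m}. P x \<or> Q x} = {x \<in> {1..m}. P x} \<union> {x \<in> {1..m}. Q x}" by auto
  moreover have "card ({x \<in> {1..m}. P x} \<union> {x \<in> {1..m}. Q x}) = card {x \<in> {1..m}. P x} + card {x \<in> {1..m}. Q x}"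
    using assms by (intro card_Un_disjoint) auto
  ultimately show ?thesis by (simp add: freq_def add_divide_distrib)
qed

lemma freq_True: "0 < m \<Longrightarrow> freq m (\<lambda>x. True) = 1"
proof -
  assume "0 < m"
  moreover have "{x \<in> {1..m}. True} = {1..m}" by blast
  ultimately show ?thesis by (simp only: freq_def) simp
qed

lemma freq_permutes:
  assumes p: "p permutes {1..m}"
  shows "freq m (\<lambda>x. P (p x)) = freq m P"
proof -
  have "p ` {x \<in> {1..m}. P (p x)} = {x \<in> {1..m}. P x}"
  proof (intro equalityI subsetI)
    fix y assume "y \<in> {x \<in> {1..m}. P x}"
    moreover have "y = p (inv_into UNIV p y)" using permutes_inverses(1)[OF p] by simp
    moreover have "inv_into UNIV p y \<in> {1..m} \<longleftrightarrow> y \<in> {1..m}"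
      using permutes_in_image[OF permutes_inv[OF p]] .
    ultimately show "y \<in> p ` {x \<in> {1..m}. P (p x)}" by (metis (mono_tags, lifting) imageI mem_Collect_eq)
  next
    fix y assume "y \<in> p ` {x \<in> {1..m}. P (p x)}"
    then show "y \<in> {x \<in> {1..m}. P x}" using permutes_in_image[OF p] by blast
  qed
  moreover have "inj_on p {x \<in> {1..m}. P (p x)}" using permutes_inj[OF p] by (rule inj_on_subset) simp
  then have "card (p ` {x \<in> {1..m}. P (p x)}) = card {x \<in> {1..m}. P (p x)}" by (rule card_image)
  ultimately show ?thesis by (simp only: freq_def)
qed

lemma negligible_mono:
  assumes "((\<lambda>n. freq (m n) (P n)) \<longlongrightarrow> 0) F" "\<And>n x. Q n x \<Longrightarrow> P n x"
  shows "((\<lambda>n. freq (m n) (Q n)) \<longlongrightarrow> 0) F"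
proof (rule tendsto_sandwich[OF _ _ tendsto_const assms(1)])
  show "\<forall>\<^sub>F n in F. freq (m n) (Q n) \<le> freq (m n) (P n)"
    using assms(2) by (intro always_eventually allI freq_mono)
qed simp

lemma negligible_disj:
  assumes "((\<lambda>n. freq (m n) (P n)) \<longlongrightarrow> 0) F" "((\<lambda>n. freq (m n) (Q n)) \<longlongrightarrow> 0) F"
  shows "((\<lambda>n. freq (m n) (\<lambda>x. P n x \<or> Q n x)) \<longlongrightarrow> 0) F"
proof (rule tendsto_sandwich[OF _ _ tendsto_const])
  show "((\<lambda>n. freq (m n) (P n) + freq (m n) (Q n)) \<longlongrightarrow> 0) F" using tendsto_add[OF assms] by simp
qed (simp_all add: freq_disj_le)

lemma negligible_Bex:
  assumes "finite I" "\<And>i. i \<in> I \<Longrightarrow> ((\<lambda>n. freq (m n) (P i n)) \<longlongrightarrow> 0) F"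
  shows "((\<lambda>n. freq (m n) (\<lambda>x. \<exists>i\<in>I. P i n x)) \<longlongrightarrow> 0) F"
  using assms
proof (induction I)
  case empty
  then show ?case by (simp add: freq_def)
next
  case (insert i I)
  then have "((\<lambda>n. freq (m n) (\<lambda>x. P i n x \<or> (\<exists>i\<in>I. P i n x))) \<longlongrightarrow> 0) F"
    by (intro negligible_disj) auto
  then show ?case by simp
qed

lemma freq_diff_le: "freq m P - freq m Q \<le> freq m (\<lambda>x. P x \<noteq> Q x)"
proof -
  have "freq m P \<le> freq m (\<lambda>x. Q x \<or> (P x \<noteq> Q x))" by (rule freq_mono) blast
  also have "\<dots> \<le> freq m Q + freq m (\<lambda>x. P x \<noteq> Q x)" by (rule freq_disj_le)
  finally show ?thesis by simp
qed

lemma negligible_diff: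
  assumes "((\<lambda>n. freq (m n) (\<lambda>x. P n x \<noteq> Q n x)) \<longlongrightarrow> 0) F"
  shows "((\<lambda>n. freq (m n) (P n) - freq (m n) (Q n)) \<longlongrightarrow> 0) F"
proof (rule tendsto_rabs_zero_cancel, rule tendsto_sandwich[OF _ _ tendsto_const assms])
  have "(\<lambda>x. Q n x \<noteq> P n x) = (\<lambda>x. P n x \<noteq> Q n x)" for n by auto
  then have "\<bar>freq (m n) (P n) - freq (m n) (Q n)\<bar> \<le> freq (m n) (\<lambda>x. P n x \<noteq> Q n x)" for n
    using freq_diff_le[of "m n" "P n" "Q n"] freq_diff_le[of "m n" "Q n" "P n"] by (simp add: abs_le_iff)
  then show "\<forall>\<^sub>F n in F. \<bar>freq (m n) (P n) - freq (m n) (Q n)\<bar> \<le> freq (m n) (\<lambda>x. P n x \<noteq> Q n x)" by simp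
qed simp

text \<open>The filter is arbitrary so that the property passes to finer filters, which replace
  subsequences.\<close>

definition asymptotic_hom :: "('a, 'k) monoid_scheme \<Rightarrow> 'i filter \<Rightarrow> ('i \<Rightarrow> nat) \<Rightarrow> ('i \<Rightarrow> 'a \<Rightarrow> nat \<Rightarrow> nat) \<Rightarrow> bool"
  where "asymptotic_hom G F m a \<longleftrightarrow> (\<forall>n. 0 < m n) \<and> (\<forall>n. \<forall>g\<in>carrier G. a n g permutes {1..m n}) \<and>
    (\<forall>g\<in>carrier G. \<forall>h\<in>carrier G. ((\<lambda>n. freq (m n) (\<lambda>x. a n g (a n h x) \<noteq> a n (g \<otimes>\<^bsub>G\<^esub> h) x)) \<longlongrightarrow> 0) F)"

text \<open>Products are respected only approximately, so this set need not be a subgroup.\<close>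

definition stab :: "('a, 'k) monoid_scheme \<Rightarrow> ('a \<Rightarrow> nat \<Rightarrow> nat) \<Rightarrow> nat \<Rightarrow> 'a set"
  where "stab G a x = {p \<in> carrier G. a p x = x}"

definition acts_at :: "('a, 'k) monoid_scheme \<Rightarrow> ('a \<Rightarrow> nat \<Rightarrow> nat) \<Rightarrow> 'a set \<Rightarrow> nat \<Rightarrow> bool"
  where "acts_at G a B x \<longleftrightarrow> (\<forall>p\<in>B. \<forall>q\<in>B. a p (a q x) = a (p \<otimes>\<^bsub>G\<^esub> q) x)"

text \<open>For finite \<open>B\<close> these are the basic neighbourhoods of \<open>H\<close> in
  the product topology on the power set.\<close>

definition cyl :: "'a set \<Rightarrow> 'a set \<Rightarrow> 'a set set"
  where "cyl H B = {K. K \<inter> B = H \<inter> B}"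

definition conjugate :: "('a, 'k) monoid_scheme \<Rightarrow> 'a \<Rightarrow> 'a set \<Rightarrow> 'a set"
  where "conjugate G g H = (\<lambda>h. g \<otimes>\<^bsub>G\<^esub> h \<otimes>\<^bsub>G\<^esub> inv\<^bsub>G\<^esub> g) ` H"

lemma acts_atD: "acts_at G a B x \<Longrightarrow> p \<in> B \<Longrightarrow> q \<in> B \<Longrightarrow> a p (a q x) = a (p \<otimes>\<^bsub>G\<^esub> q) x"
  by (simp add: acts_at_def)

lemma acts_at_mono: "acts_at G a B x \<Longrightarrow> B' \<subseteq> B \<Longrightarrow> acts_at G a B' x"
  by (auto simp: acts_at_def)

lemma cyl_mono: "B \<subseteq> B' \<Longrightarrow> cyl H B' \<subseteq> cyl H B"
  by (auto simp: cyl_def)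

lemma cyl_disjoint: "H \<inter> B \<noteq> H' \<inter> B \<Longrightarrow> cyl H B \<inter> cyl H' B = {}"
  by (auto simp: cyl_def)

lemma separating_set:
  fixes \<H> :: "'a set set"
  assumes "finite \<H>" "\<And>H. H \<in> \<H> \<Longrightarrow> H \<subseteq> U"
  obtains B where "finite B" "B \<subseteq> U" "\<And>H H'. H \<in> \<H> \<Longrightarrow> H' \<in> \<H> \<Longrightarrow> H \<noteq> H' \<Longrightarrow> H \<inter> B \<noteq> H' \<inter> B"
proof -
  let ?P = "{HH \<in> \<H> \<times> \<H>. fst HH \<noteq> snd HH}"
  have "\<exists>p. p \<in> U \<and> (p \<in> fst HH) \<noteq> (p \<in> snd HH)" if HH: "HH \<in> ?P" for HH
  proof -
    have "fst HH \<noteq> snd HH" using HH by simp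
    then obtain p where p: "(p \<in> fst HH) \<noteq> (p \<in> snd HH)" unfolding set_eq_iff by blast
    moreover have "fst HH \<in> \<H>" "snd HH \<in> \<H>" using HH by auto
    then have "fst HH \<subseteq> U" "snd HH \<subseteq> U" using assms(2)[of "fst HH"] assms(2)[of "snd HH"] by simp_all
    ultimately show ?thesis by blast
  qed
  then have "\<forall>HH\<in>?P. \<exists>p. p \<in> U \<and> (p \<in> fst HH) \<noteq> (p \<in> snd HH)" by blast
  from bchoice[OF this] obtain c where c: "\<forall>HH\<in>?P. c HH \<in> U \<and> (c HH \<in> fst HH) \<noteq> (c HH \<in> snd HH)" ..
  show thesis
  proof (rule that)
    show "finite (c ` ?P)" using assms(1) by simp
    show "c ` ?P \<subseteq> U" using c by blast
    fix H H' assume H: "H \<in> \<H>" "H' \<in> \<H>" "H \<noteq> H'"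
    then have P: "(H, H') \<in> ?P" by simp
    then have "c (H, H') \<in> c ` ?P" by (rule imageI)
    moreover have "(c (H, H') \<in> H) \<noteq> (c (H, H') \<in> H')" using bspec[OF c P] by simp
    ultimately show "H \<inter> c ` ?P \<noteq> H' \<inter> c ` ?P" by blast
  qed
qed

lemma (in group) conjugate_eq: "H \<subseteq> carrier G \<Longrightarrow> g \<in> carrier G \<Longrightarrow> g <# H #> inv g = conjugate G g H"
  by (auto simp: l_coset_def r_coset_def conjugate_def)

lemma (in group) conjugate_closed: "H \<subseteq> carrier G \<Longrightarrow> g \<in> carrier G \<Longrightarrow> conjugate G g H \<subseteq> carrier G"
  by (auto simp: conjugate_def)

lemma (in group) conjugate_conjugate:
  assumes "H \<subseteq> carrier G" "g \<in> carrier G" "h \<in> carrier G"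
  shows "conjugate G g (conjugate G h H) = conjugate G (g \<otimes> h) H"
  unfolding conjugate_def image_image
  by (rule image_cong) (use assms in \<open>auto simp: m_assoc inv_mult_group subset_iff\<close>)

lemma (in group) conjugate_one: "H \<subseteq> carrier G \<Longrightarrow> conjugate G \<one> H = H"
  by (force simp: conjugate_def)

lemma (in group) mem_conjugate_iff:
  assumes "H \<subseteq> carrier G" "g \<in> carrier G" "b \<in> carrier G"
  shows "g \<otimes> b \<otimes> inv g \<in> conjugate G g H \<longleftrightarrow> b \<in> H"
proof
  assume "g \<otimes> b \<otimes> inv g \<in> conjugate G g H"
  then obtain h where h: "h \<in> H" "g \<otimes> b \<otimes> inv g = g \<otimes> h \<otimes> inv g" by (auto simp: conjugate_def)
  then have "b = h" using assms by (simp add: subset_iff)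
  then show "b \<in> H" using h by simp
qed (auto simp: conjugate_def)

lemma (in group) stab_conjugate:
  assumes perm: "a g permutes S" and at: "acts_at G a B x" and B: "g \<in> B" "b \<in> B" "g \<otimes> b \<otimes> inv g \<in> B"
    and c: "g \<in> carrier G" "b \<in> carrier G"
  shows "g \<otimes> b \<otimes> inv g \<in> stab G a (a g x) \<longleftrightarrow> b \<in> stab G a x"
proof -
  have "a (g \<otimes> b \<otimes> inv g) (a g x) = a (g \<otimes> b \<otimes> inv g \<otimes> g) x" using at B(3,1) by (rule acts_atD)
  also have "g \<otimes> b \<otimes> inv g \<otimes> g = g \<otimes> b" using c by (simp add: m_assoc)
  also have "a (g \<otimes> b) x = a g (a b x)" using acts_atD[OF at B(1,2)] by simp
  finally have "a (g \<otimes> b \<otimes> inv g) (a g x) = a g x \<longleftrightarrow> a b x = x"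
    using permutes_inj[OF perm] by (simp add: inj_eq)
  then show ?thesis using c by (simp add: stab_def)
qed

text \<open>Moving a point by \<open>g\<close> conjugates its stabilizer by \<open>g\<close>. Where
  the finitely many products involved are respected this holds exactly, provided that the test set
  is conjugated as well.\<close>

lemma (in group) stab_cyl_conjugate:
  assumes perm: "a g permutes S" and at: "acts_at G a (insert g (B \<union> conjugate G g B)) x"
    and c: "g \<in> carrier G" "B \<subseteq> carrier G" "H \<subseteq> carrier G"
  shows "stab G a (a g x) \<in> cyl (conjugate G g H) (conjugate G g B) \<longleftrightarrow> stab G a x \<in> cyl H B"
proof -
  have *: "g \<otimes> b \<otimes> inv g \<in> stab G a (a g x) \<longleftrightarrow> b \<in> stab G a x" if "b \<in> B" for b
    using that c by (intro stab_conjugate[OF perm at]) (auto simp: conjugate_def)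
  have "stab G a (a g x) \<in> cyl (conjugate G g H) (conjugate G g B) \<longleftrightarrow>
    (\<forall>b\<in>B. g \<otimes> b \<otimes> inv g \<in> stab G a (a g x) \<longleftrightarrow> g \<otimes> b \<otimes> inv g \<in> conjugate G g H)"
  proof -
    have "K \<inter> f ` B = H' \<inter> f ` B \<longleftrightarrow> (\<forall>b\<in>B. f b \<in> K \<longleftrightarrow> f b \<in> H')" for K H' and f :: "'a \<Rightarrow> 'a" by blast
    then show ?thesis unfolding cyl_def conjugate_def[of G g B] mem_Collect_eq .
  qed
  also have "\<dots> \<longleftrightarrow> (\<forall>b\<in>B. b \<in> stab G a x \<longleftrightarrow> b \<in> H)"
    using * mem_conjugate_iff[OF c(3,1)] c(2) by (meson subsetD)
  also have "\<dots> \<longleftrightarrow> stab G a x \<in> cyl H B" by (auto simp: cyl_def)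
  finally show ?thesis .
qed

lemma asymptotic_hom_acts_at:
  assumes "asymptotic_hom G F m a" "finite B" "B \<subseteq> carrier G"
  shows "((\<lambda>n. freq (m n) (\<lambda>x. \<not> acts_at G (a n) B x)) \<longlongrightarrow> 0) F"
proof -
  have "((\<lambda>n. freq (m n) (\<lambda>x. \<exists>p\<in>B. \<exists>q\<in>B. a n p (a n q x) \<noteq> a n (p \<otimes>\<^bsub>G\<^esub> q) x)) \<longlongrightarrow> 0) F"
  proof (intro negligible_Bex assms(2))
    fix p q assume "p \<in> B" "q \<in> B"
    then have "p \<in> carrier G" "q \<in> carrier G" using assms(3) by auto
    then show "((\<lambda>n. freq (m n) (\<lambda>x. a n p (a n q x) \<noteq> a n (p \<otimes>\<^bsub>G\<^esub> q) x)) \<longlongrightarrow> 0) F"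
      using assms(1) unfolding asymptotic_hom_def by blast
  qed
  then show ?thesis by (rule negligible_mono) (auto simp: acts_at_def)
qed


subsection \<open>The limit distribution of stabilizers\<close>

text \<open>The part of the subgroup axioms that, for finite \<open>Q\<close>, a stabilizer
  satisfies at almost all points.\<close>

definition (in group) subgroup_on :: "'a set \<Rightarrow> 'a set \<Rightarrow> bool"
  where "subgroup_on Q K \<longleftrightarrow> K \<subseteq> carrier G \<and> \<one> \<in> K \<and> (\<forall>p\<in>Q \<inter> K. \<forall>q\<in>Q \<inter> K. p \<otimes> inv q \<in> K)"

text \<open>Compactness of the space of subgroups, in a form that applies to sets tested only on a
  finite \<open>Q\<close>. If no finite choice worked, counterexamples for growing \<open>Q\<close>
  and \<open>\<J>\<close> would accumulate at a true subgroup, which lies in its own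
  cylinder.\<close>

lemma (in group) subgroups_compact:
  assumes B: "\<And>H. subgroup H G \<Longrightarrow> finite (B H)"
  shows "\<exists>Q \<J>. finite Q \<and> Q \<subseteq> carrier G \<and> finite \<J> \<and> \<J> \<subseteq> {H. subgroup H G} \<and>
    (\<forall>K. subgroup_on Q K \<longrightarrow> (\<exists>H\<in>\<J>. K \<in> cyl H (B H)))"
proof (rule ccontr)
  assume no: "\<not> ?thesis"
  define L where "L = {H. subgroup H G}"
  have ex: "\<exists>K. subgroup_on Q K \<and> (\<forall>H\<in>\<J>. K \<notin> cyl H (B H))"
    if QJ: "finite Q \<and> Q \<subseteq> carrier G" "finite \<J> \<and> \<J> \<subseteq> L" for Q \<J>
  proof (rule ccontr)
    assume neg: "\<not> ?thesis"
    have "\<forall>Q \<J>. \<not> (finite Q \<and> Q \<subseteq> carrier G \<and> finite \<J> \<and> \<J> \<subseteq> {H. subgroup H G} \<and>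
        (\<forall>K. subgroup_on Q K \<longrightarrow> (\<exists>H\<in>\<J>. K \<in> cyl H (B H))))"
      using no by (simp only: not_ex simp_thms)
    then have "\<not> (finite Q \<and> Q \<subseteq> carrier G \<and> finite \<J> \<and> \<J> \<subseteq> {H. subgroup H G} \<and>
        (\<forall>K. subgroup_on Q K \<longrightarrow> (\<exists>H\<in>\<J>. K \<in> cyl H (B H))))" by blast
    then obtain K where "subgroup_on Q K" "\<not> (\<exists>H\<in>\<J>. K \<in> cyl H (B H))" using QJ unfolding L_def by blast
    then show False using neg by blast
  qed
  define \<kappa> where "\<kappa> = (\<lambda>i. SOME K. subgroup_on (fst i) K \<and> (\<forall>H\<in>snd i. K \<notin> cyl H (B H)))"
  have \<kappa>: "subgroup_on Q (\<kappa> (Q, \<J>)) \<and> (\<forall>H\<in>\<J>. \<kappa> (Q, \<J>) \<notin> cyl H (B H))"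
    if "finite Q \<and> Q \<subseteq> carrier G" "finite \<J> \<and> \<J> \<subseteq> L" for Q \<J>
    unfolding \<kappa>_def fst_conv snd_conv using ex[OF that] by (rule someI_ex)
  define \<Phi> where "\<Phi> = finite_subsets_at_top (carrier G) \<times>\<^sub>F finite_subsets_at_top L"
  have "\<Phi> \<noteq> bot" by (simp add: \<Phi>_def prod_filter_eq_bot)
  moreover have "\<bar>(if p \<in> \<kappa> i then 1 else 0) :: real\<bar> \<le> 1" for p i by simp
  ultimately obtain F' l where F': "F' \<noteq> bot" "F' \<le> \<Phi>"
    and l: "\<And>p. ((\<lambda>i. (if p \<in> \<kappa> i then 1 else 0) :: real) \<longlongrightarrow> l p) F'"
    using bounded_family_cluster_filter[of \<Phi> "\<lambda>p i. (if p \<in> \<kappa> i then 1 else 0) :: real" "\<lambda>_. 1"] by metis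
  \<comment> \<open>The membership indicators converge along \<open>F'\<close> and take only the
    values 0 and 1, so every membership is eventually constant; \<open>K\<close> is the pointwise
    limit.\<close>
  define K where "K = {p. \<forall>\<^sub>F i in F'. p \<in> \<kappa> i}"
  have ev: "\<forall>\<^sub>F i in F'. subgroup_on (fst i) (\<kappa> i) \<and> X \<subseteq> fst i \<and> Y \<subseteq> snd i \<and> (\<forall>H\<in>snd i. \<kappa> i \<notin> cyl H (B H))"
    if "finite X \<and> X \<subseteq> carrier G" "finite Y \<and> Y \<subseteq> L" for X Y
  proof (rule filter_leD[OF F'(2)])
    have 1: "\<forall>\<^sub>F Q in finite_subsets_at_top (carrier G). finite Q \<and> Q \<subseteq> carrier G \<and> X \<subseteq> Q"
      using that(1) unfolding eventually_finite_subsets_at_top by blast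
    have 2: "\<forall>\<^sub>F \<J> in finite_subsets_at_top L. finite \<J> \<and> \<J> \<subseteq> L \<and> Y \<subseteq> \<J>"
      using that(2) unfolding eventually_finite_subsets_at_top by blast
    show "\<forall>\<^sub>F i in \<Phi>. subgroup_on (fst i) (\<kappa> i) \<and> X \<subseteq> fst i \<and> Y \<subseteq> snd i \<and> (\<forall>H\<in>snd i. \<kappa> i \<notin> cyl H (B H))"
      unfolding \<Phi>_def using eventually_prodI[OF 1 2]
    proof eventually_elim
      case (elim i)
      then show ?case using \<kappa>[of "fst i" "snd i"] by simp
    qed
  qed
  have notK: "\<forall>\<^sub>F i in F'. p \<notin> \<kappa> i" if "p \<notin> K" for p
  proof (cases "l p < 1")
    case True
    from order_tendstoD(2)[OF l True] show ?thesis by eventually_elim (simp split: if_splits)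
  next
    case False
    then have "0 < l p" by simp
    from order_tendstoD(1)[OF l this] have "\<forall>\<^sub>F i in F'. p \<in> \<kappa> i" by eventually_elim (simp split: if_splits)
    then show ?thesis using that by (simp add: K_def)
  qed
  have Kiff: "\<forall>\<^sub>F i in F'. p \<in> \<kappa> i \<longleftrightarrow> p \<in> K" for p
  proof (cases "p \<in> K")
    case True
    then have "\<forall>\<^sub>F i in F'. p \<in> \<kappa> i" by (simp add: K_def)
    then show ?thesis by eventually_elim (simp add: True)
  next
    case False
    from notK[OF False] show ?thesis by eventually_elim (simp add: False)
  qed
  have inK: "p \<in> K" if "\<forall>\<^sub>F i in F'. p \<in> \<kappa> i" for p using that by (simp add: K_def)
  have evK: "\<exists>i. P i" if "\<forall>\<^sub>F i in F'. P i" for P using eventually_happens'[OF F'(1) that] .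
  have "subgroup K G"
  proof (rule subgroupI)
    show Kc: "K \<subseteq> carrier G"
    proof
      fix p assume "p \<in> K"
      then have "\<forall>\<^sub>F i in F'. p \<in> \<kappa> i" by (simp add: K_def)
      with ev[of "{}" "{}"] have "\<forall>\<^sub>F i in F'. p \<in> carrier G"
        by (auto simp: subgroup_on_def elim: eventually_elim2)
      then show "p \<in> carrier G" using F'(1) by simp
    qed
    have one: "\<one> \<in> K" by (rule inK) (use ev[of "{}" "{}"] in \<open>auto simp: subgroup_on_def elim: eventually_mono\<close>)
    then show "K \<noteq> {}" by blast
    have div: "p \<otimes> inv q \<in> K" if "p \<in> K" "q \<in> K" for p q
    proof (rule inK)
      have "\<forall>\<^sub>F i in F'. p \<in> \<kappa> i" "\<forall>\<^sub>F i in F'. q \<in> \<kappa> i" using that by (simp_all add: K_def)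
      moreover have "\<forall>\<^sub>F i in F'. subgroup_on (fst i) (\<kappa> i) \<and> {p, q} \<subseteq> fst i \<and> {} \<subseteq> snd i \<and> (\<forall>H\<in>snd i. \<kappa> i \<notin> cyl H (B H))"
        using that Kc by (intro ev) auto
      ultimately show "\<forall>\<^sub>F i in F'. p \<otimes> inv q \<in> \<kappa> i"
        by eventually_elim (simp add: subgroup_on_def)
    qed
    show "inv p \<in> K" if "p \<in> K" for p using div[OF one that] Kc that by auto
    then show "p \<otimes> q \<in> K" if "p \<in> K" "q \<in> K" for p q
      using div[of p "inv q"] that Kc by auto
  qed
  \<comment> \<open>As soon as \<open>K\<close> itself belongs to the list of subgroups,
    \<open>\<kappa> i\<close> has to avoid the cylinder of \<open>K\<close>, but eventually it
    agrees with \<open>K\<close> on the finite set \<open>B K\<close>.\<close>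
  then have KL: "finite {K} \<and> {K} \<subseteq> L" by (simp add: L_def)
  have "\<forall>\<^sub>F i in F'. \<forall>p\<in>B K. p \<in> \<kappa> i \<longleftrightarrow> p \<in> K"
    using B[OF \<open>subgroup K G\<close>] Kiff by (intro eventually_ball_finite) auto
  with ev[of "{}" "{K}"] KL have "\<forall>\<^sub>F i in F'. \<kappa> i \<notin> cyl K (B K) \<and> (\<forall>p\<in>B K. p \<in> \<kappa> i \<longleftrightarrow> p \<in> K)"
    by (auto elim: eventually_elim2)
  from evK[OF this] show False by (auto simp: cyl_def)
qed

text \<open>\<open>\<mu>\<close> is defined on all families of subsets at once. As a limit of
  normalized counting measures it is finitely additive of total mass 1, with no claim of
  sigma-additivity; point masses are therefore defined through cylinders.\<close>

locale stab_limit = group G for G (structure) +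
  fixes F :: "'i filter" and m :: "'i \<Rightarrow> nat" and a :: "'i \<Rightarrow> 'a \<Rightarrow> nat \<Rightarrow> nat" and \<mu> :: "'a set set \<Rightarrow> real"
  assumes F: "F \<noteq> bot" and ah: "asymptotic_hom G F m a"
    and lim: "\<And>C. ((\<lambda>n. freq (m n) (\<lambda>x. stab G (a n) x \<in> C)) \<longlongrightarrow> \<mu> C) F"
begin

lemma perm: "g \<in> carrier G \<Longrightarrow> a n g permutes {1..m n}"
  and m_pos: "0 < m n"
  using ah by (simp_all add: asymptotic_hom_def)

lemma acts: "finite B \<Longrightarrow> B \<subseteq> carrier G \<Longrightarrow> ((\<lambda>n. freq (m n) (\<lambda>x. \<not> acts_at G (a n) B x)) \<longlongrightarrow> 0) F"
  by (rule asymptotic_hom_acts_at[OF ah])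

lemma mu_nonneg: "0 \<le> \<mu> C"
  by (rule tendsto_lowerbound[OF lim _ F]) simp

lemma mu_mono: "C \<subseteq> D \<Longrightarrow> \<mu> C \<le> \<mu> D"
  by (rule tendsto_le[OF F lim lim]) (auto intro!: always_eventually freq_mono)

lemma mu_Un_le: "\<mu> (C \<union> D) \<le> \<mu> C + \<mu> D"
  by (rule tendsto_le[OF F tendsto_add[OF lim lim] lim]) (simp add: freq_disj_le)

lemma mu_Un_disjoint: "C \<inter> D = {} \<Longrightarrow> \<mu> (C \<union> D) = \<mu> C + \<mu> D"
proof (rule tendsto_unique[OF F lim])
  assume "C \<inter> D = {}"
  then have "freq (m n) (\<lambda>x. stab G (a n) x \<in> C \<union> D) = freq (m n) (\<lambda>x. stab G (a n) x \<in> C) + freq (m n) (\<lambda>x. stab G (a n) x \<in> D)" for n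
    using freq_disj_eq[of "\<lambda>x. stab G (a n) x \<in> C" "\<lambda>x. stab G (a n) x \<in> D" "m n"] by (simp only: Un_iff) blast
  then show "((\<lambda>n. freq (m n) (\<lambda>x. stab G (a n) x \<in> C \<union> D)) \<longlongrightarrow> \<mu> C + \<mu> D) F"
    using tendsto_add[OF lim[of C] lim[of D]] by simp
qed

lemma mu_UNIV: "\<mu> UNIV = 1"
proof (rule tendsto_unique[OF F lim])
  have "freq (m n) (\<lambda>x. stab G (a n) x \<in> UNIV) = 1" for n using freq_True[OF m_pos] by simp
  then show "((\<lambda>n. freq (m n) (\<lambda>x. stab G (a n) x \<in> UNIV)) \<longlongrightarrow> 1) F" by simp
qed

lemma mu_empty: "\<mu> {} = 0"
  using mu_Un_disjoint[of "{}" "{}"] by simp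

lemma mu_UN_le: "finite I \<Longrightarrow> \<mu> (\<Union>i\<in>I. C i) \<le> (\<Sum>i\<in>I. \<mu> (C i))"
proof (induction I rule: finite_induct)
  case (insert i I)
  then show ?case using mu_Un_le[of "C i" "\<Union>i\<in>I. C i"] by simp
qed (simp add: mu_empty)

lemma mu_UN_disjoint:
  "finite I \<Longrightarrow> disjoint_family_on C I \<Longrightarrow> \<mu> (\<Union>i\<in>I. C i) = (\<Sum>i\<in>I. \<mu> (C i))"
proof (induction I rule: finite_induct)
  case (insert i I)
  have "C i \<inter> (\<Union>i\<in>I. C i) = {}" using insert.prems insert.hyps(2) by (auto simp: disjoint_family_on_def)
  moreover have "disjoint_family_on C I" using insert.prems by (auto simp: disjoint_family_on_def)
  ultimately show ?case using insert mu_Un_disjoint[of "C i" "\<Union>i\<in>I. C i"] by simp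
qed (simp add: mu_empty)

text \<open>The permutation \<open>a n g\<close> preserves the counting measure and, outside a
  negligible set, matches stabilizers in one cylinder with stabilizers in the conjugate one.\<close>

lemma mu_cyl_conjugate:
  assumes g: "g \<in> carrier G" and B: "finite B" "B \<subseteq> carrier G" and H: "H \<subseteq> carrier G"
  shows "\<mu> (cyl (conjugate G g H) (conjugate G g B)) = \<mu> (cyl H B)"
proof -
  let ?H = "conjugate G g H" and ?B = "conjugate G g B"
  have "((\<lambda>n. freq (m n) (\<lambda>x. \<not> acts_at G (a n) (insert g (B \<union> ?B)) x)) \<longlongrightarrow> 0) F"
    using g B conjugate_closed[OF B(2) g] by (intro acts) (auto simp: conjugate_def)
  then have "((\<lambda>n. freq (m n) (\<lambda>x. (stab G (a n) (a n g x) \<in> cyl ?H ?B) \<noteq> (stab G (a n) x \<in> cyl H B))) \<longlongrightarrow> 0) F"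
  proof (rule negligible_mono)
    fix n x
    assume "(stab G (a n) (a n g x) \<in> cyl ?H ?B) \<noteq> (stab G (a n) x \<in> cyl H B)"
    then show "\<not> acts_at G (a n) (insert g (B \<union> ?B)) x"
      using stab_cyl_conjugate[where a = "a n", OF perm[OF g, of n] _ g B(2) H, of x] by blast
  qed
  then have "((\<lambda>n. freq (m n) (\<lambda>x. stab G (a n) (a n g x) \<in> cyl ?H ?B) - freq (m n) (\<lambda>x. stab G (a n) x \<in> cyl H B)) \<longlongrightarrow> 0) F"
    by (rule negligible_diff)
  moreover have "freq (m n) (\<lambda>x. stab G (a n) (a n g x) \<in> cyl ?H ?B) = freq (m n) (\<lambda>x. stab G (a n) x \<in> cyl ?H ?B)" for n
    using freq_permutes[OF perm[OF g], of n "\<lambda>x. stab G (a n) x \<in> cyl ?H ?B"] .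
  ultimately have "((\<lambda>n. freq (m n) (\<lambda>x. stab G (a n) x \<in> cyl ?H ?B) - freq (m n) (\<lambda>x. stab G (a n) x \<in> cyl H B)) \<longlongrightarrow> 0) F"
    by simp
  moreover have "((\<lambda>n. freq (m n) (\<lambda>x. stab G (a n) x \<in> cyl ?H ?B) - freq (m n) (\<lambda>x. stab G (a n) x \<in> cyl H B)) \<longlongrightarrow> \<mu> (cyl ?H ?B) - \<mu> (cyl H B)) F"
    by (intro tendsto_diff lim)
  ultimately show ?thesis using tendsto_unique[OF F] by fastforce
qed

text \<open>The mass of the point \<open>H\<close> for the limit measure.\<close>

definition wt :: "'a set \<Rightarrow> real"
  where "wt H = Inf ((\<lambda>B. \<mu> (cyl H B)) ` {B. finite B \<and> B \<subseteq> carrier G})"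

lemma wt_bdd: "bdd_below ((\<lambda>B. \<mu> (cyl H B)) ` {B. finite B \<and> B \<subseteq> carrier G})"
  by (rule bdd_belowI[of _ 0]) (auto simp: mu_nonneg)

lemma wt_le: "finite B \<Longrightarrow> B \<subseteq> carrier G \<Longrightarrow> wt H \<le> \<mu> (cyl H B)"
  unfolding wt_def by (intro cINF_lower wt_bdd) simp

lemma wt_nonneg: "0 \<le> wt H"
  unfolding wt_def by (intro cINF_greatest mu_nonneg) auto

lemma wt_approx:
  assumes "wt H < r" "finite B0" "B0 \<subseteq> carrier G"
  obtains B where "finite B" "B \<subseteq> carrier G" "B0 \<subseteq> B" "\<mu> (cyl H B) < r"
proof -
  have "{B. finite B \<and> B \<subseteq> carrier G} \<noteq> {}" by blast
  then obtain B where B: "finite B" "B \<subseteq> carrier G" "\<mu> (cyl H B) < r"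
    using assms(1) wt_bdd unfolding wt_def by (auto simp: cINF_less_iff)
  have "\<mu> (cyl H (B0 \<union> B)) \<le> \<mu> (cyl H B)" by (intro mu_mono cyl_mono) simp
  then show thesis using B assms by (intro that[of "B0 \<union> B"]) auto
qed

lemma wt_conjugate_le:
  assumes g: "g \<in> carrier G" and H: "H \<subseteq> carrier G"
  shows "wt (conjugate G g H) \<le> wt H"
  unfolding wt_def[of H]
proof (rule cINF_greatest)
  fix B assume "B \<in> {B. finite B \<and> B \<subseteq> carrier G}"
  then have B: "finite B" "B \<subseteq> carrier G" by auto
  have "wt (conjugate G g H) \<le> \<mu> (cyl (conjugate G g H) (conjugate G g B))"
    using B conjugate_closed[OF B(2) g] by (intro wt_le) (auto simp: conjugate_def)
  then show "wt (conjugate G g H) \<le> \<mu> (cyl H B)" using mu_cyl_conjugate[OF g B H] by simp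
qed blast

lemma wt_conjugate:
  assumes g: "g \<in> carrier G" and H: "H \<subseteq> carrier G"
  shows "wt (conjugate G g H) = wt H"
proof (rule antisym)
  have "wt (conjugate G (inv g) (conjugate G g H)) \<le> wt (conjugate G g H)"
    using g H conjugate_closed[OF H g] by (intro wt_conjugate_le) auto
  then show "wt H \<le> wt (conjugate G g H)" using g H by (simp add: conjugate_conjugate conjugate_one)
qed (rule wt_conjugate_le[OF assms])

text \<open>Over a finite separating set the cylinders of the members are disjoint, so finite
  additivity suffices.\<close>

lemma sum_wt_le_1:
  assumes "finite \<H>" "\<And>H. H \<in> \<H> \<Longrightarrow> H \<subseteq> carrier G"
  shows "sum wt \<H> \<le> 1"
proof -
  obtain B where B: "finite B" "B \<subseteq> carrier G" and sep: "\<And>H H'. H \<in> \<H> \<Longrightarrow> H' \<in> \<H> \<Longrightarrow> H \<noteq> H' \<Longrightarrow> H \<inter> B \<noteq> H' \<inter> B"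
    using separating_set[of \<H> "carrier G"] assms by metis
  have "sum wt \<H> \<le> (\<Sum>H\<in>\<H>. \<mu> (cyl H B))" using B by (intro sum_mono wt_le)
  also have "\<dots> = \<mu> (\<Union>H\<in>\<H>. cyl H B)"
    using assms(1) sep by (intro mu_UN_disjoint[symmetric]) (auto simp: disjoint_family_on_def cyl_disjoint)
  also have "\<dots> \<le> \<mu> UNIV" by (rule mu_mono) simp
  finally show ?thesis by (simp add: mu_UNIV)
qed

text \<open>All conjugates have the same positive mass, and the total mass is at most 1.\<close>

lemma wt_pos_almost_normal:
  assumes H: "subgroup H G" and pos: "0 < wt H"
  shows "almost_normal G H"
proof -
  have Hc: "H \<subseteq> carrier G" using H by (rule subgroup.subset)
  define \<C> where "\<C> = (\<lambda>g. conjugate G g H) ` carrier G"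
  have wtC: "wt H' = wt H" "H' \<subseteq> carrier G" if H': "H' \<in> \<C>" for H'
  proof -
    obtain g where "g \<in> carrier G" "H' = conjugate G g H" using H' by (auto simp: \<C>_def)
    then show "wt H' = wt H" "H' \<subseteq> carrier G" using wt_conjugate[OF _ Hc] conjugate_closed[OF Hc] by simp_all
  qed
  have "finite \<C>"
  proof (rule ccontr)
    assume inf: "infinite \<C>"
    obtain k :: nat where k: "1 < k * wt H" using reals_Archimedean3[OF pos] by blast
    obtain \<D> where D: "\<D> \<subseteq> \<C>" "finite \<D>" "card \<D> = k" using infinite_arbitrarily_large[OF inf] by blast
    have "sum wt \<D> = (\<Sum>H'\<in>\<D>. wt H)" using D(1) wtC(1) by (intro sum.cong) auto
    then have "sum wt \<D> = k * wt H" using D by simp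
    moreover have "sum wt \<D> \<le> 1" using D wtC(2) by (intro sum_wt_le_1) auto
    ultimately show False using k by simp
  qed
  moreover have "{g <# H #> inv g | g. g \<in> carrier G} = \<C>"
    using conjugate_eq[OF Hc] by (auto simp: \<C>_def)
  ultimately show ?thesis using H by (simp add: almost_normal_def)
qed

text \<open>At a point where the products in question are respected, the unit acts trivially by
  injectivity of \<open>a n \<one>\<close>, and quotients of stabilizing elements stabilize.\<close>

lemma stab_subgroup_on:
  assumes Q: "finite Q" "Q \<subseteq> carrier G"
  shows "((\<lambda>n. freq (m n) (\<lambda>x. \<not> subgroup_on Q (stab G (a n) x))) \<longlongrightarrow> 0) F"
proof -
  let ?B = "insert \<one> (Q \<union> (\<lambda>(p, q). p \<otimes> inv q) ` (Q \<times> Q))"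
  have "((\<lambda>n. freq (m n) (\<lambda>x. \<not> acts_at G (a n) ?B x)) \<longlongrightarrow> 0) F" using Q by (intro acts) auto
  then show ?thesis
  proof (rule negligible_mono)
    fix n x
    assume n: "\<not> subgroup_on Q (stab G (a n) x)"
    show "\<not> acts_at G (a n) ?B x"
    proof
      assume at: "acts_at G (a n) ?B x"
      have "a n \<one> (a n \<one> x) = a n (\<one> \<otimes> \<one>) x" by (rule acts_atD[OF at]) auto
      then have "a n \<one> x = x" using permutes_inj[OF perm[OF one_closed]] by (simp add: inj_eq)
      moreover have "a n (p \<otimes> inv q) x = x" if "p \<in> Q \<inter> stab G (a n) x" "q \<in> Q \<inter> stab G (a n) x" for p q
      proof -
        have pq: "p \<in> carrier G" "q \<in> carrier G" "p \<in> Q" "q \<in> Q" "a n p x = x" "a n q x = x" using that by (auto simp: stab_def)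
        have "p \<otimes> inv q \<in> ?B" using pq by force
        then have "a n (p \<otimes> inv q) (a n q x) = a n (p \<otimes> inv q \<otimes> q) x" using pq by (intro acts_atD[OF at]) auto
        then show ?thesis using pq by (simp add: m_assoc)
      qed
      ultimately have "subgroup_on Q (stab G (a n) x)"
        by (auto simp: subgroup_on_def stab_def)
      then show False using n by simp
    qed
  qed
qed

text \<open>Every subgroup gets a cylinder whose mass barely exceeds its point mass. By compactness
  finitely many of these cylinders already carry the full mass, so the corresponding points carry
  almost all of it.\<close>

theorem concentration:
  assumes count: "countable {H. subgroup H G}" and \<delta>: "0 < \<delta>"
  obtains \<H> where "finite \<H>" "\<And>H. H \<in> \<H> \<Longrightarrow> subgroup H G \<and> 0 < wt H" "1 - \<delta> \<le> sum wt \<H>"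
proof -
  define L where "L = {H. subgroup H G}"
  \<comment> \<open>The excess allowed for the subgroup with number k is \<delta> divided by the
    power k + 1 of 2, so that every finite collection has total excess at most \<delta>. This is
    where countability of the set of subgroups enters.\<close>
  define e where "e = (\<lambda>H. \<delta> * (1 / 2) ^ Suc (to_nat_on L H))"
  have e: "0 < e H" for H using \<delta> by (simp add: e_def)
  have "\<exists>B. finite B \<and> B \<subseteq> carrier G \<and> \<mu> (cyl H B) < wt H + e H" for H
  proof -
    have "wt H < wt H + e H" using e[of H] by simp
    then obtain B where "finite B" "B \<subseteq> carrier G" "\<mu> (cyl H B) < wt H + e H"
      by (rule wt_approx[OF _ finite.emptyI empty_subsetI])
    then show ?thesis by (intro exI conjI)
  qed
  then obtain B where B: "\<And>H. finite (B H) \<and> B H \<subseteq> carrier G \<and> \<mu> (cyl H (B H)) < wt H + e H" by metis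
  obtain Q \<J> where Q: "finite Q" "Q \<subseteq> carrier G" and J: "finite \<J>" "\<J> \<subseteq> L"
    and cov: "\<And>K. subgroup_on Q K \<Longrightarrow> \<exists>H\<in>\<J>. K \<in> cyl H (B H)"
    using subgroups_compact[of B] B unfolding L_def by blast
  have "1 \<le> \<mu> (\<Union>H\<in>\<J>. cyl H (B H))"
  proof (rule tendsto_le[OF F lim[of "\<Union>H\<in>\<J>. cyl H (B H)"]])
    show "((\<lambda>n. 1 - freq (m n) (\<lambda>x. \<not> subgroup_on Q (stab G (a n) x))) \<longlongrightarrow> 1) F"
      using tendsto_diff[OF tendsto_const stab_subgroup_on[OF Q], of 1] by simp
    have "1 \<le> freq (m n) (\<lambda>x. stab G (a n) x \<in> (\<Union>H\<in>\<J>. cyl H (B H))) + freq (m n) (\<lambda>x. \<not> subgroup_on Q (stab G (a n) x))" for n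
    proof -
      have "1 = freq (m n) (\<lambda>x. True)" using freq_True[OF m_pos] by simp
      also have "\<dots> \<le> freq (m n) (\<lambda>x. stab G (a n) x \<in> (\<Union>H\<in>\<J>. cyl H (B H)) \<or> \<not> subgroup_on Q (stab G (a n) x))"
        using cov by (intro freq_mono) blast
      also have "\<dots> \<le> freq (m n) (\<lambda>x. stab G (a n) x \<in> (\<Union>H\<in>\<J>. cyl H (B H))) + freq (m n) (\<lambda>x. \<not> subgroup_on Q (stab G (a n) x))"
        by (rule freq_disj_le)
      finally show ?thesis .
    qed
    then show "\<forall>\<^sub>F n in F. 1 - freq (m n) (\<lambda>x. \<not> subgroup_on Q (stab G (a n) x)) \<le> freq (m n) (\<lambda>x. stab G (a n) x \<in> (\<Union>H\<in>\<J>. cyl H (B H)))"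
      by (intro always_eventually allI) (simp add: diff_le_eq)
  qed
  also have "\<dots> \<le> (\<Sum>H\<in>\<J>. \<mu> (cyl H (B H)))" using J(1) by (rule mu_UN_le)
  also have "\<dots> \<le> (\<Sum>H\<in>\<J>. wt H + e H)" using B by (intro sum_mono) (simp add: less_imp_le)
  also have "\<dots> = sum wt \<J> + sum e \<J>" by (rule sum.distrib)
  also have "sum e \<J> \<le> \<delta>"
  proof -
    have inj: "inj_on (to_nat_on L) \<J>" using inj_on_to_nat_on[of L] count J(2) unfolding L_def by (blast intro: inj_on_subset)
    have "sum e \<J> = \<delta> * (\<Sum>H\<in>\<J>. (1 / 2) ^ Suc (to_nat_on L H))" by (simp add: e_def sum_distrib_left)
    also have "(\<Sum>H\<in>\<J>. (1 / 2 :: real) ^ Suc (to_nat_on L H)) = (\<Sum>k\<in>to_nat_on L ` \<J>. (1 / 2) ^ Suc k)"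
      using inj by (simp add: sum.reindex)
    also have "\<dots> \<le> (\<Sum>k. (1 / 2) ^ Suc k)"
      using J(1) sums_summable[OF power_half_series] by (intro sum_le_suminf) auto
    also have "\<dots> = 1" using sums_unique[OF power_half_series] by simp
    finally show ?thesis using \<delta> by simp
  qed
  finally have "1 - \<delta> \<le> sum wt \<J>" by simp
  also have "sum wt \<J> = sum wt {H \<in> \<J>. 0 < wt H}"
    using J(1) wt_nonneg by (intro sum.mono_neutral_right) (auto simp: not_less intro: antisym)
  finally show thesis using J by (intro that[of "{H \<in> \<J>. 0 < wt H}"]) (auto simp: L_def)
qed

end


subsection \<open>Subgroups with finitely many conjugates\<close>

text \<open>Elements with equal values of \<open>f\<close> lie in one coset, so the image of
  \<open>f\<close> surjects onto the set of cosets.\<close>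

lemma (in group) finite_rcosetsI:
  assumes K: "subgroup K G" and f: "f ` carrier G \<subseteq> Y" "finite Y"
    and eq: "\<And>x y. x \<in> carrier G \<Longrightarrow> y \<in> carrier G \<Longrightarrow> f x = f y \<Longrightarrow> x \<otimes> inv y \<in> K"
  shows "finite (rcosets K)" "card (rcosets K) \<le> card Y"
proof -
  define r where "r = (\<lambda>y. SOME x. x \<in> carrier G \<and> f x = y)"
  have r: "r (f x) \<in> carrier G \<and> f (r (f x)) = f x" if "x \<in> carrier G" for x
    unfolding r_def by (rule someI_ex) (use that in blast)
  have sub: "rcosets K \<subseteq> (\<lambda>y. K #> r y) ` Y"
  proof
    fix C assume "C \<in> rcosets K"
    then obtain x where x: "x \<in> carrier G" "C = K #> x" by (auto simp: RCOSETS_def)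
    then have "C = K #> r (f x)" using r[OF x(1)] eq[of x "r (f x)"] rcos_eq_iff[OF K, of x "r (f x)"] by simp
    then show "C \<in> (\<lambda>y. K #> r y) ` Y" using f(1) x(1) by blast
  qed
  then show "finite (rcosets K)" using f(2) finite_subset by blast
  have "card (rcosets K) \<le> card ((\<lambda>y. K #> r y) ` Y)" using sub f(2) by (intro card_mono) auto
  also have "\<dots> \<le> card Y" using f(2) by (rule card_image_le)
  finally show "card (rcosets K) \<le> card Y" .
qed

lemma (in group) finite_rcosets_Int:
  assumes "finite \<K>" "\<K> \<noteq> {}" "\<And>K. K \<in> \<K> \<Longrightarrow> subgroup K G \<and> finite (rcosets K)"
  shows "subgroup (\<Inter>\<K>) G \<and> finite (rcosets (\<Inter>\<K>))"
proof
  show sg: "subgroup (\<Inter>\<K>) G" using assms by (intro subgroups_Inter) auto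
  let ?f = "\<lambda>x. \<lambda>K\<in>\<K>. K #> x"
  show "finite (rcosets (\<Inter>\<K>))"
  proof (rule finite_rcosetsI(1)[OF sg, of ?f "PiE \<K> (\<lambda>K. rcosets K)"])
    show "?f ` carrier G \<subseteq> PiE \<K> (\<lambda>K. rcosets K)" by (auto simp: RCOSETS_def)
    show "finite (PiE \<K> (\<lambda>K. rcosets K))" using assms by (intro finite_PiE) auto
    fix x y assume xy: "x \<in> carrier G" "y \<in> carrier G" "?f x = ?f y"
    show "x \<otimes> inv y \<in> \<Inter>\<K>"
    proof
      fix K assume K: "K \<in> \<K>"
      then have "K #> x = K #> y" using fun_cong[OF xy(3), of K] by simp
      then show "x \<otimes> inv y \<in> K" using rcos_eq_iff xy assms(3)[OF K] by blast
    qed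
  qed
qed

text \<open>The normal core, that is the kernel of the action on the cosets. Its index is finite
  because an element acts by one of finitely many self-maps of a finite set.\<close>

lemma (in group) finite_index_core:
  assumes K: "subgroup K G" "finite (rcosets K)"
  shows "\<exists>K'. K' \<lhd> G \<and> finite (rcosets K') \<and> K' \<subseteq> K"
proof -
  interpret K: subgroup K G by fact
  define K' where "K' = {g \<in> carrier G. \<forall>p\<in>carrier G. p \<otimes> g \<otimes> inv p \<in> K}"
  have sg: "subgroup K' G"
  proof (rule subgroupI)
    show "K' \<subseteq> carrier G" by (auto simp: K'_def)
    have "\<one> \<in> K'" by (simp add: K'_def)
    then show "K' \<noteq> {}" by blast
  next
    fix g assume g: "g \<in> K'"
    have "p \<otimes> inv g \<otimes> inv p \<in> K" if p: "p \<in> carrier G" for p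
    proof -
      have "inv (p \<otimes> g \<otimes> inv p) \<in> K" using g p by (simp add: K'_def)
      then show ?thesis using g p by (simp add: K'_def inv_mult_group m_assoc)
    qed
    then show "inv g \<in> K'" using g by (simp add: K'_def)
  next
    fix g h assume g: "g \<in> K'" and h: "h \<in> K'"
    have "p \<otimes> (g \<otimes> h) \<otimes> inv p \<in> K" if p: "p \<in> carrier G" for p
    proof -
      have gh: "g \<in> carrier G" "h \<in> carrier G" using g h by (auto simp: K'_def)
      have "(p \<otimes> g \<otimes> inv p) \<otimes> (p \<otimes> h \<otimes> inv p) \<in> K" by (rule K.m_closed) (use g h p in \<open>auto simp: K'_def\<close>)
      also have "(p \<otimes> g \<otimes> inv p) \<otimes> (p \<otimes> h \<otimes> inv p) = p \<otimes> (g \<otimes> h) \<otimes> inv p"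
      proof -
        have "inv p \<otimes> (p \<otimes> z) = z" if "z \<in> carrier G" for z using that p by (simp add: m_assoc[symmetric])
        then show ?thesis using p gh by (simp add: m_assoc)
      qed
      finally show ?thesis .
    qed
    then show "g \<otimes> h \<in> K'" using g h by (simp add: K'_def)
  qed
  have "K' \<lhd> G"
    unfolding normal_inv_iff
  proof (intro conjI ballI sg)
    fix x g assume x: "x \<in> carrier G" and g: "g \<in> K'"
    have "p \<otimes> (x \<otimes> g \<otimes> inv x) \<otimes> inv p \<in> K" if p: "p \<in> carrier G" for p
    proof -
      have "(p \<otimes> x) \<otimes> g \<otimes> inv (p \<otimes> x) \<in> K" using x g p by (simp add: K'_def)
      then show ?thesis using x p g by (simp add: K'_def inv_mult_group m_assoc)
    qed
    then show "x \<otimes> g \<otimes> inv x \<in> K'" using x g by (simp add: K'_def)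
  qed
  moreover have "finite (rcosets K')"
  proof -
    let ?f = "\<lambda>x. \<lambda>C\<in>rcosets K. C #> x"
    show ?thesis
    proof (rule finite_rcosetsI(1)[OF sg, of ?f "PiE (rcosets K) (\<lambda>_. rcosets K)"])
      have "C #> x \<in> rcosets K" if C: "C \<in> rcosets K" and x: "x \<in> carrier G" for C x
      proof -
        obtain p where "p \<in> carrier G" "C = K #> p" using C by (auto simp: RCOSETS_def)
        then show ?thesis using x K.subset by (auto simp: RCOSETS_def coset_mult_assoc)
      qed
      then show "?f ` carrier G \<subseteq> PiE (rcosets K) (\<lambda>_. rcosets K)" by (auto simp: PiE_iff)
      show "finite (PiE (rcosets K) (\<lambda>_. rcosets K))" using K by (intro finite_PiE) auto
      fix x y assume xy: "x \<in> carrier G" "y \<in> carrier G" "?f x = ?f y"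
      have "p \<otimes> (x \<otimes> inv y) \<otimes> inv p \<in> K" if p: "p \<in> carrier G" for p
      proof -
        have "K #> p \<in> rcosets K" using p by (auto simp: RCOSETS_def)
        then have "K #> p #> x = K #> p #> y" using fun_cong[OF xy(3), of "K #> p"] by simp
        then have "K #> (p \<otimes> x) = K #> (p \<otimes> y)" using xy p K.subset by (simp add: coset_mult_assoc)
        then have "p \<otimes> x \<otimes> inv (p \<otimes> y) \<in> K" using rcos_eq_iff[OF K(1)] xy p by simp
        then show ?thesis using xy p by (simp add: inv_mult_group m_assoc)
      qed
      then show "x \<otimes> inv y \<in> K'" using xy by (simp add: K'_def)
    qed
  qed
  moreover have "K' \<subseteq> K"
  proof
    fix g assume g: "g \<in> K'"
    then have "\<one> \<otimes> g \<otimes> inv \<one> \<in> K" unfolding K'_def by blast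
    then show "g \<in> K" using g by (simp add: K'_def)
  qed
  ultimately show ?thesis by blast
qed

section \<open>The normalizer of a subgroup with finitely many conjugates, and its quotient by the
  subgroup\<close>

locale finite_conjugacy = group G for G (structure) +
  fixes H :: "'a set"
  assumes H: "subgroup H G" and fin_class: "finite ((\<lambda>g. conjugate G g H) ` carrier G)"
begin

definition N :: "'a set" where "N = {g \<in> carrier G. conjugate G g H = H}"

text \<open>One element for each conjugate of \<open>H\<close>; equivalently a transversal of the
  left cosets of the normalizer \<open>N\<close>.\<close>

definition S :: "'a set"
  where "S = (\<lambda>C. SOME g. g \<in> carrier G \<and> conjugate G g H = C) ` ((\<lambda>g. conjugate G g H) ` carrier G)"

definition \<Gamma> :: "'a set monoid" where "\<Gamma> = G\<lparr>carrier := N\<rparr> Mod H"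

text \<open>A set-theoretic section of the projection from \<open>N\<close> to
  \<open>\<Gamma>\<close>. In general it is not multiplicative, but its defects lie in
  \<open>H\<close> (see \<open>sect_mult\<close>) and fix the points whose stabilizer looks like
  \<open>H\<close>.\<close>

definition sect :: "'a set \<Rightarrow> 'a" where "sect \<gamma> = (SOME n. n \<in> N \<and> H #> n = \<gamma>)"

lemma Hc: "H \<subseteq> carrier G"
  using H by (rule subgroup.subset)

lemma N_carrier: "N \<subseteq> carrier G"
  by (auto simp: N_def)

lemma N_closed:
  assumes "g \<in> N" "h \<in> N"
  shows "g \<otimes> h \<in> N" "inv g \<in> N"
proof -
  have c: "g \<in> carrier G" "h \<in> carrier G" "conjugate G g H = H" "conjugate G h H = H" using assms by (auto simp: N_def)
  have "conjugate G (g \<otimes> h) H = H" using conjugate_conjugate[OF Hc c(1,2)] c(3,4) by simp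
  then show "g \<otimes> h \<in> N" using c by (simp add: N_def)
  have "conjugate G (inv g) (conjugate G g H) = H"
    using conjugate_conjugate[OF Hc, of "inv g" g] c(1) by (simp add: conjugate_one Hc)
  then show "inv g \<in> N" using c by (simp add: N_def)
qed

lemma one_N: "\<one> \<in> N"
  by (simp add: N_def conjugate_one Hc)

lemma N_subgroup: "subgroup N G"
  by (rule subgroupI) (use N_carrier N_closed one_N in auto)

lemma H_N: "H \<subseteq> N"
proof
  fix h assume h: "h \<in> H"
  interpret H: subgroup H G by (rule H)
  have hc: "h \<in> carrier G" using h by simp
  have le: "conjugate G k H \<subseteq> H" if "k \<in> H" for k using that by (auto simp: conjugate_def)
  have "H = conjugate G h (conjugate G (inv h) H)" using hc by (simp add: conjugate_conjugate Hc conjugate_one)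
  also have "\<dots> \<subseteq> conjugate G h H" using le[of "inv h"] h unfolding conjugate_def by auto
  finally have "conjugate G h H = H" using le[OF h] by simp
  then show "h \<in> N" using hc by (simp add: N_def)
qed

lemma S_some:
  assumes "g \<in> carrier G"
  obtains s where "s \<in> S" "s \<in> carrier G" "conjugate G s H = conjugate G g H"
proof -
  let ?s = "SOME h. h \<in> carrier G \<and> conjugate G h H = conjugate G g H"
  have "?s \<in> carrier G \<and> conjugate G ?s H = conjugate G g H" by (rule someI_ex) (use assms in blast)
  moreover have "?s \<in> S" using assms by (auto simp: S_def)
  ultimately show thesis using that by blast
qed

lemma S_finite: "finite S"
  unfolding S_def using fin_class by simp

lemma S_ex: "s \<in> S \<Longrightarrow> \<exists>g\<in>carrier G. s = (SOME h. h \<in> carrier G \<and> conjugate G h H = conjugate G g H)"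
  by (auto simp: S_def)

lemma S_spec:
  assumes "g \<in> carrier G" "s = (SOME h. h \<in> carrier G \<and> conjugate G h H = conjugate G g H)"
  shows "s \<in> carrier G \<and> conjugate G s H = conjugate G g H"
  unfolding assms(2) by (rule someI_ex) (use assms(1) in blast)

lemma S_carrier: "S \<subseteq> carrier G"
  using S_ex S_spec by blast

lemma S_inj:
  assumes "s \<in> S" "s' \<in> S" "conjugate G s H = conjugate G s' H"
  shows "s = s'"
proof -
  obtain g where g: "g \<in> carrier G" "s = (SOME h. h \<in> carrier G \<and> conjugate G h H = conjugate G g H)" using S_ex[OF assms(1)] by blast
  obtain g' where g': "g' \<in> carrier G" "s' = (SOME h. h \<in> carrier G \<and> conjugate G h H = conjugate G g' H)" using S_ex[OF assms(2)] by blast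
  have "conjugate G g H = conjugate G g' H" using S_spec[OF g] S_spec[OF g'] assms(3) by simp
  then show ?thesis using g(2) g'(2) by simp
qed

lemma card_S: "card S = card ((\<lambda>g. conjugate G g H) ` carrier G)"
proof -
  have "(\<lambda>g. conjugate G g H) ` carrier G = (\<lambda>s. conjugate G s H) ` S"
  proof
    show "(\<lambda>g. conjugate G g H) ` carrier G \<subseteq> (\<lambda>s. conjugate G s H) ` S"
    proof (rule image_subsetI)
      fix g assume "g \<in> carrier G"
      then obtain s where "s \<in> S" "conjugate G s H = conjugate G g H" by (rule S_some)
      then show "conjugate G g H \<in> (\<lambda>s. conjugate G s H) ` S" by (metis imageI)
    qed
  qed (use S_carrier in blast)
  moreover have "inj_on (\<lambda>s. conjugate G s H) S" using S_inj by (auto intro: inj_onI)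
  ultimately show ?thesis by (simp add: card_image)
qed

lemma S_decomp:
  assumes p: "p \<in> carrier G"
  obtains s n where "s \<in> S" "n \<in> N" "p = s \<otimes> n"
proof -
  obtain s where s: "s \<in> S" "s \<in> carrier G" "conjugate G s H = conjugate G p H" using S_some[OF p] .
  have "conjugate G (inv s \<otimes> p) H = conjugate G (inv s) (conjugate G s H)"
    using s(2,3) p conjugate_conjugate[OF Hc, of "inv s" p] by simp
  also have "\<dots> = H" using conjugate_conjugate[OF Hc, of "inv s" s] s(2) by (simp add: conjugate_one Hc)
  finally have "inv s \<otimes> p \<in> N" using s p by (simp add: N_def)
  moreover have "p = s \<otimes> (inv s \<otimes> p)" using s p by (simp add: m_assoc[symmetric])
  ultimately show thesis using that s by blast
qed

lemma S_decomp_unique: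
  assumes "s \<in> S" "s' \<in> S" "n \<in> N" "n' \<in> N" "s \<otimes> n = s' \<otimes> n'"
  shows "s = s'"
proof (rule S_inj[OF assms(1,2)])
  have c: "s \<in> carrier G" "s' \<in> carrier G" "n \<in> carrier G" "n' \<in> carrier G" "conjugate G n H = H" "conjugate G n' H = H"
    using assms S_carrier by (auto simp: N_def)
  have "conjugate G s H = conjugate G (s \<otimes> n) H" using c conjugate_conjugate[OF Hc, of s n] by simp
  also have "\<dots> = conjugate G s' H" unfolding assms(5) using c conjugate_conjugate[OF Hc, of s' n'] by simp
  finally show "conjugate G s H = conjugate G s' H" .
qed

lemma group_N: "group (G\<lparr>carrier := N\<rparr>)"
  using N_subgroup by (rule subgroup.subgroup_is_group) (rule is_group)

lemma H_normal: "H \<lhd> G\<lparr>carrier := N\<rparr>"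
proof -
  interpret GN: group "G\<lparr>carrier := N\<rparr>" by (rule group_N)
  have "subgroup H (G\<lparr>carrier := N\<rparr>)" using H H_N N_subgroup by (intro subgroup_incl)
  moreover have "n \<otimes> h \<otimes> inv\<^bsub>G\<lparr>carrier := N\<rparr>\<^esub> n \<in> H" if "n \<in> N" "h \<in> H" for n h
  proof -
    have "n \<otimes> h \<otimes> inv n \<in> conjugate G n H" using that by (auto simp: conjugate_def)
    then show ?thesis using that m_inv_consistent[OF N_subgroup, of n] by (simp add: N_def)
  qed
  ultimately show ?thesis unfolding GN.normal_inv_iff by simp
qed

lemma group_\<Gamma>: "group \<Gamma>"
  unfolding \<Gamma>_def using H_normal by (rule normal.factorgroup_is_group)

lemma rcos_N: "H #>\<^bsub>G\<lparr>carrier := N\<rparr>\<^esub> n = H #> n"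
  by (simp add: r_coset_def)

lemma carrier_\<Gamma>: "carrier \<Gamma> = (\<lambda>n. H #> n) ` N"
  by (auto simp: \<Gamma>_def FactGroup_def RCOSETS_def rcos_N)

lemma \<Gamma>_rep:
  assumes "C \<in> carrier \<Gamma>"
  obtains n where "n \<in> N" "C = H #> n"
  using assms by (auto simp: carrier_\<Gamma>)

lemma mult_\<Gamma>:
  assumes "n \<in> N" "n' \<in> N"
  shows "(H #> n) \<otimes>\<^bsub>\<Gamma>\<^esub> (H #> n') = H #> (n \<otimes> n')"
  using normal.rcos_sum[OF H_normal, of n n'] assms
  by (simp add: \<Gamma>_def FactGroup_def rcos_N set_mult_def)

lemma one_\<Gamma>: "\<one>\<^bsub>\<Gamma>\<^esub> = H"
  by (simp add: \<Gamma>_def FactGroup_def)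

lemma inv_\<Gamma>:
  assumes n: "n \<in> N"
  shows "inv\<^bsub>\<Gamma>\<^esub> (H #> n) = H #> inv n"
proof (rule group.inv_equality[OF group_\<Gamma>])
  have nc: "n \<in> carrier G" using n N_carrier by blast
  show "(H #> inv n) \<otimes>\<^bsub>\<Gamma>\<^esub> (H #> n) = \<one>\<^bsub>\<Gamma>\<^esub>" using mult_\<Gamma>[of "inv n" n] n N_closed nc Hc by (simp add: one_\<Gamma>)
qed (use n N_closed in \<open>auto simp: carrier_\<Gamma>\<close>)

lemma sect:
  assumes "\<gamma> \<in> carrier \<Gamma>"
  shows "sect \<gamma> \<in> N" "H #> sect \<gamma> = \<gamma>"
proof -
  have "sect \<gamma> \<in> N \<and> H #> sect \<gamma> = \<gamma>"
    unfolding sect_def by (rule someI_ex) (use assms in \<open>auto simp: carrier_\<Gamma>\<close>)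
  then show "sect \<gamma> \<in> N" "H #> sect \<gamma> = \<gamma>" by auto
qed

text \<open>The two quotients of \<open>n\<close> and \<open>n'\<close> are conjugate by
  \<open>n'\<close>, which normalizes \<open>H\<close>. The present form writes \<open>n\<close> as
  \<open>n'\<close> times an element of \<open>H\<close> on the right, where that element acts on a
  point before \<open>n'\<close> does.\<close>

lemma H_rcos_eq_iff:
  assumes "n \<in> N" "n' \<in> N"
  shows "H #> n = H #> n' \<longleftrightarrow> inv n' \<otimes> n \<in> H"
proof -
  have c: "n \<in> carrier G" "n' \<in> carrier G" "n' \<in> N" using assms N_carrier by auto
  have "H #> n = H #> n' \<longleftrightarrow> n \<otimes> inv n' \<in> H" using rcos_eq_iff[OF H] c by simp
  also have "n \<otimes> inv n' = n' \<otimes> (inv n' \<otimes> n) \<otimes> inv n'" using c by (simp add: m_assoc[symmetric])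
  also have "n' \<otimes> (inv n' \<otimes> n) \<otimes> inv n' \<in> H \<longleftrightarrow> inv n' \<otimes> n \<in> H"
    using mem_conjugate_iff[OF Hc c(2), of "inv n' \<otimes> n"] c by (simp add: N_def)
  finally show ?thesis .
qed

lemma sect_mult:
  assumes "\<gamma> \<in> carrier \<Gamma>" "n \<in> N"
  shows "inv (sect ((H #> n) \<otimes>\<^bsub>\<Gamma>\<^esub> \<gamma>)) \<otimes> (n \<otimes> sect \<gamma>) \<in> H"
proof -
  interpret \<Gamma>: group \<Gamma> by (rule group_\<Gamma>)
  have c: "(H #> n) \<otimes>\<^bsub>\<Gamma>\<^esub> \<gamma> \<in> carrier \<Gamma>" using assms by (intro \<Gamma>.m_closed) (auto simp: carrier_\<Gamma>)
  have "H #> (n \<otimes> sect \<gamma>) = (H #> n) \<otimes>\<^bsub>\<Gamma>\<^esub> \<gamma>" using mult_\<Gamma>[OF assms(2) sect(1)[OF assms(1)]] sect(2)[OF assms(1)] by simp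
  then show ?thesis
    using H_rcos_eq_iff[of "n \<otimes> sect \<gamma>" "sect ((H #> n) \<otimes>\<^bsub>\<Gamma>\<^esub> \<gamma>)"] sect[OF c] sect(1)[OF assms(1)] assms(2) N_closed by simp
qed

text \<open>The mean is restricted to \<open>N\<close>, normalized and pushed forward.
  \<open>\<mu> N\<close> is positive because finitely many translates of \<open>N\<close> cover the
  group.\<close>

lemma \<Gamma>_mean:
  assumes \<mu>: "invariant_mean G \<mu>"
  shows "invariant_mean \<Gamma> (\<lambda>A. \<mu> (\<Union>A) / \<mu> N)"
proof -
  have sN: "s <# N \<subseteq> carrier G" if "s \<in> S" for s using that S_carrier N_carrier by (auto simp: l_coset_def)
  have "1 = \<mu> (carrier G)" using invariant_meanD(1)[OF \<mu>] by simp
  also have "carrier G = (\<Union>s\<in>S. s <# N)"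
  proof
    show "carrier G \<subseteq> (\<Union>s\<in>S. s <# N)"
    proof
      fix p assume "p \<in> carrier G"
      then obtain s n where "s \<in> S" "n \<in> N" "p = s \<otimes> n" by (rule S_decomp)
      then show "p \<in> (\<Union>s\<in>S. s <# N)" by (auto simp: l_coset_def)
    qed
  qed (use sN in blast)
  also have "\<mu> (\<Union>s\<in>S. s <# N) = (\<Sum>s\<in>S. \<mu> (s <# N))"
    using S_decomp_unique by (intro invariant_mean_UN[OF \<mu> S_finite sN]) (auto simp: disjoint_family_on_def l_coset_def)
  also have "\<dots> = (\<Sum>s\<in>S. \<mu> N)"
    using S_carrier N_carrier by (intro sum.cong invariant_meanD(4)[OF \<mu>]) auto
  also have "\<dots> = card S * \<mu> N" by simp
  finally have "\<mu> N \<noteq> 0" by auto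
  then have pos: "0 < \<mu> N" using invariant_meanD(2)[OF \<mu> N_carrier] by simp
  have U: "\<Union>A \<subseteq> N" if A: "A \<subseteq> carrier \<Gamma>" for A
  proof -
    have "H #> n \<subseteq> N" if "n \<in> N" for n using that H_N N_closed by (auto simp: r_coset_def)
    show ?thesis
    proof (rule Union_least)
      fix C assume "C \<in> A"
      then obtain n where "n \<in> N" "C = H #> n" using A by (auto simp: carrier_\<Gamma>)
      then show "C \<subseteq> N" using \<open>\<And>n. n \<in> N \<Longrightarrow> H #> n \<subseteq> N\<close> by simp
    qed
  qed
  have Uc: "\<Union>A \<subseteq> carrier G" if A: "A \<subseteq> carrier \<Gamma>" for A using U[OF A] N_carrier by blast
  show ?thesis
    unfolding invariant_mean_def
  proof (intro conjI allI impI)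
    have "\<Union>(carrier \<Gamma>) = N"
    proof
      show "N \<subseteq> \<Union>(carrier \<Gamma>)"
      proof
        fix n assume n: "n \<in> N"
        then have "n \<in> H #> n" using rcos_self[OF _ H] N_carrier by blast
        then show "n \<in> \<Union>(carrier \<Gamma>)" using n by (auto simp: carrier_\<Gamma>)
      qed
    qed (use U in blast)
    then show "\<mu> (\<Union>(carrier \<Gamma>)) / \<mu> N = 1" using pos by simp
  next
    fix A assume "A \<subseteq> carrier \<Gamma>"
    then show "0 \<le> \<mu> (\<Union>A) / \<mu> N" using invariant_meanD(2)[OF \<mu> Uc] pos by simp
  next
    fix A B assume AB: "A \<subseteq> carrier \<Gamma>" "B \<subseteq> carrier \<Gamma>" "A \<inter> B = {}"
    have "\<Union>A \<inter> \<Union>B = {}"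
    proof (rule ccontr)
      assume "\<Union>A \<inter> \<Union>B \<noteq> {}"
      then obtain x C D where x: "C \<in> A" "D \<in> B" "x \<in> C" "x \<in> D" by blast
      obtain n where n: "n \<in> N" "C = H #> n" using x(1) AB(1) by (blast intro: \<Gamma>_rep)
      obtain n' where n': "n' \<in> N" "D = H #> n'" using x(2) AB(2) by (blast intro: \<Gamma>_rep)
      have "n \<in> carrier G" "n' \<in> carrier G" using n n' N_carrier by auto
      then have "C = H #> x" "D = H #> x"
        using repr_independence[of x H n] repr_independence[of x H n'] x(3,4) n(2) n'(2) H by blast+
      then show False using x AB by blast
    qed
    then have "\<mu> (\<Union>A \<union> \<Union>B) = \<mu> (\<Union>A) + \<mu> (\<Union>B)" using Uc AB by (intro invariant_meanD(3)[OF \<mu>]) auto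
    then show "\<mu> (\<Union>(A \<union> B)) / \<mu> N = \<mu> (\<Union>A) / \<mu> N + \<mu> (\<Union>B) / \<mu> N" by (simp add: add_divide_distrib Union_Un_distrib)
  next
    fix \<gamma> A assume \<gamma>: "\<gamma> \<in> carrier \<Gamma>" and A: "A \<subseteq> carrier \<Gamma>"
    then obtain n where n: "n \<in> N" "\<gamma> = H #> n" by (auto simp: carrier_\<Gamma>)
    have nc: "n \<in> carrier G" using n N_carrier by blast
    have coset: "\<gamma> \<otimes>\<^bsub>\<Gamma>\<^esub> C = n <# C" if C: "C \<in> A" for C
    proof -
      obtain c where c: "c \<in> N" "C = H #> c" using C A by (blast intro: \<Gamma>_rep)
      have cc: "c \<in> carrier G" using c N_carrier by blast
      have "H #> n = n <# H" 
      proof -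
        have "H #>\<^bsub>G\<lparr>carrier := N\<rparr>\<^esub> n = n <#\<^bsub>G\<lparr>carrier := N\<rparr>\<^esub> H" using normal.coset_eq[OF H_normal] n by simp
        then show ?thesis by (simp add: r_coset_def l_coset_def)
      qed
      have "\<gamma> \<otimes>\<^bsub>\<Gamma>\<^esub> C = H #> (n \<otimes> c)" using mult_\<Gamma> n c by simp
      also have "\<dots> = (H #> n) #> c" using Hc nc cc by (simp add: coset_mult_assoc)
      also have "\<dots> = (n <# H) #> c" using \<open>H #> n = n <# H\<close> by simp
      also have "\<dots> = n <# (H #> c)" using Hc nc cc by (simp add: coset_assoc)
      finally show ?thesis using c by simp
    qed
    have "\<Union>(\<gamma> <#\<^bsub>\<Gamma>\<^esub> A) = (\<Union>C\<in>A. \<gamma> \<otimes>\<^bsub>\<Gamma>\<^esub> C)" by (auto simp: l_coset_def)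
    also have "\<dots> = (\<Union>C\<in>A. n <# C)" using coset by simp
    also have "\<dots> = n <# \<Union>A" by (auto simp: l_coset_def)
    finally have "\<mu> (\<Union>(\<gamma> <#\<^bsub>\<Gamma>\<^esub> A)) = \<mu> (\<Union>A)" using invariant_meanD(4)[OF \<mu> nc Uc[OF A]] by simp
    then show "\<mu> (\<Union>(\<gamma> <#\<^bsub>\<Gamma>\<^esub> A)) / \<mu> N = \<mu> (\<Union>A) / \<mu> N" by simp
  qed
qed

text \<open>A nontrivial element of \<open>\<Gamma>\<close> has its representative outside
  \<open>H\<close>, hence outside one of the finite-index subgroups that intersect in
  \<open>H\<close>. Finitely many of these meet in a subgroup \<open>L\<close> above
  \<open>H\<close>; the image of \<open>L \<inter> N\<close> in \<open>\<Gamma>\<close> has finite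
  index and misses \<open>B\<close>, and so does its core.\<close>

lemma \<Gamma>_residually_finite:
  assumes pc: "profinitely_closed G H" and B: "finite B" "B \<subseteq> carrier \<Gamma>" "\<one>\<^bsub>\<Gamma>\<^esub> \<notin> B"
  shows "\<exists>K. K \<lhd> \<Gamma> \<and> finite (rcosets\<^bsub>\<Gamma>\<^esub> K) \<and> K \<inter> B = {}"
proof -
  interpret \<Gamma>: group \<Gamma> by (rule group_\<Gamma>)
  obtain K :: "nat \<Rightarrow> 'a set" where K: "\<And>i. subgroup (K i) G \<and> finite (rcosets (K i))" "H = (\<Inter>i. K i)"
    using pc unfolding profinitely_closed_def by blast
  have "\<exists>i. sect C \<notin> K i" if C: "C \<in> B" for C
  proof -
    have Cc: "C \<in> carrier \<Gamma>" using C B by blast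
    have "sect C \<notin> H"
    proof
      assume "sect C \<in> H"
      then have "H #> sect C = H" using sect(1)[OF Cc] N_carrier H by (intro coset_join2) auto
      then show False using sect(2)[OF Cc] C B(3) one_\<Gamma> by simp
    qed
    then show ?thesis using K(2) by blast
  qed
  then have "\<forall>C\<in>B. \<exists>i. sect C \<notin> K i" by blast
  from bchoice[OF this] obtain i where i: "\<forall>C\<in>B. sect C \<notin> K (i C)" ..
  \<comment> \<open>The index 0 keeps the family nonempty when \<open>B\<close> is empty.\<close>
  define L where "L = \<Inter>(K ` insert 0 (i ` B))"
  have L: "subgroup L G" "finite (rcosets L)"
    using finite_rcosets_Int[of "K ` insert 0 (i ` B)"] K(1) B(1) unfolding L_def by auto
  have HL: "H \<subseteq> L" using K(2) by (auto simp: L_def)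
  interpret L: subgroup L G by (rule L(1))
  define M where "M = {C \<in> carrier \<Gamma>. C \<subseteq> L}"
  have M_iff: "H #> n \<in> M \<longleftrightarrow> n \<in> L" if n: "n \<in> N" for n
  proof -
    have nc: "n \<in> carrier G" using n N_carrier by blast
    have "n \<in> H #> n" using rcos_self[OF nc H] .
    moreover have "H #> n \<subseteq> L" if "n \<in> L" using that HL by (auto simp: r_coset_def)
    ultimately show ?thesis using n by (auto simp: M_def carrier_\<Gamma>)
  qed
  have sgM: "subgroup M \<Gamma>"
  proof (rule \<Gamma>.subgroupI)
    show "M \<subseteq> carrier \<Gamma>" by (auto simp: M_def)
    have "H #> \<one> \<in> M" using M_iff[OF one_N] by simp
    then show "M \<noteq> {}" by blast
  next
    fix C assume C: "C \<in> M"
    then obtain n where n: "n \<in> N" "C = H #> n" by (auto simp: M_def carrier_\<Gamma>)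
    then have "n \<in> L" using M_iff C by simp
    then show "inv\<^bsub>\<Gamma>\<^esub> C \<in> M" using n inv_\<Gamma> M_iff[of "inv n"] N_closed by simp
  next
    fix C D assume C: "C \<in> M" "D \<in> M"
    then obtain n n' where n: "n \<in> N" "C = H #> n" "n' \<in> N" "D = H #> n'" by (auto simp: M_def carrier_\<Gamma>)
    then have "n \<in> L" "n' \<in> L" using M_iff C by simp_all
    then show "C \<otimes>\<^bsub>\<Gamma>\<^esub> D \<in> M" using n mult_\<Gamma> M_iff[of "n \<otimes> n'"] N_closed by simp
  qed
  have "finite (rcosets\<^bsub>\<Gamma>\<^esub> M)"
  proof (rule \<Gamma>.finite_rcosetsI(1)[OF sgM, of "\<lambda>C. L #> sect C" "rcosets L"])
    show "(\<lambda>C. L #> sect C) ` carrier \<Gamma> \<subseteq> rcosets L" using sect(1) N_carrier by (auto simp: RCOSETS_def)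
    fix C D assume CD: "C \<in> carrier \<Gamma>" "D \<in> carrier \<Gamma>" "L #> sect C = L #> sect D"
    have n: "sect C \<in> N" "sect D \<in> N" "H #> sect C = C" "H #> sect D = D" using sect CD by auto
    then have "sect C \<otimes> inv (sect D) \<in> L" using rcos_eq_iff[OF L(1)] CD(3) N_carrier by blast
    moreover have "C \<otimes>\<^bsub>\<Gamma>\<^esub> inv\<^bsub>\<Gamma>\<^esub> D = H #> (sect C \<otimes> inv (sect D))"
      using mult_\<Gamma>[of "sect C" "inv (sect D)"] inv_\<Gamma>[of "sect D"] n N_closed by simp
    ultimately show "C \<otimes>\<^bsub>\<Gamma>\<^esub> inv\<^bsub>\<Gamma>\<^esub> D \<in> M" using M_iff[of "sect C \<otimes> inv (sect D)"] n N_closed by simp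
  qed (rule L(2))
  then obtain K' where K': "K' \<lhd> \<Gamma>" "finite (rcosets\<^bsub>\<Gamma>\<^esub> K')" "K' \<subseteq> M" using \<Gamma>.finite_index_core[OF sgM] by blast
  moreover have "K' \<inter> B = {}"
  proof (rule ccontr)
    assume "K' \<inter> B \<noteq> {}"
    then obtain C where C: "C \<in> M" "C \<in> B" using K'(3) by blast
    then have "sect C \<in> L" using M_iff[of "sect C"] sect[of C] B(2) by auto
    then have "sect C \<in> K (i C)" using C(2) by (auto simp: L_def)
    then show False using i C(2) by blast
  qed
  ultimately show ?thesis by blast
qed

lemma \<Gamma>_tiles:
  assumes \<mu>: "invariant_mean G \<mu>" and pc: "profinitely_closed G H"
    and E: "finite E" "E \<subseteq> carrier \<Gamma>" "0 < \<delta>"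
  shows "\<exists>T K. folner_set \<Gamma> E \<delta> T \<and> K \<lhd> \<Gamma> \<and> finite (rcosets\<^bsub>\<Gamma>\<^esub> K) \<and> bij_betw (\<lambda>t. K #>\<^bsub>\<Gamma>\<^esub> t) T (rcosets\<^bsub>\<Gamma>\<^esub> K)"
proof -
  interpret \<Gamma>: group \<Gamma> by (rule group_\<Gamma>)
  show ?thesis
  proof (rule \<Gamma>.folner_transversal[OF _ _ E])
    fix E :: "'a set set" and \<epsilon> :: real assume "finite E" "E \<subseteq> carrier \<Gamma>" "0 < \<epsilon>"
    then show "\<exists>T. folner_set \<Gamma> E \<epsilon> T" using \<Gamma>.folner_set_exists[OF \<Gamma>_mean[OF \<mu>]] by metis
  qed (rule \<Gamma>_residually_finite[OF pc])
qed

end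

lemma (in group) inv_mult_cancel:
  "x \<in> carrier G \<Longrightarrow> z \<in> carrier G \<Longrightarrow> inv x \<otimes> (x \<otimes> z) = z"
  by (simp add: m_assoc[symmetric])

lemma (in group) normal_rcos_eq_iff:
  assumes K: "K \<lhd> G" and x: "x \<in> carrier G" and y: "y \<in> carrier G"
  shows "K #> x = K #> y \<longleftrightarrow> inv x \<otimes> y \<in> K"
proof -
  interpret K: normal K G by (rule K)
  have "K #> x = K #> y \<longleftrightarrow> K #> y = K #> x" by auto
  also have "\<dots> \<longleftrightarrow> y \<otimes> inv x \<in> K" using rcos_eq_iff[OF K.subgroup_axioms y x] .
  also have "\<dots> \<longleftrightarrow> inv x \<otimes> y \<in> K"
  proof
    assume "y \<otimes> inv x \<in> K"
    then have "inv x \<otimes> (y \<otimes> inv x) \<otimes> x \<in> K" using x by (rule K.inv_op_closed1[rotated])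
    then show "inv x \<otimes> y \<in> K" using x y by (simp add: m_assoc)
  next
    assume "inv x \<otimes> y \<in> K"
    then have "x \<otimes> (inv x \<otimes> y) \<otimes> inv x \<in> K" using x by (rule K.inv_op_closed2[rotated])
    then show "y \<otimes> inv x \<in> K" using x y by (simp add: m_assoc[symmetric])
  qed
  finally show ?thesis .
qed

section \<open>Induction of tiles from the normalizer to the whole group\<close>

context finite_conjugacy
begin

text \<open>The full preimage in \<open>N\<close> of a subgroup of \<open>\<Gamma>\<close>. It is a
  point stabilizer of the transitive set induced from the cosets of \<open>K\<close> in
  \<open>\<Gamma>\<close>.\<close>

definition pre :: "'a set set \<Rightarrow> 'a set" where "pre K = {n \<in> N. H #> n \<in> K}"

text \<open>The induced counterpart of \<open>D\<close>: one copy, or sheet, for each element of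
  \<open>S\<close>.\<close>

definition lift :: "'a set set \<Rightarrow> 'a set" where "lift D = (\<lambda>(s, t). s \<otimes> sect t) ` (S \<times> D)"

lemma pre_subgroup:
  assumes K: "subgroup K \<Gamma>"
  shows "subgroup (pre K) G"
proof -
  interpret K: subgroup K \<Gamma> by (rule K)
  show ?thesis
  proof (rule subgroupI)
    show "pre K \<subseteq> carrier G" using N_carrier by (auto simp: pre_def)
    have "\<one> \<in> pre K" using one_N K.one_closed Hc by (simp add: pre_def one_\<Gamma>)
    then show "pre K \<noteq> {}" by blast
  next
    fix x assume x: "x \<in> pre K"
    interpret \<Gamma>: group \<Gamma> by (rule group_\<Gamma>)
    have "inv\<^bsub>\<Gamma>\<^esub> (H #> x) \<in> K" using x by (intro K.m_inv_closed) (simp add: pre_def)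
    then show "inv x \<in> pre K" using x inv_\<Gamma> N_closed(2)[of x x] by (simp add: pre_def)
  next
    fix x y assume x: "x \<in> pre K" and y: "y \<in> pre K"
    then have "(H #> x) \<otimes>\<^bsub>\<Gamma>\<^esub> (H #> y) \<in> K" by (intro K.m_closed) (simp_all add: pre_def)
    then show "x \<otimes> y \<in> pre K" using x y mult_\<Gamma> N_closed by (simp add: pre_def)
  qed
qed

lemma H_pre:
  assumes "subgroup K \<Gamma>"
  shows "H \<subseteq> pre K"
proof
  fix h assume h: "h \<in> H"
  then have "H #> h = H" using Hc H by (intro coset_join2) auto
  then show "h \<in> pre K" using h H_N subgroup.one_closed[OF assms] by (auto simp: pre_def one_\<Gamma>)
qed

lemma pre_div_iff:
  assumes K: "K \<lhd> \<Gamma>" and n: "n \<in> N" "n' \<in> N"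
  shows "inv n \<otimes> n' \<in> pre K \<longleftrightarrow> K #>\<^bsub>\<Gamma>\<^esub> (H #> n) = K #>\<^bsub>\<Gamma>\<^esub> (H #> n')"
proof -
  have "inv\<^bsub>\<Gamma>\<^esub> (H #> n) \<otimes>\<^bsub>\<Gamma>\<^esub> (H #> n') = H #> (inv n \<otimes> n')"
    using n N_closed by (simp add: inv_\<Gamma> mult_\<Gamma>)
  then show ?thesis
    using group.normal_rcos_eq_iff[OF group_\<Gamma> K, of "H #> n" "H #> n'"] n N_closed by (simp add: pre_def carrier_\<Gamma>)
qed

text \<open>The inverse of an element decomposes as \<open>s n\<close>, and its coset depends only
  on \<open>s\<close> and on the element of \<open>T\<close> that represents \<open>n\<close> modulo
  \<open>K\<close>. The inverse appears because right cosets stand for left cosets.\<close>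

lemma pre_rcosets:
  assumes K: "K \<lhd> \<Gamma>" and T: "finite T" "T \<subseteq> carrier \<Gamma>" and bij: "bij_betw (\<lambda>t. K #>\<^bsub>\<Gamma>\<^esub> t) T (rcosets\<^bsub>\<Gamma>\<^esub> K)"
  shows "finite (rcosets (pre K))" "card (rcosets (pre K)) \<le> card S * card T"
proof -
  have sg: "subgroup (pre K) G" using K by (intro pre_subgroup normal_imp_subgroup)
  have "\<exists>st. st \<in> S \<times> T \<and> (\<exists>n\<in>N. inv x = fst st \<otimes> n \<and> K #>\<^bsub>\<Gamma>\<^esub> (H #> n) = K #>\<^bsub>\<Gamma>\<^esub> snd st)" if x: "x \<in> carrier G" for x
  proof -
    obtain s n where s: "s \<in> S" "n \<in> N" "inv x = s \<otimes> n" using S_decomp[OF inv_closed[OF x]] .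
    have "K #>\<^bsub>\<Gamma>\<^esub> (H #> n) \<in> rcosets\<^bsub>\<Gamma>\<^esub> K" using s by (auto simp: RCOSETS_def carrier_\<Gamma>)
    then obtain t where "t \<in> T" "K #>\<^bsub>\<Gamma>\<^esub> (H #> n) = K #>\<^bsub>\<Gamma>\<^esub> t" using bij unfolding bij_betw_def by blast
    then show ?thesis using s by (intro exI[of _ "(s, t)"]) auto
  qed
  then have "\<forall>x\<in>carrier G. \<exists>st. st \<in> S \<times> T \<and> (\<exists>n\<in>N. inv x = fst st \<otimes> n \<and> K #>\<^bsub>\<Gamma>\<^esub> (H #> n) = K #>\<^bsub>\<Gamma>\<^esub> snd st)" by blast
  from bchoice[OF this] obtain f where
    f: "\<forall>x\<in>carrier G. f x \<in> S \<times> T \<and> (\<exists>n\<in>N. inv x = fst (f x) \<otimes> n \<and> K #>\<^bsub>\<Gamma>\<^esub> (H #> n) = K #>\<^bsub>\<Gamma>\<^esub> snd (f x))" ..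
  have eq: "x \<otimes> inv y \<in> pre K" if xy: "x \<in> carrier G" "y \<in> carrier G" "f x = f y" for x y
  proof -
    obtain n where n: "n \<in> N" "inv x = fst (f x) \<otimes> n" "K #>\<^bsub>\<Gamma>\<^esub> (H #> n) = K #>\<^bsub>\<Gamma>\<^esub> snd (f x)" using f xy by blast
    obtain n' where n': "n' \<in> N" "inv y = fst (f y) \<otimes> n'" "K #>\<^bsub>\<Gamma>\<^esub> (H #> n') = K #>\<^bsub>\<Gamma>\<^esub> snd (f y)" using f xy by blast
    have "fst (f x) \<in> S" using f xy(1) by auto
    then have c: "fst (f x) \<in> carrier G" "n \<in> carrier G" "n' \<in> carrier G" using n n' S_carrier N_carrier by auto
    have "x = inv (fst (f x) \<otimes> n)" using n(2) xy by (metis inv_inv)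
    then have "x \<otimes> inv y = inv n \<otimes> (inv (fst (f x)) \<otimes> (fst (f x) \<otimes> n'))" using n' xy(3) c by (simp add: inv_mult_group m_assoc)
    also have "\<dots> = inv n \<otimes> n'" using c by (simp add: m_assoc[symmetric])
    finally show ?thesis using pre_div_iff[OF K n(1) n'(1)] n(3) n'(3) xy(3) by simp
  qed
  have 1: "f ` carrier G \<subseteq> S \<times> T" using f by blast
  have 2: "finite (S \<times> T)" using S_finite T by simp
  have "finite (rcosets (pre K))" by (rule finite_rcosetsI(1)[OF sg 1 2 eq])
  moreover have "card (rcosets (pre K)) \<le> card (S \<times> T)" by (rule finite_rcosetsI(2)[OF sg 1 2 eq])
  ultimately show "finite (rcosets (pre K))" "card (rcosets (pre K)) \<le> card S * card T" by (simp_all add: card_cartesian_product)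
qed

lemma lift_carrier: "D \<subseteq> carrier \<Gamma> \<Longrightarrow> lift D \<subseteq> carrier G"
  using S_carrier N_carrier sect(1) by (fastforce simp: lift_def)

lemma lift_inj:
  assumes D: "D \<subseteq> carrier \<Gamma>"
  shows "inj_on (\<lambda>(s, t). s \<otimes> sect t) (S \<times> D)"
proof (rule inj_onI, clarify)
  fix s t s' t' assume s: "s \<in> S" "s' \<in> S" and t: "t \<in> D" "t' \<in> D" and eq: "s \<otimes> sect t = s' \<otimes> sect t'"
  have n: "sect t \<in> N" "sect t' \<in> N" "H #> sect t = t" "H #> sect t' = t'" using sect t D by auto
  have "s = s'" using S_decomp_unique[OF s n(1,2) eq] .
  then have "sect t = sect t'" using eq n s S_carrier N_carrier left_cancel[of s "sect t" "sect t'"] by auto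
  then show "s = s' \<and> t = t'" using \<open>s = s'\<close> n by metis
qed

lemma card_lift: "D \<subseteq> carrier \<Gamma> \<Longrightarrow> card (lift D) = card S * card D"
  unfolding lift_def using card_image[OF lift_inj] by (simp add: card_cartesian_product)

text \<open>If two lifted elements define the same coset, their quotient lies in \<open>N\<close>,
  so the parts in \<open>S\<close> agree by uniqueness of the decomposition. What remains is an
  equality of cosets of \<open>K\<close> in \<open>\<Gamma>\<close>.\<close>

lemma lift_rcos_inj:
  assumes K: "K \<lhd> \<Gamma>" and D: "D \<subseteq> carrier \<Gamma>" and inj: "inj_on (\<lambda>t. K #>\<^bsub>\<Gamma>\<^esub> t) D"
  shows "inj_on (\<lambda>d. pre K #> inv d) (lift D)"
proof (rule inj_onI)
  fix d d' assume d: "d \<in> lift D" "d' \<in> lift D" and eq: "pre K #> inv d = pre K #> inv d'"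
  obtain s t where st: "s \<in> S" "t \<in> D" "d = s \<otimes> sect t" using d(1) by (auto simp: lift_def)
  obtain s' t' where st': "s' \<in> S" "t' \<in> D" "d' = s' \<otimes> sect t'" using d(2) by (auto simp: lift_def)
  have n: "sect t \<in> N" "sect t' \<in> N" "H #> sect t = t" "H #> sect t' = t'" using sect st st' D by auto
  have c: "s \<in> carrier G" "s' \<in> carrier G" "sect t \<in> carrier G" "sect t' \<in> carrier G"
    using st st' n S_carrier N_carrier by auto
  have dc: "d \<in> carrier G" "d' \<in> carrier G" using st st' c by auto
  have sg: "subgroup (pre K) G" using K by (intro pre_subgroup normal_imp_subgroup)
  have k: "inv d \<otimes> d' \<in> pre K" using rcos_eq_iff[OF sg, of "inv d" "inv d'"] eq dc by simp
  then have kN: "inv d \<otimes> d' \<in> N" by (simp add: pre_def)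
  have "s \<otimes> (sect t \<otimes> (inv d \<otimes> d')) = d \<otimes> (inv d \<otimes> d')" using st(3) c dc by (simp add: m_assoc)
  also have "\<dots> = s' \<otimes> sect t'" using dc st'(3) by (simp add: m_assoc[symmetric])
  finally have "s = s'" by (intro S_decomp_unique[OF st(1) st'(1) N_closed(1)[OF n(1) kN] n(2)])
  have "inv d \<otimes> d' = inv (sect t) \<otimes> (inv s \<otimes> (s \<otimes> sect t'))"
    unfolding st(3) st'(3) \<open>s = s'\<close>[symmetric] using c by (simp add: inv_mult_group m_assoc)
  also have "\<dots> = inv (sect t) \<otimes> sect t'" using c by (simp add: m_assoc[symmetric])
  finally have "inv (sect t) \<otimes> sect t' \<in> pre K" using k by simp
  then have "K #>\<^bsub>\<Gamma>\<^esub> t = K #>\<^bsub>\<Gamma>\<^esub> t'" using pre_div_iff[OF K n(1,2)] n by simp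
  then have "t = t'" using inj st st' by (auto dest: inj_onD)
  then show "d = d'" using st st' \<open>s = s'\<close> by simp
qed

definition decS :: "'a \<Rightarrow> 'a" where "decS p = (SOME s. s \<in> S \<and> inv s \<otimes> p \<in> N)"

definition decN :: "'a \<Rightarrow> 'a" where "decN p = inv (decS p) \<otimes> p"

lemma dec:
  assumes p: "p \<in> carrier G"
  shows "decS p \<in> S" "decN p \<in> N" "p = decS p \<otimes> decN p"
proof -
  obtain s n where s: "s \<in> S" "n \<in> N" "p = s \<otimes> n" using S_decomp[OF p] .
  have "s \<in> carrier G" "n \<in> carrier G" using s S_carrier N_carrier by auto
  then have "inv s \<otimes> p = n" unfolding s(3) by (simp add: m_assoc[symmetric])
  then have "\<exists>s. s \<in> S \<and> inv s \<otimes> p \<in> N" using s by blast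
  then have *: "decS p \<in> S \<and> inv (decS p) \<otimes> p \<in> N" unfolding decS_def by (rule someI_ex)
  then show "decS p \<in> S" "decN p \<in> N" by (auto simp: decN_def)
  show "p = decS p \<otimes> decN p" using * p S_carrier by (auto simp: decN_def m_assoc[symmetric])
qed

text \<open>Write \<open>e s = s' n\<close> with \<open>s'\<close> in \<open>S\<close> and
  \<open>n\<close> in \<open>N\<close>. Left multiplication by \<open>e\<close> moves the sheet of
  \<open>s\<close> to the sheet of \<open>s'\<close> and acts within it by the class of
  \<open>n\<close>, so tiles almost invariant under these classes have lifts almost invariant under
  \<open>E\<close>.\<close>

definition shifts :: "'a set \<Rightarrow> 'a set set" where "shifts E = (\<lambda>(e, s). H #> decN (e \<otimes> s)) ` (E \<times> S)"

text \<open>They contain the elements \<open>h\<close> with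
  \<open>e s sect(t) = s' sect(t') h\<close>. Such an \<open>h\<close> lies in \<open>H\<close> if
  \<open>t'\<close> is the shift times \<open>t\<close>; having it in the test set \<open>B\<close>
  makes it fix the base point.\<close>

definition corrections :: "'a set \<Rightarrow> 'a set set \<Rightarrow> 'a set"
  where "corrections E T = (\<lambda>(e, s, t, t'). inv (sect t') \<otimes> (decN (e \<otimes> s) \<otimes> sect t)) ` (E \<times> S \<times> T \<times> T)"

lemma shifts_carrier: "E \<subseteq> carrier G \<Longrightarrow> shifts E \<subseteq> carrier \<Gamma>"
proof
  fix C assume E: "E \<subseteq> carrier G" and "C \<in> shifts E"
  then obtain e s where es: "e \<in> E" "s \<in> S" "C = H #> decN (e \<otimes> s)" by (auto simp: shifts_def)
  then have "e \<otimes> s \<in> carrier G" using E S_carrier by blast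
  then show "C \<in> carrier \<Gamma>" using dec(2) es(3) by (simp add: carrier_\<Gamma>)
qed

text \<open>Unless \<open>t\<close> is a boundary element of \<open>D\<close>, one has
  \<open>e s sect(t) = s' sect(t') h\<close> with \<open>t'\<close> in \<open>D\<close> and
  \<open>h\<close> in \<open>H\<close>. Since \<open>h\<close> fixes \<open>c\<close> and lies in
  \<open>pre K\<close>, the points and the cosets move alike. The factor 4 comes from the boundary 2
  \<epsilon> \<open>card T\<close> and from \<open>card T\<close> being at most twice
  \<open>card D\<close>.\<close>

lemma orbit_piece_lift:
  assumes T: "folner_set \<Gamma> (shifts E) \<epsilon> T" and K: "K \<lhd> \<Gamma>" and bij: "bij_betw (\<lambda>t. K #>\<^bsub>\<Gamma>\<^esub> t) T (rcosets\<^bsub>\<Gamma>\<^esub> K)"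
    and D: "D \<subseteq> T" "(1 - \<epsilon>) * card T \<le> card D" and \<epsilon>: "0 < \<epsilon>" "\<epsilon> \<le> 1 / 2"
    and E: "finite E" "E \<subseteq> carrier G"
    and at: "acts_at G b B c" and st: "stab G b c \<in> cyl H B"
    and B: "E \<subseteq> B" "lift T \<subseteq> B" "corrections E T \<subseteq> B"
    and inj: "inj_on (\<lambda>d. b d c) (lift D)" and M: "card S * card T \<le> M"
  shows "orbit_piece G b E (4 * \<epsilon>) M (c, pre K, lift D)"
proof -
  have fT: "finite T" "T \<subseteq> carrier \<Gamma>" using T by (simp_all add: folner_set_def)
  have fD: "finite D" "D \<subseteq> carrier \<Gamma>" using fT D finite_subset by auto
  have sgK: "subgroup K \<Gamma>" using K by (rule normal_imp_subgroup)
  have sg: "subgroup (pre K) G" using sgK by (rule pre_subgroup)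
  have cT: "card T \<le> 2 * real (card D)"
  proof -
    have "1 / 2 * card T \<le> (1 - \<epsilon>) * card T" using \<epsilon> by (intro mult_right_mono) auto
    then show ?thesis using D(2) by linarith
  qed
  show ?thesis
    unfolding orbit_piece_def prod.case
  proof (intro conjI ballI)
    show "subgroup (pre K) G" by (rule sg)
    show "finite (rcosets (pre K))" by (rule pre_rcosets(1)[OF K fT bij])
    show "card (rcosets (pre K)) \<le> M" using pre_rcosets(2)[OF K fT bij] M by simp
    show "finite (lift D)" using fD S_finite by (simp add: lift_def)
    show "lift D \<subseteq> carrier G" by (rule lift_carrier[OF fD(2)])
    show "inj_on (\<lambda>d. pre K #> inv d) (lift D)"
      using bij D(1) by (intro lift_rcos_inj K fD) (auto simp: bij_betw_def intro: inj_on_subset)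
    show "inj_on (\<lambda>d. b d c) (lift D)" by (rule inj)
    have "(1 - 4 * \<epsilon>) * card (rcosets (pre K)) \<le> (1 - \<epsilon>) * card (rcosets (pre K))" using \<epsilon> by (intro mult_right_mono) auto
    also have "\<dots> \<le> (1 - \<epsilon>) * (card S * card T)"
    proof (rule mult_left_mono)
      show "real (card (rcosets (pre K))) \<le> real (card S * card T)"
        using pre_rcosets(2)[OF K fT bij] by (simp only: of_nat_le_iff)
    qed (use \<epsilon> in simp)
    also have "\<dots> = card S * ((1 - \<epsilon>) * card T)" by simp
    also have "\<dots> \<le> card S * real (card D)" using D(2) by (intro mult_left_mono) auto
    also have "\<dots> = card (lift D)" using card_lift[OF fD(2)] by simp
    finally show "(1 - 4 * \<epsilon>) * card (rcosets (pre K)) \<le> card (lift D)" .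
  next
    fix e assume e: "e \<in> E"
    have ec: "e \<in> carrier G" using e E by blast
    define P where "P = (\<lambda>d. \<exists>d'\<in>lift D. pre K #> inv d' = pre K #> inv (e \<otimes> d) \<and> b e (b d c) = b d' c)"
    define \<nu> where "\<nu> = (\<lambda>s. H #> decN (e \<otimes> s))"
    have esc: "e \<otimes> s \<in> carrier G" if "s \<in> S" for s using that S_carrier ec by blast
    have good: "P (s \<otimes> sect t)" if s: "s \<in> S" and t: "t \<in> D" "\<nu> s \<otimes>\<^bsub>\<Gamma>\<^esub> t \<in> D" for s t
    proof -
      define n where "n = decN (e \<otimes> s)"
      define s' where "s' = decS (e \<otimes> s)"
      define t' where "t' = \<nu> s \<otimes>\<^bsub>\<Gamma>\<^esub> t"
      define h where "h = inv (sect t') \<otimes> (n \<otimes> sect t)"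
      have d: "s' \<in> S" "n \<in> N" "e \<otimes> s = s' \<otimes> n" using dec[OF esc[OF s]] by (simp_all add: n_def s'_def)
      have t': "t' \<in> D" using t by (simp add: t'_def)
      have tc: "t \<in> carrier \<Gamma>" "t' \<in> carrier \<Gamma>" using t t' fD by auto
      have hH: "h \<in> H" using sect_mult[OF tc(1) d(2)] by (simp add: h_def t'_def \<nu>_def n_def)
      have c: "s \<in> carrier G" "s' \<in> carrier G" "n \<in> carrier G" "sect t \<in> carrier G" "sect t' \<in> carrier G" "h \<in> carrier G"
        using s d sect(1)[OF tc(1)] sect(1)[OF tc(2)] hH S_carrier N_carrier Hc by auto
      have ed: "e \<otimes> (s \<otimes> sect t) = (s' \<otimes> sect t') \<otimes> h"
      proof -
        have "e \<otimes> (s \<otimes> sect t) = (e \<otimes> s) \<otimes> sect t" using ec c by (simp add: m_assoc)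
        also have "\<dots> = s' \<otimes> (n \<otimes> sect t)" unfolding d(3) using c by (simp add: m_assoc)
        also have "n \<otimes> sect t = sect t' \<otimes> h" using c by (simp add: h_def m_assoc[symmetric])
        finally show ?thesis using c by (simp add: m_assoc)
      qed
      have d'lift: "s' \<otimes> sect t' \<in> lift D" using d t' by (force simp: lift_def)
      have liftT: "lift D \<subseteq> lift T" using D by (auto simp: lift_def)
      have "s \<otimes> sect t \<in> lift D" using s t by (force simp: lift_def)
      then have dB: "e \<in> B" "s \<otimes> sect t \<in> B" "s' \<otimes> sect t' \<in> B" using d'lift liftT B e by auto
      have hB: "h \<in> B"
      proof -
        have "(e, s, t, t') \<in> E \<times> S \<times> T \<times> T" using e s t t' D by blast
        then have "h \<in> corrections E T" unfolding corrections_def h_def n_def by (force intro: image_eqI)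
        then show ?thesis using B by blast
      qed
      have "h \<in> stab G b c" using st hB hH by (auto simp: cyl_def)
      then have "b h c = c" by (simp add: stab_def)
      have "b e (b (s \<otimes> sect t) c) = b (e \<otimes> (s \<otimes> sect t)) c" by (rule acts_atD[OF at dB(1,2)])
      also have "\<dots> = b (s' \<otimes> sect t') (b h c)" unfolding ed by (rule acts_atD[OF at dB(3) hB, symmetric])
      finally have 1: "b e (b (s \<otimes> sect t) c) = b (s' \<otimes> sect t') c" using \<open>b h c = c\<close> by simp
      have "inv (s' \<otimes> sect t') \<otimes> (e \<otimes> (s \<otimes> sect t)) = h" unfolding ed by (rule inv_mult_cancel) (use c in auto)
      then have "inv (s' \<otimes> sect t') \<otimes> inv (inv (e \<otimes> (s \<otimes> sect t))) \<in> pre K" using hH H_pre[OF sgK] c ec by auto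
      then have "pre K #> inv (s' \<otimes> sect t') = pre K #> inv (e \<otimes> (s \<otimes> sect t))"
        using rcos_eq_iff[OF sg, of "inv (s' \<otimes> sect t')" "inv (e \<otimes> (s \<otimes> sect t))"] c ec by simp
      then show ?thesis unfolding P_def using 1 d'lift by blast
    qed
    \<comment> \<open>The exceptional elements are counted sheet by sheet: each \<open>s\<close>
      contributes the boundary of \<open>D\<close> in the direction of its shift.\<close>
    have "{d \<in> lift D. \<not> P d} \<subseteq> (\<Union>s\<in>S. (\<lambda>t. s \<otimes> sect t) ` {t \<in> D. \<nu> s \<otimes>\<^bsub>\<Gamma>\<^esub> t \<notin> D})"
      using good by (auto simp: lift_def)
    then have "card {d \<in> lift D. \<not> P d} \<le> card (\<Union>s\<in>S. (\<lambda>t. s \<otimes> sect t) ` {t \<in> D. \<nu> s \<otimes>\<^bsub>\<Gamma>\<^esub> t \<notin> D})"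
      using S_finite fD by (intro card_mono) auto
    also have "\<dots> \<le> (\<Sum>s\<in>S. card ((\<lambda>t. s \<otimes> sect t) ` {t \<in> D. \<nu> s \<otimes>\<^bsub>\<Gamma>\<^esub> t \<notin> D}))"
      using S_finite by (rule card_UN_le)
    finally have "real (card {d \<in> lift D. \<not> P d}) \<le> (\<Sum>s\<in>S. real (card ((\<lambda>t. s \<otimes> sect t) ` {t \<in> D. \<nu> s \<otimes>\<^bsub>\<Gamma>\<^esub> t \<notin> D})))"
      by (simp add: of_nat_sum[symmetric] del: of_nat_sum)
    also have "\<dots> \<le> (\<Sum>s\<in>S. 4 * \<epsilon> * card D)"
    proof (rule sum_mono)
      fix s assume s: "s \<in> S"
      have \<nu>: "\<nu> s \<in> shifts E" using s e by (force simp: \<nu>_def shifts_def)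
      then have \<nu>c: "\<nu> s \<in> carrier \<Gamma>" using shifts_carrier[OF E(2)] by blast
      have "card ((\<lambda>t. s \<otimes> sect t) ` {t \<in> D. \<nu> s \<otimes>\<^bsub>\<Gamma>\<^esub> t \<notin> D}) \<le> card {t \<in> D. \<nu> s \<otimes>\<^bsub>\<Gamma>\<^esub> t \<notin> D}"
        using fD by (intro card_image_le) auto
      also have "\<dots> \<le> card {t \<in> T. \<nu> s \<otimes>\<^bsub>\<Gamma>\<^esub> t \<notin> T} + (card T - card D)"
        by (rule group.card_boundary_subset[OF group_\<Gamma> fT D(1) \<nu>c])
      finally have "real (card ((\<lambda>t. s \<otimes> sect t) ` {t \<in> D. \<nu> s \<otimes>\<^bsub>\<Gamma>\<^esub> t \<notin> D})) \<le> card {t \<in> T. \<nu> s \<otimes>\<^bsub>\<Gamma>\<^esub> t \<notin> T} + (real (card T) - card D)"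
        using card_mono[OF fT(1) D(1)] by linarith
      also have "real (card {t \<in> T. \<nu> s \<otimes>\<^bsub>\<Gamma>\<^esub> t \<notin> T}) \<le> \<epsilon> * card T" using T \<nu> by (simp add: folner_set_def)
      also have "real (card T) - card D \<le> \<epsilon> * card T" using D(2) by (simp add: algebra_simps)
      also have "\<epsilon> * card T + \<epsilon> * card T \<le> 4 * \<epsilon> * card D"
        using mult_left_mono[OF cT, of \<epsilon>] \<epsilon> by simp
      finally show "real (card ((\<lambda>t. s \<otimes> sect t) ` {t \<in> D. \<nu> s \<otimes>\<^bsub>\<Gamma>\<^esub> t \<notin> D})) \<le> 4 * \<epsilon> * card D" by simp
    qed
    also have "\<dots> = 4 * \<epsilon> * card (lift D)" using card_lift[OF fD(2)] by simp
    finally show "real (card {d \<in> lift D. \<not> (\<exists>d'\<in>lift D. pre K #> inv d' = pre K #> inv (e \<otimes> d) \<and> b e (b d c) = b d' c)}) \<le> 4 * \<epsilon> * card (lift D)"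
      unfolding P_def .
  qed
qed

end


subsection \<open>The part of the action seen by one atom\<close>

locale atom = stab_limit G F m a \<mu> + finite_conjugacy G H
  for G (structure) and F :: "'i filter" and m a \<mu> H +
  assumes wt_pos: "0 < wt H"
begin

text \<open>\<open>XH\<close> and \<open>AH\<close> play the parts of \<open>X\<close> and
  \<open>A\<close> in \<open>approx_free\<close>, for the partial action of \<open>\<Gamma>\<close>
  through \<open>sect\<close>.\<close>

definition XH :: "'a set \<Rightarrow> 'i \<Rightarrow> nat set"
  where "XH B n = {x \<in> {1..m n}. stab G (a n) x \<in> cyl H B \<and> acts_at G (a n) B x}"

definition AH :: "'a set \<Rightarrow> 'a set set \<Rightarrow> 'i \<Rightarrow> nat set"
  where "AH B Q n = {x \<in> XH B n. \<forall>\<delta>\<in>Q. a n (sect \<delta>) x \<in> XH B n}"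

text \<open>The elements of \<open>G\<close> on which the action must be controlled for the induced partial action of
  \<open>\<Gamma>\<close> on \<open>XH\<close> to be free over \<open>Q\<close>.\<close>

definition ctrl :: "'a set set \<Rightarrow> 'a set"
  where "ctrl Q = sect ` Q \<union> (\<lambda>(\<gamma>, \<delta>). sect (\<gamma> \<otimes>\<^bsub>\<Gamma>\<^esub> \<delta>)) ` (Q \<times> Q)
    \<union> (\<lambda>(\<gamma>, \<delta>). inv (sect (\<gamma> \<otimes>\<^bsub>\<Gamma>\<^esub> \<delta>)) \<otimes> (sect \<gamma> \<otimes> sect \<delta>)) ` (Q \<times> Q)
    \<union> (\<lambda>(\<gamma>, \<delta>). inv (sect \<gamma>) \<otimes> sect \<delta>) ` (Q \<times> Q)"

lemma sect_carrier: "\<gamma> \<in> carrier \<Gamma> \<Longrightarrow> sect \<gamma> \<in> carrier G"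
  using sect(1) N_carrier by blast

lemma ctrl_finite: "finite Q \<Longrightarrow> finite (ctrl Q)"
  by (simp add: ctrl_def)

lemma ctrl_carrier:
  assumes "Q \<subseteq> carrier \<Gamma>"
  shows "ctrl Q \<subseteq> carrier G"
proof -
  interpret \<Gamma>: group \<Gamma> by (rule group_\<Gamma>)
  have "sect \<gamma> \<in> carrier G" if "\<gamma> \<in> Q" for \<gamma> using that assms sect_carrier by blast
  moreover have "sect (\<gamma> \<otimes>\<^bsub>\<Gamma>\<^esub> \<delta>) \<in> carrier G" if "\<gamma> \<in> Q" "\<delta> \<in> Q" for \<gamma> \<delta>
    using that assms by (intro sect_carrier \<Gamma>.m_closed) auto
  ultimately show ?thesis unfolding ctrl_def by auto
qed

lemma XH_stab: "x \<in> XH B n \<Longrightarrow> h \<in> H \<Longrightarrow> h \<in> B \<Longrightarrow> a n h x = x"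
  by (auto simp: XH_def cyl_def stab_def)

lemma XH_stab_iff: "x \<in> XH B n \<Longrightarrow> h \<in> carrier G \<Longrightarrow> h \<in> B \<Longrightarrow> a n h x = x \<longleftrightarrow> h \<in> H"
  by (auto simp: XH_def cyl_def stab_def)

lemma XH_acts: "x \<in> XH B n \<Longrightarrow> p \<in> B \<Longrightarrow> q \<in> B \<Longrightarrow> a n p (a n q x) = a n (p \<otimes> q) x"
  by (auto simp: XH_def acts_at_def)

text \<open>The defect of \<open>sect\<close> at a product lies in \<open>H\<close> and in
  \<open>B\<close>, hence fixes \<open>x\<close>. If two elements of \<open>Q\<close> move
  \<open>x\<close> to the same point, the quotient of their sections stabilizes \<open>x\<close> and
  lies in \<open>B\<close>, hence in \<open>H\<close>, so they coincide in
  \<open>\<Gamma>\<close>.\<close>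

lemma approx_free_AH:
  assumes Q: "Q \<subseteq> carrier \<Gamma>" and B: "ctrl Q \<subseteq> B"
  shows "approx_free \<Gamma> Q (\<lambda>\<gamma>. a n (sect \<gamma>)) (XH B n) (AH B Q n)"
  unfolding approx_free_def
proof (intro conjI ballI)
  show "finite (XH B n)" by (simp add: XH_def)
  show "AH B Q n \<subseteq> XH B n" by (auto simp: AH_def)
  show "inj_on (a n (sect \<gamma>)) (XH B n)" if "\<gamma> \<in> Q" for \<gamma>
    using permutes_inj[OF perm[OF sect_carrier, of \<gamma> n]] that Q by (blast intro: inj_on_subset)
  show "a n (sect \<delta>) x \<in> XH B n" if "x \<in> AH B Q n" "\<delta> \<in> Q" for x \<delta> using that by (simp add: AH_def)
next
  fix x \<gamma> \<delta> assume x: "x \<in> AH B Q n" and q: "\<gamma> \<in> Q" "\<delta> \<in> Q"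
  have xX: "x \<in> XH B n" using x by (simp add: AH_def)
  interpret \<Gamma>: group \<Gamma> by (rule group_\<Gamma>)
  have c: "\<gamma> \<in> carrier \<Gamma>" "\<delta> \<in> carrier \<Gamma>" "\<gamma> \<otimes>\<^bsub>\<Gamma>\<^esub> \<delta> \<in> carrier \<Gamma>" using q Q by auto
  define h where "h = inv (sect (\<gamma> \<otimes>\<^bsub>\<Gamma>\<^esub> \<delta>)) \<otimes> (sect \<gamma> \<otimes> sect \<delta>)"
  have hH: "h \<in> H" using sect_mult[OF c(2) sect(1)[OF c(1)]] sect(2)[OF c(1)] by (simp add: h_def)
  have qq: "(\<gamma>, \<delta>) \<in> Q \<times> Q" using q by simp
  have inB: "sect \<gamma> \<in> B" "sect \<delta> \<in> B" "sect (\<gamma> \<otimes>\<^bsub>\<Gamma>\<^esub> \<delta>) \<in> B" "h \<in> B"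
  proof -
    show "sect \<gamma> \<in> B" "sect \<delta> \<in> B" using q B by (auto simp: ctrl_def)
    show "sect (\<gamma> \<otimes>\<^bsub>\<Gamma>\<^esub> \<delta>) \<in> B" using qq B by (force simp: ctrl_def)
    have "h \<in> (\<lambda>(\<gamma>, \<delta>). inv (sect (\<gamma> \<otimes>\<^bsub>\<Gamma>\<^esub> \<delta>)) \<otimes> (sect \<gamma> \<otimes> sect \<delta>)) ` (Q \<times> Q)"
      using qq by (rule rev_image_eqI) (simp add: h_def)
    then show "h \<in> B" using B by (auto simp: ctrl_def)
  qed
  have cc: "sect \<gamma> \<in> carrier G" "sect \<delta> \<in> carrier G" "sect (\<gamma> \<otimes>\<^bsub>\<Gamma>\<^esub> \<delta>) \<in> carrier G" using c sect_carrier by auto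
  have "sect (\<gamma> \<otimes>\<^bsub>\<Gamma>\<^esub> \<delta>) \<otimes> h = sect \<gamma> \<otimes> sect \<delta>" using cc by (simp add: h_def m_assoc[symmetric])
  then have "a n (sect \<gamma>) (a n (sect \<delta>) x) = a n (sect (\<gamma> \<otimes>\<^bsub>\<Gamma>\<^esub> \<delta>) \<otimes> h) x"
    using XH_acts[OF xX inB(1,2)] by simp
  also have "\<dots> = a n (sect (\<gamma> \<otimes>\<^bsub>\<Gamma>\<^esub> \<delta>)) (a n h x)" using XH_acts[OF xX inB(3,4)] by simp
  also have "a n h x = x" using XH_stab[OF xX hH inB(4)] .
  finally show "a n (sect \<gamma>) (a n (sect \<delta>) x) = a n (sect (\<gamma> \<otimes>\<^bsub>\<Gamma>\<^esub> \<delta>)) x" .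
next
  fix x assume x: "x \<in> AH B Q n"
  have xX: "x \<in> XH B n" using x by (simp add: AH_def)
  show "inj_on (\<lambda>\<gamma>. a n (sect \<gamma>) x) Q"
  proof (rule inj_onI)
    fix \<gamma> \<delta> assume q: "\<gamma> \<in> Q" "\<delta> \<in> Q" and eq: "a n (sect \<gamma>) x = a n (sect \<delta>) x"
    have c: "\<gamma> \<in> carrier \<Gamma>" "\<delta> \<in> carrier \<Gamma>" using q Q by auto
    have cc: "sect \<gamma> \<in> carrier G" "sect \<delta> \<in> carrier G" using c sect_carrier by auto
    define k where "k = inv (sect \<gamma>) \<otimes> sect \<delta>"
    have kc: "k \<in> carrier G" using cc by (simp add: k_def)
    have qq: "(\<gamma>, \<delta>) \<in> Q \<times> Q" using q by simp
    have "k \<in> (\<lambda>(\<gamma>, \<delta>). inv (sect \<gamma>) \<otimes> sect \<delta>) ` (Q \<times> Q)"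
      using qq by (rule rev_image_eqI) (simp add: k_def)
    then have kB: "k \<in> B" using B by (auto simp: ctrl_def)
    have gB: "sect \<gamma> \<in> B" using q B by (auto simp: ctrl_def)
    have "sect \<gamma> \<otimes> k = sect \<delta>" using cc by (simp add: k_def m_assoc[symmetric])
    then have "a n (sect \<gamma>) (a n k x) = a n (sect \<gamma>) x" using XH_acts[OF xX gB kB] eq by simp
    then have "a n k x = x" using permutes_inj[OF perm[OF cc(1), of n]] by (simp add: inj_eq)
    then have "k \<in> H" using XH_stab_iff[OF xX kc kB] by simp
    then have "H #> sect \<delta> = H #> sect \<gamma>" using H_rcos_eq_iff[of "sect \<delta>" "sect \<gamma>"] sect(1) c by (simp add: k_def)
    then show "\<gamma> = \<delta>" using sect(2) c by simp
  qed
qed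

lemma card_XH: "freq (m n) (\<lambda>x. x \<in> XH B n) * m n = card (XH B n)"
proof -
  have "{x \<in> {1..m n}. x \<in> XH B n} = XH B n" by (auto simp: XH_def)
  then show ?thesis using m_pos[of n] by (simp add: freq_def)
qed

lemma XH_large:
  assumes B: "finite B" "B \<subseteq> carrier G" and r: "r < wt H"
  shows "\<forall>\<^sub>F n in F. r < freq (m n) (\<lambda>x. x \<in> XH B n)"
proof -
  have le: "freq (m n) (\<lambda>x. stab G (a n) x \<in> cyl H B) - freq (m n) (\<lambda>x. \<not> acts_at G (a n) B x) \<le> freq (m n) (\<lambda>x. x \<in> XH B n)" for n
  proof -
    have "freq (m n) (\<lambda>x. stab G (a n) x \<in> cyl H B) \<le> freq (m n) (\<lambda>x. x \<in> XH B n \<or> \<not> acts_at G (a n) B x)"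
      by (rule freq_mono) (auto simp: XH_def)
    also have "\<dots> \<le> freq (m n) (\<lambda>x. x \<in> XH B n) + freq (m n) (\<lambda>x. \<not> acts_at G (a n) B x)" by (rule freq_disj_le)
    finally show ?thesis by simp
  qed
  have "((\<lambda>n. freq (m n) (\<lambda>x. stab G (a n) x \<in> cyl H B) - freq (m n) (\<lambda>x. \<not> acts_at G (a n) B x)) \<longlongrightarrow> \<mu> (cyl H B) - 0) F"
    by (intro tendsto_diff lim acts B)
  moreover have "r < \<mu> (cyl H B) - 0" using r wt_le[OF B, of H] by simp
  ultimately have "\<forall>\<^sub>F n in F. r < freq (m n) (\<lambda>x. stab G (a n) x \<in> cyl H B) - freq (m n) (\<lambda>x. \<not> acts_at G (a n) B x)"
    by (rule order_tendstoD)
  then show ?thesis using le by (auto elim!: eventually_mono intro: less_le_trans)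
qed

text \<open>Up to negligible failures of the action, a point leaves \<open>XH\<close> under
  \<open>Q\<close> only if its stabilizer looks like \<open>H\<close> on \<open>B\<close> but not on
  a larger set \<open>B2\<close>. The cylinder over \<open>B2\<close> still has at least the point
  mass, which the cylinder over \<open>B\<close> hardly exceeds, so such points are rare.\<close>

lemma AH_large:
  assumes Q: "finite Q" "Q \<subseteq> carrier \<Gamma>" and B: "finite B" "B \<subseteq> carrier G"
    and \<eta>: "0 < \<eta>" and tight: "\<mu> (cyl H B) < wt H + \<eta> * wt H / 4"
  shows "\<forall>\<^sub>F n in F. real (card (XH B n - AH B Q n)) \<le> \<eta> * card (XH B n)"
proof -
  \<comment> \<open>As sections lie in \<open>N\<close> and preserve \<open>H\<close>, the test on
    \<open>B\<close> at the moved point is the test on the set \<open>R \<delta>\<close>, conjugated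
    back, at the original point.\<close>
  define R where "R = (\<lambda>\<delta>. conjugate G (inv (sect \<delta>)) B)"
  define R' where "R' = (\<lambda>\<delta>. insert (sect \<delta>) (R \<delta> \<union> conjugate G (sect \<delta>) (R \<delta>)))"
  define B2 where "B2 = B \<union> (\<Union>\<delta>\<in>Q. R \<delta>)"
  have sc: "sect \<delta> \<in> carrier G" if "\<delta> \<in> Q" for \<delta> using that Q sect_carrier by blast
  have Rc: "finite (R \<delta>)" "R \<delta> \<subseteq> carrier G" "conjugate G (sect \<delta>) (R \<delta>) = B" if "\<delta> \<in> Q" for \<delta>
  proof -
    show "finite (R \<delta>)" using B by (simp add: R_def conjugate_def)
    show "R \<delta> \<subseteq> carrier G" unfolding R_def using B sc[OF that] by (intro conjugate_closed) auto
    show "conjugate G (sect \<delta>) (R \<delta>) = B" using B sc[OF that] by (simp add: R_def conjugate_conjugate conjugate_one)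
  qed
  have B2: "finite B2" using B Q Rc by (auto simp: B2_def)
  have B2c: "B2 \<subseteq> carrier G" unfolding B2_def using B Rc(2) by (intro Un_least UN_least)
  define f1 where "f1 = (\<lambda>n. freq (m n) (\<lambda>x. stab G (a n) x \<in> cyl H B - cyl H B2))"
  define f2 where "f2 = (\<lambda>n. freq (m n) (\<lambda>x. \<exists>\<delta>\<in>Q. \<not> acts_at G (a n) (R' \<delta>) x \<or> \<not> acts_at G (a n) B (a n (sect \<delta>) x)))"
  have f2: "(f2 \<longlongrightarrow> 0) F"
    unfolding f2_def
  proof (intro negligible_Bex negligible_disj Q(1))
    fix \<delta> assume \<delta>: "\<delta> \<in> Q"
    show "((\<lambda>n. freq (m n) (\<lambda>x. \<not> acts_at G (a n) (R' \<delta>) x)) \<longlongrightarrow> 0) F"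
      using Rc[OF \<delta>] sc[OF \<delta>] B by (intro acts) (auto simp: R'_def)
    show "((\<lambda>n. freq (m n) (\<lambda>x. \<not> acts_at G (a n) B (a n (sect \<delta>) x))) \<longlongrightarrow> 0) F"
      using acts[OF B] freq_permutes[OF perm[OF sc[OF \<delta>]], of _ "\<lambda>x. \<not> acts_at G (a _) B x"] by (simp only: freq_permutes[OF perm[OF sc[OF \<delta>]]])
  qed
  have le: "freq (m n) (\<lambda>x. x \<in> XH B n - AH B Q n) \<le> f1 n + f2 n" for n
  proof -
    have "freq (m n) (\<lambda>x. x \<in> XH B n - AH B Q n) \<le> freq (m n) (\<lambda>x. stab G (a n) x \<in> cyl H B - cyl H B2 \<or>
        (\<exists>\<delta>\<in>Q. \<not> acts_at G (a n) (R' \<delta>) x \<or> \<not> acts_at G (a n) B (a n (sect \<delta>) x)))"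
    proof (rule freq_mono, rule ccontr)
      fix x assume x: "x \<in> {1..m n}" "x \<in> XH B n - AH B Q n"
        and no: "\<not> (stab G (a n) x \<in> cyl H B - cyl H B2 \<or>
        (\<exists>\<delta>\<in>Q. \<not> acts_at G (a n) (R' \<delta>) x \<or> \<not> acts_at G (a n) B (a n (sect \<delta>) x)))"
      obtain \<delta> where \<delta>: "\<delta> \<in> Q" "a n (sect \<delta>) x \<notin> XH B n" using x by (auto simp: AH_def)
      have at: "acts_at G (a n) (R' \<delta>) x" "acts_at G (a n) B (a n (sect \<delta>) x)" using no \<delta>(1) by auto
      have "stab G (a n) x \<in> cyl H B" using x by (auto simp: XH_def)
      then have "stab G (a n) x \<in> cyl H B2" using no by blast
      then have "stab G (a n) x \<in> cyl H (R \<delta>)" using cyl_mono[of "R \<delta>" B2 H] \<delta>(1) by (auto simp: B2_def)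
      then have "stab G (a n) (a n (sect \<delta>) x) \<in> cyl (conjugate G (sect \<delta>) H) (conjugate G (sect \<delta>) (R \<delta>))"
        using stab_cyl_conjugate[where a = "a n", OF perm[OF sc[OF \<delta>(1)], of n] at(1)[unfolded R'_def] sc[OF \<delta>(1)] Rc(2)[OF \<delta>(1)] Hc] by blast
      moreover have "conjugate G (sect \<delta>) H = H" using sect(1)[of \<delta>] \<delta>(1) Q(2) by (auto simp: N_def)
      ultimately have "stab G (a n) (a n (sect \<delta>) x) \<in> cyl H B" using Rc(3)[OF \<delta>(1)] by simp
      moreover have "a n (sect \<delta>) x \<in> {1..m n}" using permutes_in_image[OF perm[OF sc[OF \<delta>(1)], of n]] x(1) by blast
      ultimately have "a n (sect \<delta>) x \<in> XH B n" using at(2) by (simp add: XH_def)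
      then show False using \<delta>(2) by simp
    qed
    also have "\<dots> \<le> f1 n + f2 n" unfolding f1_def f2_def by (rule freq_disj_le)
    finally show ?thesis .
  qed
  have "((\<lambda>n. f1 n + f2 n) \<longlongrightarrow> \<mu> (cyl H B - cyl H B2) + 0) F" unfolding f1_def by (intro tendsto_add lim f2)
  moreover have "\<mu> (cyl H B - cyl H B2) + 0 < \<eta> * wt H / 2"
  proof -
    have "cyl H B = (cyl H B - cyl H B2) \<union> cyl H B2" using cyl_mono[of B B2 H] by (auto simp: B2_def)
    then have "\<mu> (cyl H B) = \<mu> (cyl H B - cyl H B2) + \<mu> (cyl H B2)" using mu_Un_disjoint[of "cyl H B - cyl H B2" "cyl H B2"] by auto
    then have "\<mu> (cyl H B - cyl H B2) < \<eta> * wt H / 4" using tight wt_le[OF B2 B2c, of H] by linarith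
    also have "\<dots> \<le> \<eta> * wt H / 2" using \<eta> wt_pos by simp
    finally show ?thesis by simp
  qed
  ultimately have ev1: "\<forall>\<^sub>F n in F. f1 n + f2 n < \<eta> * wt H / 2" by (rule order_tendstoD)
  have ev2: "\<forall>\<^sub>F n in F. wt H / 2 < freq (m n) (\<lambda>x. x \<in> XH B n)" using B wt_pos by (intro XH_large) auto
  show ?thesis
    using ev1 ev2
  proof eventually_elim
    case (elim n)
    have "\<eta> * (wt H / 2) \<le> \<eta> * freq (m n) (\<lambda>x. x \<in> XH B n)" using elim(2) \<eta> by (intro mult_left_mono) auto
    then have "freq (m n) (\<lambda>x. x \<in> XH B n - AH B Q n) \<le> \<eta> * freq (m n) (\<lambda>x. x \<in> XH B n)" using le[of n] elim(1) by simp
    then have "freq (m n) (\<lambda>x. x \<in> XH B n - AH B Q n) * m n \<le> \<eta> * freq (m n) (\<lambda>x. x \<in> XH B n) * m n" by (intro mult_right_mono) auto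
    also have "\<dots> = \<eta> * card (XH B n)" using card_XH[of n B] by (simp add: mult.assoc)
    also have "freq (m n) (\<lambda>x. x \<in> XH B n - AH B Q n) * m n = card (XH B n - AH B Q n)"
    proof -
      have "{x \<in> {1..m n}. x \<in> XH B n - AH B Q n} = XH B n - AH B Q n" by (auto simp: XH_def)
      then show ?thesis using m_pos[of n] by (simp add: freq_def)
    qed
    finally show ?case .
  qed
qed

end

context atom
begin

text \<open>A quasi-tiling of \<open>XH\<close> by tiles of \<open>\<Gamma>\<close> is moved around
  by \<open>S\<close>. The translates of \<open>XH\<close> are disjoint because \<open>B0\<close>
  separates the conjugates of \<open>H\<close>, so the induced pieces nearly account for the mass of
  the whole conjugacy class.\<close>

theorem atom_pieces:
  assumes \<nu>: "invariant_mean G \<nu>" and pc: "profinitely_closed G H"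
    and E: "finite E" "E \<subseteq> carrier G" and \<epsilon>: "0 < \<epsilon>" "\<epsilon> < 1"
    and B0: "finite B0" "B0 \<subseteq> carrier G"
    and sep: "\<And>s s'. s \<in> S \<Longrightarrow> s' \<in> S \<Longrightarrow> s \<noteq> s' \<Longrightarrow> conjugate G s H \<inter> B0 \<noteq> conjugate G s' H \<inter> B0"
  shows "\<exists>M. \<forall>\<^sub>F n in F. \<exists>Z. orbit_cover G (a n) E \<epsilon> M
    {x \<in> {1..m n}. \<exists>s\<in>S. stab G (a n) x \<in> cyl (conjugate G s H) B0} ((1 - \<epsilon>) * (card S * wt H) * m n) Z"
proof -
  interpret \<Gamma>: group \<Gamma> by (rule group_\<Gamma>)
  \<comment> \<open>\<open>orbit_piece_lift\<close> loses a factor 4.\<close>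
  define \<epsilon>1 where "\<epsilon>1 = \<epsilon> / 4"
  have \<epsilon>1: "0 < \<epsilon>1" "\<epsilon>1 < 1" "\<epsilon>1 \<le> 1 / 2" "4 * \<epsilon>1 = \<epsilon>" using \<epsilon> by (auto simp: \<epsilon>1_def)
  define tile where "tile = (\<lambda>T K. folner_set \<Gamma> (shifts E) \<epsilon>1 T \<and> K \<lhd> \<Gamma> \<and> finite (rcosets\<^bsub>\<Gamma>\<^esub> K) \<and>
    bij_betw (\<lambda>t. K #>\<^bsub>\<Gamma>\<^esub> t) T (rcosets\<^bsub>\<Gamma>\<^esub> K))"
  define \<T> where "\<T> = {T. \<exists>K. tile T K}"
  have sh: "finite (shifts E)" "shifts E \<subseteq> carrier \<Gamma>" using E S_finite shifts_carrier by (auto simp: shifts_def)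
  obtain k where k: "(1 - \<epsilon>1 / 2) ^ k < \<epsilon>1" using real_arch_pow_inv[of \<epsilon>1 "1 - \<epsilon>1 / 2"] \<epsilon>1 by auto
  have "\<exists>L Q \<eta>. finite L \<and> L \<subseteq> \<T> \<and> finite Q \<and> Q \<subseteq> carrier \<Gamma> \<and> 0 < (\<eta> :: real) \<and>
    (\<forall>b (X :: nat set) A. approx_free \<Gamma> Q b X A \<longrightarrow> real (card (X - A)) \<le> \<eta> * card X \<longrightarrow>
      (\<exists>Z. tiling b X A L \<epsilon>1 Z \<and> real (card (X - \<Union> (piece b ` Z))) \<le> (1 - \<epsilon>1 / 2) ^ k * card X))"
  proof (rule \<Gamma>.quasi_tiling)
    fix T assume "T \<in> \<T>"
    then show "finite T \<and> T \<noteq> {} \<and> T \<subseteq> carrier \<Gamma>" by (auto simp: \<T>_def tile_def folner_set_def)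
  next
    fix B and \<kappa> :: real assume B: "finite B" "B \<subseteq> carrier \<Gamma>" "0 < \<kappa>"
    have "\<exists>T K. folner_set \<Gamma> (shifts E \<union> B) (min \<epsilon>1 \<kappa>) T \<and> K \<lhd> \<Gamma> \<and> finite (rcosets\<^bsub>\<Gamma>\<^esub> K) \<and>
        bij_betw (\<lambda>t. K #>\<^bsub>\<Gamma>\<^esub> t) T (rcosets\<^bsub>\<Gamma>\<^esub> K)"
      using sh B \<epsilon>1 by (intro \<Gamma>_tiles[OF \<nu> pc]) auto
    then obtain T K where T: "folner_set \<Gamma> (shifts E \<union> B) (min \<epsilon>1 \<kappa>) T" and K: "K \<lhd> \<Gamma>" "finite (rcosets\<^bsub>\<Gamma>\<^esub> K)"
        "bij_betw (\<lambda>t. K #>\<^bsub>\<Gamma>\<^esub> t) T (rcosets\<^bsub>\<Gamma>\<^esub> K)" by blast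
    have "folner_set \<Gamma> (shifts E) \<epsilon>1 T" "folner_set \<Gamma> B \<kappa> T" by (rule folner_set_mono[OF T]; simp)+
    then show "\<exists>T\<in>\<T>. folner_set \<Gamma> B \<kappa> T" using K unfolding \<T>_def tile_def by blast
  qed (use \<epsilon>1 in auto)
  then obtain L Q \<eta> where L: "finite L" "L \<subseteq> \<T>" and Q: "finite Q" "Q \<subseteq> carrier \<Gamma>" and \<eta>: "0 < (\<eta> :: real)"
    and qt: "\<And>b (X :: nat set) A. approx_free \<Gamma> Q b X A \<Longrightarrow> real (card (X - A)) \<le> \<eta> * card X \<Longrightarrow>
      \<exists>Z. tiling b X A L \<epsilon>1 Z \<and> real (card (X - \<Union> (piece b ` Z))) \<le> (1 - \<epsilon>1 / 2) ^ k * card X"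
    by (elim exE conjE) blast
  have "\<forall>T\<in>L. \<exists>K. tile T K" using L by (auto simp: \<T>_def)
  from bchoice[OF this] obtain Kf where Kf: "\<forall>T\<in>L. tile T (Kf T)" ..
  have T: "folner_set \<Gamma> (shifts E) \<epsilon>1 T" "Kf T \<lhd> \<Gamma>" "bij_betw (\<lambda>t. Kf T #>\<^bsub>\<Gamma>\<^esub> t) T (rcosets\<^bsub>\<Gamma>\<^esub> (Kf T))"
    "finite T" "T \<noteq> {}" "T \<subseteq> carrier \<Gamma>" if "T \<in> L" for T
    using bspec[OF Kf that] by (auto simp: tile_def folner_set_def)
  \<comment> \<open>The test on \<open>W s\<close> at \<open>y\<close> decides the test on
    \<open>B0\<close> at the point \<open>s y\<close>.\<close>
  define W where "W = (\<lambda>s. conjugate G (inv s) B0)"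
  have W: "finite (W s)" "W s \<subseteq> carrier G" "conjugate G s (W s) = B0" "s \<in> carrier G" if "s \<in> S" for s
  proof -
    show s: "s \<in> carrier G" using that S_carrier by blast
    show "finite (W s)" using B0 by (simp add: W_def conjugate_def)
    show "W s \<subseteq> carrier G" unfolding W_def using B0 s by (intro conjugate_closed) auto
    show "conjugate G s (W s) = B0" using conjugate_conjugate[OF B0(2), of s "inv s"] s B0(2) by (simp add: W_def conjugate_one)
  qed
  \<comment> \<open>Everything on which the action or the stabilizers must be controlled. It
    involves the tiles and the set \<open>Q\<close>, so the cylinder over \<open>B\<close> is chosen
    only after the quasi-tiling data.\<close>
  define B1 where "B1 = ctrl Q \<union> (\<Union>T\<in>L. sect ` T \<union> lift T \<union> corrections E T) \<union> E \<union> S \<union> B0 \<union> (\<Union>s\<in>S. W s)"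
  have B1: "finite B1"
    using Q L E S_finite B0 W(1) T(4) by (auto simp: B1_def lift_def corrections_def intro!: ctrl_finite)
  have B1c: "B1 \<subseteq> carrier G"
    unfolding B1_def
  proof (intro Un_least UN_least)
    show "ctrl Q \<subseteq> carrier G" by (rule ctrl_carrier[OF Q(2)])
    show "sect ` T \<subseteq> carrier G" if "T \<in> L" for T using T(6)[OF that] sect_carrier by blast
    show "lift T \<subseteq> carrier G" if "T \<in> L" for T using T(6)[OF that] by (rule lift_carrier)
    show "corrections E T \<subseteq> carrier G" if "T \<in> L" for T
    proof
      fix p assume "p \<in> corrections E T"
      then obtain e s t t' where p: "e \<in> E" "s \<in> S" "t \<in> T" "t' \<in> T" "p = inv (sect t') \<otimes> (decN (e \<otimes> s) \<otimes> sect t)"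
        by (auto simp: corrections_def)
      have "e \<otimes> s \<in> carrier G" using p E S_carrier by blast
      then have "decN (e \<otimes> s) \<in> carrier G" using dec(2) N_carrier by blast
      moreover have "sect t \<in> carrier G" "sect t' \<in> carrier G" using p T(6)[OF that] sect_carrier by auto
      ultimately show "p \<in> carrier G" using p(5) by simp
    qed
  qed (use E S_carrier B0 W(2) in auto)
  have "wt H < wt H + \<eta> * wt H / 4" using \<eta> wt_pos by simp
  then obtain B where B: "finite B" "B \<subseteq> carrier G" "B1 \<subseteq> B" "\<mu> (cyl H B) < wt H + \<eta> * wt H / 4"
    by (rule wt_approx[OF _ B1 B1c])
  have BB: "ctrl Q \<subseteq> B" "E \<subseteq> B" "S \<subseteq> B" "B0 \<subseteq> B" "\<And>s. s \<in> S \<Longrightarrow> W s \<subseteq> B"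
    "\<And>T. T \<in> L \<Longrightarrow> sect ` T \<subseteq> B" "\<And>T. T \<in> L \<Longrightarrow> lift T \<subseteq> B" "\<And>T. T \<in> L \<Longrightarrow> corrections E T \<subseteq> B"
    using B(3) unfolding B1_def by blast+
  define M where "M = (\<Sum>T\<in>L. card S * card T)"
  have M: "card S * card T \<le> M" if "T \<in> L" for T
    unfolding M_def using that L(1) by (intro member_le_sum) auto
  have ev1: "\<forall>\<^sub>F n in F. real (card (XH B n - AH B Q n)) \<le> \<eta> * card (XH B n)"
    by (rule AH_large[OF Q B(1,2) \<eta> B(4)])
  have ev2: "\<forall>\<^sub>F n in F. (1 - \<epsilon>1) * wt H < freq (m n) (\<lambda>x. x \<in> XH B n)"
    using B wt_pos \<epsilon>1 by (intro XH_large) auto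
  have "\<forall>\<^sub>F n in F. \<exists>Z. orbit_cover G (a n) E \<epsilon> M
    {x \<in> {1..m n}. \<exists>s\<in>S. stab G (a n) x \<in> cyl (conjugate G s H) B0} ((1 - \<epsilon>) * (card S * wt H) * m n) Z"
    using ev1 ev2
  proof eventually_elim
    case (elim n)
    define b where "b = (\<lambda>\<gamma>. a n (sect \<gamma>))"
    have "approx_free \<Gamma> Q b (XH B n) (AH B Q n)" unfolding b_def by (rule approx_free_AH[OF Q(2) BB(1)])
    from qt[OF this elim(1)] obtain Z0 where Z0: "tiling b (XH B n) (AH B Q n) L \<epsilon>1 Z0"
      and cov: "real (card (XH B n - \<Union> (piece b ` Z0))) \<le> (1 - \<epsilon>1 / 2) ^ k * card (XH B n)" by blast
    have finX: "finite (XH B n)" by (simp add: XH_def)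
    have shift: "stab G (a n) (a n s y) \<in> cyl (conjugate G s H) B0" if y: "y \<in> XH B n" and s: "s \<in> S" for s y
    proof -
      have sub: "insert s (W s \<union> conjugate G s (W s)) \<subseteq> B" using W(3)[OF s] BB(3,4) BB(5)[OF s] s by auto
      have "acts_at G (a n) B y" using y by (simp add: XH_def)
      then have at: "acts_at G (a n) (insert s (W s \<union> conjugate G s (W s))) y"
        using sub by (rule acts_at_mono)
      have "stab G (a n) y \<in> cyl H (W s)" using y cyl_mono[OF BB(5)[OF s], of H] by (auto simp: XH_def)
      then have "stab G (a n) (a n s y) \<in> cyl (conjugate G s H) (conjugate G s (W s))"
        using stab_cyl_conjugate[where a = "a n", OF perm[OF W(4)[OF s], of n] at W(4)[OF s] W(2)[OF s] Hc] by blast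
      then show ?thesis using W(3)[OF s] by simp
    qed
    \<comment> \<open>The point \<open>a n s y\<close> determines \<open>s\<close>: on
      \<open>B0\<close> its stabilizer reveals which conjugate of \<open>H\<close> it
      resembles.\<close>
    have key: "s = s' \<and> y = y'" if y: "y \<in> XH B n" "y' \<in> XH B n" and s: "s \<in> S" "s' \<in> S" and eq: "a n s y = a n s' y'" for s s' y y'
    proof -
      have "stab G (a n) (a n s y) \<in> cyl (conjugate G s H) B0 \<inter> cyl (conjugate G s' H) B0"
        using shift[OF y(1) s(1)] shift[OF y(2) s(2)] eq by simp
      then have "conjugate G s H \<inter> B0 = conjugate G s' H \<inter> B0" by (auto simp: cyl_def)
      then have "s = s'" using sep s by blast
      then show ?thesis using eq permutes_inj[OF perm[OF W(4)[OF s(1)], of n]] by (simp add: inj_eq)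
    qed
    have Zd: "c \<in> XH B n" "T \<in> L" "D \<subseteq> T" "(1 - \<epsilon>1) * card T \<le> card D" "inj_on (\<lambda>d. b d c) T" "(\<lambda>d. b d c) ` T \<subseteq> XH B n"
      "D \<subseteq> carrier \<Gamma>" "D \<noteq> {}" "finite D"
      if z: "(c, T, D) \<in> Z0" for c T D
    proof -
      note t = tilingD[OF Z0 z]
      show "c \<in> XH B n" using t(1) by (simp add: AH_def)
      show "T \<in> L" "D \<subseteq> T" "(1 - \<epsilon>1) * card T \<le> card D" "inj_on (\<lambda>d. b d c) T" "(\<lambda>d. b d c) ` T \<subseteq> XH B n" by (rule t)+
      show "D \<subseteq> carrier \<Gamma>" using t(3) T(6)[OF t(2)] by blast
      show "finite D" using t(3) T(4)[OF t(2)] by (rule finite_subset)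
      have "0 < card T" using T(4,5)[OF t(2)] by (simp add: card_gt_0_iff)
      then have "0 < (1 - \<epsilon>1) * card T" using \<epsilon>1 by simp
      then show "D \<noteq> {}" using t(4) by auto
    qed
    have act: "a n (s \<otimes> sect t) c = a n s (b t c)" if z: "(c, T, D) \<in> Z0" and s: "s \<in> S" and t: "t \<in> T" for c T D s t
    proof -
      have "sect t \<in> B" using BB(6)[OF Zd(2)[OF z]] t by blast
      moreover have "s \<in> B" using BB(3) s by blast
      ultimately show ?thesis using XH_acts[OF Zd(1)[OF z]] by (simp add: b_def)
    qed
    define \<Phi> where "\<Phi> = (\<lambda>(c :: nat, T, D). (c, pre (Kf T), lift D))"
    have inj: "inj_on (\<lambda>d. a n d c) (lift D)" if z: "(c, T, D) \<in> Z0" for c T D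
    proof (rule inj_onI)
      fix d d' assume d: "d \<in> lift D" "d' \<in> lift D" and eq: "a n d c = a n d' c"
      obtain s t where st: "s \<in> S" "t \<in> D" "d = s \<otimes> sect t" using d(1) by (auto simp: lift_def)
      obtain s' t' where st': "s' \<in> S" "t' \<in> D" "d' = s' \<otimes> sect t'" using d(2) by (auto simp: lift_def)
      have tT: "t \<in> T" "t' \<in> T" using st st' Zd(3)[OF z] by auto
      have "b t c \<in> XH B n" "b t' c \<in> XH B n" using Zd(6)[OF z] tT by auto
      moreover have "a n s (b t c) = a n s' (b t' c)" using eq act[OF z st(1) tT(1)] act[OF z st'(1) tT(2)] st(3) st'(3) by simp
      ultimately have "s = s'" "b t c = b t' c" using key st(1) st'(1) by blast+
      then show "d = d'" using inj_onD[OF Zd(5)[OF z] _ tT] st st' by simp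
    qed
    have pieceI: "\<exists>s\<in>S. \<exists>y\<in>piece b z. x = a n s y" if z: "z \<in> Z0" and x: "x \<in> piece (a n) (\<Phi> z)" for x z
    proof -
      obtain c T D where zz: "z = (c, T, D)" by (cases z)
      have z': "(c, T, D) \<in> Z0" using z zz by simp
      obtain d where d: "d \<in> lift D" "x = a n d c" using x by (auto simp: piece_def \<Phi>_def zz)
      then obtain s t where st: "s \<in> S" "t \<in> D" "d = s \<otimes> sect t" by (auto simp: lift_def)
      have "x = a n s (b t c)" using act[OF z' st(1)] Zd(3)[OF z'] st d(2) by auto
      moreover have "b t c \<in> piece b z" using st(2) by (simp add: piece_def zz)
      ultimately show ?thesis using st(1) by blast
    qed
    have same: "z = z'" if z: "z \<in> Z0" "z' \<in> Z0" and x: "x \<in> piece (a n) (\<Phi> z)" "x \<in> piece (a n) (\<Phi> z')" for x z z'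
    proof -
      obtain s y where y: "s \<in> S" "y \<in> piece b z" "x = a n s y" using pieceI[OF z(1) x(1)] by blast
      obtain s' y' where y': "s' \<in> S" "y' \<in> piece b z'" "x = a n s' y'" using pieceI[OF z(2) x(2)] by blast
      have "y \<in> XH B n" "y' \<in> XH B n" using piece_subset[OF Z0 z(1)] piece_subset[OF Z0 z(2)] y y' by auto
      then have "y = y'" using key y y' by blast
      then show ?thesis using tiling_inj[OF Z0 z] y y' by blast
    qed
    have card_\<Phi>: "card (piece (a n) (\<Phi> z)) = card S * card (piece b z)" if z: "z \<in> Z0" for z
    proof -
      obtain c T D where zz: "z = (c, T, D)" by (cases z)
      have z': "(c, T, D) \<in> Z0" using z zz by simp
      have "card (piece (a n) (\<Phi> z)) = card (lift D)"
        using card_image[OF inj[OF z']] by (simp add: piece_def \<Phi>_def zz)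
      also have "\<dots> = card S * card D" using card_lift[OF Zd(7)[OF z']] .
      also have "card D = card (piece b z)" using card_piece[OF Z0 z] zz by simp
      finally show ?thesis .
    qed
    have "inj_on \<Phi> Z0"
    proof (rule inj_onI)
      fix z z' assume z: "z \<in> Z0" "z' \<in> Z0" "\<Phi> z = \<Phi> z'"
      obtain c T D where zz: "z = (c, T, D)" by (cases z)
      obtain d where "d \<in> D" using Zd(8)[of c T D] z(1) zz by blast
      moreover obtain s where "s \<in> S" using S_some[OF one_closed] by blast
      ultimately have "s \<otimes> sect d \<in> lift D" by (force simp: lift_def)
      then have "a n (s \<otimes> sect d) c \<in> piece (a n) (\<Phi> z)" by (simp add: piece_def \<Phi>_def zz)
      then show "z = z'" using same[OF z(1,2)] z(3) by simp
    qed
    have finZ0: "finite Z0" using Z0 by (simp add: tiling_def)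
    show ?case
      unfolding orbit_cover_def
    proof (intro exI[of _ "\<Phi> ` Z0"] conjI ballI)
      show "finite (\<Phi> ` Z0)" using finZ0 by simp
      show "disjoint_family_on (piece (a n)) (\<Phi> ` Z0)"
        unfolding disjoint_family_on_def
      proof (intro ballI impI, rule ccontr)
        fix z z' assume z: "z \<in> \<Phi> ` Z0" "z' \<in> \<Phi> ` Z0" "z \<noteq> z'" and ne: "piece (a n) z \<inter> piece (a n) z' \<noteq> {}"
        obtain w w' where w: "w \<in> Z0" "w' \<in> Z0" "z = \<Phi> w" "z' = \<Phi> w'" using z by blast
        obtain x where "x \<in> piece (a n) (\<Phi> w)" "x \<in> piece (a n) (\<Phi> w')" using ne w by blast
        then have "w = w'" using same w by blast
        then show False using z(3) w by simp
      qed
    next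
      fix z assume "z \<in> \<Phi> ` Z0"
      then obtain w where w: "w \<in> Z0" "z = \<Phi> w" by blast
      obtain c T D where ww: "w = (c, T, D)" by (cases w)
      have z': "(c, T, D) \<in> Z0" using w ww by simp
      have zeq: "z = (c, pre (Kf T), lift D)" using w ww by (simp add: \<Phi>_def)
      note TL = Zd(2)[OF z']
      have cX: "acts_at G (a n) B c" "stab G (a n) c \<in> cyl H B" using Zd(1)[OF z'] by (simp_all add: XH_def)
      show "orbit_piece G (a n) E \<epsilon> M z"
        unfolding zeq \<epsilon>1(4)[symmetric]
        by (rule orbit_piece_lift[OF T(1)[OF TL] T(2)[OF TL] T(3)[OF TL] Zd(3,4)[OF z'] \<epsilon>1(1,3) E cX BB(2) BB(7)[OF TL] BB(8)[OF TL] inj[OF z'] M[OF TL]])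
      show "piece (a n) z \<subseteq> {x \<in> {1..m n}. \<exists>s\<in>S. stab G (a n) x \<in> cyl (conjugate G s H) B0}"
      proof
        fix x assume "x \<in> piece (a n) z"
        then obtain s y where y: "s \<in> S" "y \<in> piece b w" "x = a n s y" using pieceI[OF w(1)] w(2) by blast
        have yX: "y \<in> XH B n" using piece_subset[OF Z0 w(1)] y by blast
        then have "y \<in> {1..m n}" by (simp add: XH_def)
        then have "x \<in> {1..m n}" using permutes_in_image[OF perm[OF W(4)[OF y(1)], of n]] y(3) by blast
        then show "x \<in> {x \<in> {1..m n}. \<exists>s\<in>S. stab G (a n) x \<in> cyl (conjugate G s H) B0}"
          using shift[OF yX y(1)] y by blast
      qed
    next
      have U: "\<Union> (piece b ` Z0) \<subseteq> XH B n" using piece_subset[OF Z0] by (rule UN_least)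
      have "real (card (XH B n - \<Union> (piece b ` Z0))) = card (XH B n) - real (card (\<Union> (piece b ` Z0)))"
        using U finX card_mono[OF finX U] by (simp add: card_Diff_subset finite_subset)
      moreover have "(1 - \<epsilon>1 / 2) ^ k * card (XH B n) \<le> \<epsilon>1 * card (XH B n)" using k by (intro mult_right_mono) auto
      ultimately have c1: "(1 - \<epsilon>1) * card (XH B n) \<le> card (\<Union> (piece b ` Z0))" using cov by (simp add: algebra_simps)
      have "(1 - \<epsilon>1) * wt H * m n \<le> freq (m n) (\<lambda>x. x \<in> XH B n) * m n" using elim(2) by (intro mult_right_mono) auto
      then have c2: "(1 - \<epsilon>1) * wt H * m n \<le> card (XH B n)" using card_XH by simp
      \<comment> \<open>One factor 1 - \<epsilon>1 accounts for the frequency of \<open>XH\<close>,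
        the other for the part left uncovered by the tiling.\<close>
      have "(1 - \<epsilon>) * (card S * wt H) * m n \<le> (1 - \<epsilon>1) ^ 2 * (card S * wt H) * m n"
      proof (intro mult_right_mono)
        show "1 - \<epsilon> \<le> (1 - \<epsilon>1) ^ 2" using Bernoulli_inequality[of "- \<epsilon>1" 2] \<epsilon>1 by simp
      qed (use wt_nonneg in auto)
      also have "\<dots> = card S * ((1 - \<epsilon>1) * ((1 - \<epsilon>1) * wt H * m n))" by (simp add: power2_eq_square)
      also have "\<dots> \<le> card S * ((1 - \<epsilon>1) * card (XH B n))" using c2 \<epsilon>1 by (intro mult_left_mono) auto
      also have "\<dots> \<le> card S * real (card (\<Union> (piece b ` Z0)))" using c1 by (intro mult_left_mono) auto
      also have "\<dots> = (\<Sum>z\<in>Z0. real (card (piece (a n) (\<Phi> z))))"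
        using card_covered[OF Z0 finX] card_\<Phi> by (simp add: sum_distrib_left)
      also have "\<dots> = (\<Sum>z\<in>\<Phi> ` Z0. real (card (piece (a n) z)))"
        using \<open>inj_on \<Phi> Z0\<close> by (simp add: sum.reindex)
      finally show "(1 - \<epsilon>) * (card S * wt H) * m n \<le> (\<Sum>z\<in>\<Phi> ` Z0. real (card (piece (a n) z)))" .
    qed
  qed
  then show ?thesis by blast
qed

end


subsection \<open>Stability of asymptotic homomorphisms\<close>

lemma orbit_piece_mono:
  assumes "orbit_piece G a E \<epsilon> M z" "\<epsilon> \<le> \<epsilon>'" "M \<le> M'"
  shows "orbit_piece G a E \<epsilon>' M' z"
proof -
  have 1: "(1 - \<epsilon>') * real k \<le> (1 - \<epsilon>) * real k" and 2: "\<epsilon> * real k \<le> \<epsilon>' * real k" for k :: nat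
    using assms(2) by (intro mult_right_mono; simp)+
  show ?thesis
    using assms(1,3) unfolding orbit_piece_def
    by (cases z) (auto intro: order_trans[OF 1] order_trans[OF _ 2])
qed

context stab_limit
begin

text \<open>Covers for finitely many conjugacy classes of atoms are put together. They live over
  disjoint regions since one set \<open>B0\<close> separates all conjugates of the atoms. Growth of
  \<open>m\<close> makes the bounded size of the coset spaces negligible.\<close>

theorem eventually_close_hom:
  assumes count: "countable {H. subgroup H G}"
    and pc: "\<And>H. almost_normal G H \<Longrightarrow> profinitely_closed G H"
    and \<nu>: "invariant_mean G \<nu>"
    and E: "finite E" "E \<subseteq> carrier G" and \<epsilon>: "0 < \<epsilon>" "\<epsilon> < 1"
    and large: "filterlim m at_top F"
  shows "\<forall>\<^sub>F n in F. \<exists>\<rho>\<in>hom G (sym_group (m n)). \<forall>e\<in>E. freq (m n) (\<lambda>x. \<rho> e x \<noteq> a n e x) \<le> \<epsilon>"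
proof -
  \<comment> \<open>\<open>hom_of_orbit_pieces\<close> returns three times its error. Half of
    \<epsilon>2 is spent on the mass that the atoms miss, half on incomplete covers.\<close>
  define \<epsilon>2 where "\<epsilon>2 = \<epsilon> / 3"
  have \<epsilon>2: "0 < \<epsilon>2" "\<epsilon>2 < 1" "3 * \<epsilon>2 = \<epsilon>" using \<epsilon> by (auto simp: \<epsilon>2_def)
  have "0 < \<epsilon>2 / 2" using \<epsilon>2 by simp
  from concentration[OF count this] obtain \<H> where Hs: "finite \<H>" "\<And>H. H \<in> \<H> \<Longrightarrow> subgroup H G \<and> 0 < wt H"
    "1 - \<epsilon>2 / 2 \<le> sum wt \<H>" by blast
  define cl where "cl = (\<lambda>H. (\<lambda>g. conjugate G g H) ` carrier G)"
  have sub: "H \<subseteq> carrier G" if "H \<in> \<H>" for H using Hs(2)[OF that] subgroup.subset by blast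
  have cl_eq: "{g <# H #> inv g | g. g \<in> carrier G} = cl H" if "H \<in> \<H>" for H
    using conjugate_eq[OF sub[OF that]] by (auto simp: cl_def)
  have an: "almost_normal G H" if "H \<in> \<H>" for H using Hs(2)[OF that] wt_pos_almost_normal by blast
  have fin_cl: "finite (cl H)" if "H \<in> \<H>" for H
    using an[OF that] cl_eq[OF that] by (simp add: almost_normal_def)
  have cl_sub: "H' \<subseteq> carrier G" "wt H' = wt H" if "H \<in> \<H>" "H' \<in> cl H" for H H'
    using that sub[OF that(1)] by (auto simp: cl_def wt_conjugate dest: subsetD[OF conjugate_closed])
  have self: "H \<in> cl H" if "H \<in> \<H>" for H
    unfolding cl_def using conjugate_one[OF sub[OF that]] by (metis image_eqI one_closed)
  have cl_mem: "cl H' = cl H" if H: "H \<in> \<H>" and H': "H' \<in> cl H" for H H'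
  proof -
    obtain g where g: "g \<in> carrier G" "H' = conjugate G g H" using H' by (auto simp: cl_def)
    show ?thesis
    proof
      show "cl H' \<subseteq> cl H" using g conjugate_conjugate[OF sub[OF H] _ g(1)] by (auto simp: cl_def)
      show "cl H \<subseteq> cl H'"
      proof
        fix K assume "K \<in> cl H"
        then obtain h where h: "h \<in> carrier G" "K = conjugate G h H" by (auto simp: cl_def)
        have "conjugate G (h \<otimes> inv g) H' = conjugate G (h \<otimes> inv g \<otimes> g) H"
          unfolding g(2) using g h by (intro conjugate_conjugate sub[OF H]) auto
        also have "h \<otimes> inv g \<otimes> g = h" using g h by (simp add: m_assoc)
        finally show "K \<in> cl H'" using h g unfolding cl_def by (metis image_eqI inv_closed m_closed)
      qed
    qed
  qed
  define r where "r = (\<lambda>C. SOME H. H \<in> \<H> \<and> cl H = C)"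
  have r: "r C \<in> \<H>" "cl (r C) = C" if "C \<in> cl ` \<H>" for C
  proof -
    have "r C \<in> \<H> \<and> cl (r C) = C" unfolding r_def by (rule someI_ex) (use that in blast)
    then show "r C \<in> \<H>" "cl (r C) = C" by auto
  qed
  have finU: "finite (\<Union>(cl ` \<H>))" using Hs(1) fin_cl by blast
  have subU: "K \<subseteq> carrier G" if "K \<in> \<Union>(cl ` \<H>)" for K using cl_sub(1) that by blast
  obtain B0 where B0: "finite B0" "B0 \<subseteq> carrier G"
    and sep: "\<And>K K'. K \<in> \<Union>(cl ` \<H>) \<Longrightarrow> K' \<in> \<Union>(cl ` \<H>) \<Longrightarrow> K \<noteq> K' \<Longrightarrow> K \<inter> B0 \<noteq> K' \<inter> B0"
    by (rule separating_set[OF finU subU]) blast+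
  have sepC: "C = C'" if C: "C \<in> cl ` \<H>" "C' \<in> cl ` \<H>" and K: "K \<in> C" "K' \<in> C'" and x: "X \<in> cyl K B0" "X \<in> cyl K' B0" for C C' K K' X
  proof -
    have "K \<inter> B0 = K' \<inter> B0" using x by (auto simp: cyl_def)
    then have "K = K'" using sep[of K K'] C K by blast
    then show ?thesis using cl_mem C K by blast
  qed
  define spot where "spot = (\<lambda>C n. {x \<in> {1..m n}. \<exists>K\<in>C. stab G (a n) x \<in> cyl K B0})"
  define COV where "COV = (\<lambda>M C n. orbit_cover G (a n) E (\<epsilon>2 / 2) M (spot C n) ((1 - \<epsilon>2 / 2) * (card C * wt (r C)) * m n))"
  have "\<forall>C\<in>cl ` \<H>. \<exists>M. \<forall>\<^sub>F n in F. \<exists>Z. COV M C n Z"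
  proof
    fix C assume C: "C \<in> cl ` \<H>"
    have rH: "r C \<in> \<H>" "cl (r C) = C" using r[OF C] by auto
    have "finite_conjugacy G (r C)"
      using Hs(2)[OF rH(1)] fin_cl[OF rH(1)] is_group
      by (intro finite_conjugacy.intro finite_conjugacy_axioms.intro) (simp_all add: cl_def)
    then interpret A: atom G F m a \<mu> "r C"
      using Hs(2)[OF rH(1)] stab_limit_axioms by (intro atom.intro atom_axioms.intro) simp_all
    have SC: "(\<lambda>s. conjugate G s (r C)) ` A.S \<subseteq> C"
    proof (rule image_subsetI)
      fix s assume "s \<in> A.S"
      then have "s \<in> carrier G" using A.S_carrier by blast
      then have "conjugate G s (r C) \<in> cl (r C)" by (simp add: cl_def)
      then show "conjugate G s (r C) \<in> C" using rH(2) by simp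
    qed
    have cS: "card A.S = card C" using A.card_S rH(2) by (simp add: cl_def)
    have "conjugate G s (r C) \<inter> B0 \<noteq> conjugate G s' (r C) \<inter> B0" if "s \<in> A.S" "s' \<in> A.S" "s \<noteq> s'" for s s'
    proof (rule sep)
      show "conjugate G s (r C) \<noteq> conjugate G s' (r C)" using A.S_inj that by blast
    qed (use SC C that in blast)+
    then obtain M where M: "\<forall>\<^sub>F n in F. \<exists>Z. orbit_cover G (a n) E (\<epsilon>2 / 2) M
      {x \<in> {1..m n}. \<exists>s\<in>A.S. stab G (a n) x \<in> cyl (conjugate G s (r C)) B0} ((1 - \<epsilon>2 / 2) * (card A.S * wt (r C)) * m n) Z"
      using A.atom_pieces[OF \<nu> pc[OF an[OF rH(1)]] E _ _ B0, of "\<epsilon>2 / 2"] \<epsilon>2 by auto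
    have spot: "{x \<in> {1..m n}. \<exists>s\<in>A.S. stab G (a n) x \<in> cyl (conjugate G s (r C)) B0} \<subseteq> spot C n" for n
      unfolding spot_def using SC by blast
    show "\<exists>M. \<forall>\<^sub>F n in F. \<exists>Z. COV M C n Z"
    proof (rule exI[of _ M], rule eventually_mono[OF M], elim exE)
      fix n Z
      assume "orbit_cover G (a n) E (\<epsilon>2 / 2) M
        {x \<in> {1..m n}. \<exists>s\<in>A.S. stab G (a n) x \<in> cyl (conjugate G s (r C)) B0} ((1 - \<epsilon>2 / 2) * (card A.S * wt (r C)) * m n) Z"
      then have "COV M C n Z"
        using spot[of n] unfolding COV_def orbit_cover_def cS by (meson subset_trans)
      then show "\<exists>Z. COV M C n Z" by blast
    qed
  qed
  from bchoice[OF this] obtain Mf where Mf: "\<forall>C\<in>cl ` \<H>. \<forall>\<^sub>F n in F. \<exists>Z. COV (Mf C) C n Z" ..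
  have finC: "finite (cl ` \<H>)" using Hs(1) by simp
  have ev1: "\<forall>\<^sub>F n in F. \<forall>C\<in>cl ` \<H>. \<exists>Z. COV (Mf C) C n Z"
    using finC Mf by (rule eventually_ball_finite)
  define M where "M = sum Mf (cl ` \<H>)"
  have M: "Mf C \<le> M" if "C \<in> cl ` \<H>" for C unfolding M_def using that finC by (intro member_le_sum) auto
  define M0 where "M0 = nat \<lceil>M / \<epsilon>2\<rceil>"
  have ev2: "\<forall>\<^sub>F n in F. M0 \<le> m n" using large by (simp add: filterlim_at_top)
  \<comment> \<open>\<open>\<H>\<close> may contain several members of a class. They have equal mass
    and number at most \<open>card C\<close>, while the cover of the class accounts for all
    \<open>card C\<close> conjugates.\<close>
  have total: "1 - \<epsilon>2 / 2 \<le> (\<Sum>C\<in>cl ` \<H>. card C * wt (r C))"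
  proof -
    have "sum wt \<H> = (\<Sum>C\<in>cl ` \<H>. sum wt {H \<in> \<H>. cl H = C})" using Hs(1) by (rule sum.image_gen)
    also have "\<dots> \<le> (\<Sum>C\<in>cl ` \<H>. card C * wt (r C))"
    proof (rule sum_mono)
      fix C assume C: "C \<in> cl ` \<H>"
      have "wt H = wt (r C)" if "H \<in> \<H>" "cl H = C" for H
        using cl_sub(2)[OF r(1)[OF C], of H] self[OF that(1)] that(2) r(2)[OF C] by simp
      then have "sum wt {H \<in> \<H>. cl H = C} = card {H \<in> \<H>. cl H = C} * wt (r C)" by simp
      also have "\<dots> \<le> card C * wt (r C)"
      proof (rule mult_right_mono)
        have "{H \<in> \<H>. cl H = C} \<subseteq> C" using self by blast
        moreover have "finite C" using fin_cl C by blast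
        ultimately show "real (card {H \<in> \<H>. cl H = C}) \<le> real (card C)" by (simp add: card_mono)
      qed (rule wt_nonneg)
      finally show "sum wt {H \<in> \<H>. cl H = C} \<le> card C * wt (r C)" .
    qed
    finally show ?thesis using Hs(3) by simp
  qed
  show ?thesis
    using ev1 ev2
  proof eventually_elim
    case (elim n)
    from bchoice[OF elim(1)] obtain Zf where Zf: "\<forall>C\<in>cl ` \<H>. COV (Mf C) C n (Zf C)" ..
    have Z: "finite (Zf C)" "disjoint_family_on (piece (a n)) (Zf C)" "\<And>z. z \<in> Zf C \<Longrightarrow> orbit_piece G (a n) E (\<epsilon>2 / 2) (Mf C) z"
      "\<And>z. z \<in> Zf C \<Longrightarrow> piece (a n) z \<subseteq> spot C n"
      "(1 - \<epsilon>2 / 2) * (card C * wt (r C)) * m n \<le> (\<Sum>z\<in>Zf C. real (card (piece (a n) z)))" if "C \<in> cl ` \<H>" for C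
      using bspec[OF Zf that] unfolding COV_def orbit_cover_def by blast+
    define ZZ where "ZZ = \<Union>(Zf ` (cl ` \<H>))"
    have finZZ: "finite ZZ" unfolding ZZ_def using finC Z(1) by (rule finite_UN_I)
    have spot_disj: "spot C n \<inter> spot C' n = {}" if C: "C \<in> cl ` \<H>" "C' \<in> cl ` \<H>" "C \<noteq> C'" for C C'
    proof (rule ccontr)
      assume "spot C n \<inter> spot C' n \<noteq> {}"
      then obtain x K K' where "K \<in> C" "K' \<in> C'" "stab G (a n) x \<in> cyl K B0" "stab G (a n) x \<in> cyl K' B0" by (auto simp: spot_def)
      then show False using sepC[OF C(1,2)] C(3) by blast
    qed
    have dZZ: "disjoint_family_on (piece (a n)) ZZ"
      unfolding disjoint_family_on_def
    proof (intro ballI impI)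
      fix z z' assume z: "z \<in> ZZ" "z' \<in> ZZ" "z \<noteq> z'"
      obtain C C' where C: "C \<in> cl ` \<H>" "z \<in> Zf C" "C' \<in> cl ` \<H>" "z' \<in> Zf C'" using z by (auto simp: ZZ_def)
      show "piece (a n) z \<inter> piece (a n) z' = {}"
      proof (cases "C = C'")
        case True
        then show ?thesis using Z(2)[OF C(1)] C z(3) by (simp add: disjoint_family_on_def)
      next
        case False
        then show ?thesis using spot_disj[OF C(1,3)] Z(4)[OF C(1,2)] Z(4)[OF C(3,4)] by blast
      qed
    qed
    have U: "\<Union>(piece (a n) ` ZZ) \<subseteq> {1..m n}"
    proof (rule UN_least)
      fix z assume "z \<in> ZZ"
      then obtain C where "C \<in> cl ` \<H>" "z \<in> Zf C" by (auto simp: ZZ_def)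
      then have "piece (a n) z \<subseteq> spot C n" by (rule Z(4))
      then show "piece (a n) z \<subseteq> {1..m n}" by (auto simp: spot_def)
    qed
    have fin_piece: "finite (piece (a n) z)" if "z \<in> ZZ" for z using U that by (meson UN_upper finite_atLeastAtMost finite_subset subset_trans)
    have cardU: "card (\<Union>(piece (a n) ` Y)) = (\<Sum>z\<in>Y. card (piece (a n) z))" if "Y \<subseteq> ZZ" for Y
    proof (rule card_UN_disjoint)
      show "finite Y" using that finZZ by (rule finite_subset)
      show "\<forall>z\<in>Y. finite (piece (a n) z)" using fin_piece that by blast
      show "\<forall>z\<in>Y. \<forall>z'\<in>Y. z \<noteq> z' \<longrightarrow> piece (a n) z \<inter> piece (a n) z' = {}" using dZZ that unfolding disjoint_family_on_def by blast
    qed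
    have ZfZZ: "Zf C \<subseteq> ZZ" if "C \<in> cl ` \<H>" for C using that by (auto simp: ZZ_def)
    have "(\<Sum>z\<in>ZZ. card (piece (a n) z)) = card (\<Union>(piece (a n) ` ZZ))" using cardU[of ZZ] by simp
    also have "\<Union>(piece (a n) ` ZZ) = (\<Union>C\<in>cl ` \<H>. \<Union>(piece (a n) ` Zf C))" by (auto simp: ZZ_def)
    also have "card \<dots> = (\<Sum>C\<in>cl ` \<H>. card (\<Union>(piece (a n) ` Zf C)))"
    proof (rule card_UN_disjoint[OF finC])
      show "\<forall>C\<in>cl ` \<H>. finite (\<Union>(piece (a n) ` Zf C))" using Z(1) fin_piece ZfZZ by blast
      show "\<forall>C\<in>cl ` \<H>. \<forall>C'\<in>cl ` \<H>. C \<noteq> C' \<longrightarrow> \<Union>(piece (a n) ` Zf C) \<inter> \<Union>(piece (a n) ` Zf C') = {}"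
      proof (intro ballI impI)
        fix C C' assume C: "C \<in> cl ` \<H>" "C' \<in> cl ` \<H>" "C \<noteq> C'"
        have "\<Union>(piece (a n) ` Zf C) \<subseteq> spot C n" "\<Union>(piece (a n) ` Zf C') \<subseteq> spot C' n"
          using Z(4)[OF C(1)] Z(4)[OF C(2)] by (simp_all add: UN_least)
        then show "\<Union>(piece (a n) ` Zf C) \<inter> \<Union>(piece (a n) ` Zf C') = {}" using spot_disj[OF C] by blast
      qed
    qed
    also have "\<dots> = (\<Sum>C\<in>cl ` \<H>. \<Sum>z\<in>Zf C. card (piece (a n) z))" using cardU ZfZZ by (intro sum.cong) auto
    finally have "(\<Sum>z\<in>ZZ. real (card (piece (a n) z))) = (\<Sum>C\<in>cl ` \<H>. \<Sum>z\<in>Zf C. real (card (piece (a n) z)))"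
      by (simp add: of_nat_sum[symmetric] del: of_nat_sum)
    also have "\<dots> \<ge> (\<Sum>C\<in>cl ` \<H>. (1 - \<epsilon>2 / 2) * (card C * wt (r C)) * m n)" using Z(5) by (rule sum_mono)
    finally have low: "(\<Sum>C\<in>cl ` \<H>. (1 - \<epsilon>2 / 2) * (card C * wt (r C)) * m n) \<le> (\<Sum>z\<in>ZZ. real (card (piece (a n) z)))" .
    have "(1 - \<epsilon>2) * m n \<le> (1 - \<epsilon>2 / 2) * (1 - \<epsilon>2 / 2) * m n"
      using Bernoulli_inequality[of "- (\<epsilon>2 / 2)" 2] \<epsilon>2 by (intro mult_right_mono) (auto simp: power2_eq_square)
    also have "\<dots> \<le> (1 - \<epsilon>2 / 2) * (\<Sum>C\<in>cl ` \<H>. card C * wt (r C)) * m n"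
      using total \<epsilon>2 by (intro mult_right_mono mult_left_mono) auto
    also have "\<dots> = (\<Sum>C\<in>cl ` \<H>. (1 - \<epsilon>2 / 2) * (card C * wt (r C)) * m n)"
      by (simp add: sum_distrib_left sum_distrib_right)
    finally have cov: "(1 - \<epsilon>2) * m n \<le> (\<Sum>z\<in>ZZ. real (card (piece (a n) z)))" using low by simp
    have pc: "orbit_piece G (a n) E \<epsilon>2 M z" if z: "z \<in> ZZ" for z
    proof -
      obtain C where C: "C \<in> cl ` \<H>" "z \<in> Zf C" using z by (auto simp: ZZ_def)
      show ?thesis by (rule orbit_piece_mono[OF Z(3)[OF C] _ M[OF C(1)]]) (use \<epsilon>2 in simp)
    qed
    have "M / \<epsilon>2 \<le> M0" by (simp add: M0_def real_nat_ceiling_ge)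
    also have "\<dots> \<le> m n" using elim(2) by simp
    finally have "M / \<epsilon>2 \<le> m n" .
    then have "M \<le> \<epsilon>2 * m n" using \<epsilon>2 by (simp add: field_simps)
    from hom_of_orbit_pieces[OF finZZ dZZ U pc cov this \<epsilon>2(1,2) E(2)]
    obtain \<rho> where \<rho>: "\<rho> \<in> hom G (sym_group (m n))" "\<forall>e\<in>E. real (card {i \<in> {1..m n}. \<rho> e i \<noteq> a n e i}) \<le> 3 * \<epsilon>2 * m n" by blast
    have "freq (m n) (\<lambda>x. \<rho> e x \<noteq> a n e x) \<le> \<epsilon>" if "e \<in> E" for e
      using \<rho>(2) that m_pos[of n] \<epsilon>2(3) by (simp add: freq_def divide_le_eq)
    then show ?case using \<rho>(1) by blast
  qed
qed

end

lemma asymptotic_hom_filter_mono: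
  assumes "asymptotic_hom G F m a" "F' \<le> F"
  shows "asymptotic_hom G F' m a"
  using assms tendsto_mono unfolding asymptotic_hom_def by blast

lemma inf_principal_neq_bot:
  assumes "\<exists>\<^sub>F n in F. P n"
  shows "inf F (principal {n. P n}) \<noteq> bot"
proof
  assume "inf F (principal {n. P n}) = bot"
  then have "\<forall>\<^sub>F n in inf F (principal {n. P n}). False" by simp
  then have "\<forall>\<^sub>F n in F. \<not> P n" by (simp add: eventually_inf_principal)
  then show False using assms by (simp add: frequently_def)
qed

lemma tendsto_nat_eventually_const:
  fixes v :: "'i \<Rightarrow> nat"
  assumes "F \<noteq> bot" "((\<lambda>n. real (v n)) \<longlongrightarrow> l) F"
  obtains k where "\<forall>\<^sub>F n in F. v n = k"
proof -
  have ev: "\<forall>\<^sub>F n in F. dist (real (v n)) l < 1 / 2" using tendstoD[OF assms(2), of "1 / 2"] by simp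
  then obtain n0 where n0: "dist (real (v n0)) l < 1 / 2" using eventually_happens'[OF assms(1)] by blast
  have "\<forall>\<^sub>F n in F. v n = v n0"
    using ev
  proof eventually_elim
    case (elim n)
    then have "\<bar>real (v n) - real (v n0)\<bar> < 1" using n0 unfolding dist_real_def by linarith
    then show ?case by linarith
  qed
  then show thesis by (rule that)
qed

text \<open>In bounded degree the errors of a tiling do not become small, but a pointwise limit of the maps is
  an exact homomorphism.\<close>

lemma (in group) bounded_degree_close_hom:
  assumes F: "F \<noteq> bot" and ah: "asymptotic_hom G F m a" and bound: "\<forall>\<^sub>F n in F. m n < M" and E: "finite E" "E \<subseteq> carrier G"
  shows "\<exists>\<^sub>F n in F. \<exists>\<rho>\<in>hom G (sym_group (m n)). \<forall>e\<in>E. freq (m n) (\<lambda>x. \<rho> e x \<noteq> a n e x) = 0"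
proof -
  have perm: "a n g permutes {1..m n}" if "g \<in> carrier G" for n g using ah that by (simp add: asymptotic_hom_def)
  have pos: "0 < m n" for n using ah by (simp add: asymptotic_hom_def)
  \<comment> \<open>One family of integers records the degree, at \<open>None\<close>, and the
    values of the permutations, at \<open>Some (p, x)\<close>. The default 0 keeps it bounded where
    the degree is not below \<open>M\<close> or \<open>p\<close> lies outside the group.\<close>
  define v where "v = (\<lambda>j n. if m n < M then (case j of None \<Rightarrow> m n | Some (p, x) \<Rightarrow> if p \<in> carrier G then a n p x else 0) else 0)"
  define c where "c = (\<lambda>j :: ('a \<times> nat) option. case j of None \<Rightarrow> real M | Some (p, x) \<Rightarrow> real (max M x))"
  have "\<bar>real (v j n)\<bar> \<le> c j" for j n
  proof (cases j)
    case None
    then show ?thesis by (simp add: v_def c_def)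
  next
    case (Some px)
    obtain p x where px: "px = (p, x)" by (cases px)
    have "a n p x \<le> max M x" if "p \<in> carrier G" "m n < M"
    proof (cases "x \<in> {1..m n}")
      case True
      then have "a n p x \<in> {1..m n}" using permutes_in_image[OF perm[OF that(1), of n]] by blast
      then have "a n p x \<le> M" using that(2) by simp
      then show ?thesis by (rule max.coboundedI1)
    next
      case False
      then have "a n p x = x" using perm[OF that(1), of n] by (simp add: permutes_def)
      then show ?thesis by simp
    qed
    then show ?thesis using Some px by (simp add: v_def c_def)
  qed
  then obtain F' l where F': "F' \<noteq> bot" "F' \<le> F" and l: "\<And>j. ((\<lambda>n. real (v j n)) \<longlongrightarrow> l j) F'"
    using bounded_family_cluster_filter[OF F, of "\<lambda>j n. real (v j n)" c] by metis
  have "\<exists>k. \<forall>\<^sub>F n in F'. v j n = k" for j using tendsto_nat_eventually_const[OF F'(1) l[of j]] by metis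
  then obtain k where k: "\<And>j. \<forall>\<^sub>F n in F'. v j n = k j" by metis
  have bound': "\<forall>\<^sub>F n in F'. m n < M" using F'(2) bound by (rule filter_leD)
  define m0 where "m0 = k None"
  have m0: "\<forall>\<^sub>F n in F'. m n = m0" using k[of None] bound' by eventually_elim (simp add: v_def m0_def)
  define \<rho> where "\<rho> = (\<lambda>p x. if x \<in> {1..m0} then k (Some (p, x)) else x)"
  have \<rho>: "\<forall>\<^sub>F n in F'. m n = m0 \<and> a n p = \<rho> p" if p: "p \<in> carrier G" for p
  proof -
    have "\<forall>\<^sub>F n in F'. \<forall>x\<in>{1..m0}. v (Some (p, x)) n = k (Some (p, x))"
      by (intro eventually_ball_finite ballI k) simp
    with m0 bound' show ?thesis
    proof eventually_elim
      case (elim n)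
      have "a n p x = \<rho> p x" for x
      proof (cases "x \<in> {1..m0}")
        case True
        then have "v (Some (p, x)) n = k (Some (p, x))" using elim(3) by blast
        then show ?thesis using True elim(2) p by (simp add: v_def \<rho>_def)
      next
        case False
        then have "x \<notin> {1..m n}" using elim(1) by simp
        then have "a n p x = x" by (rule permutes_not_in[OF perm[OF p, of n]])
        moreover have "\<rho> p x = x" using False unfolding \<rho>_def by (rule if_not_P)
        ultimately show ?thesis by simp
      qed
      then show ?case using elim(1) by blast
    qed
  qed
  have "\<rho> \<in> hom G (sym_group m0)"
  proof (rule homI)
    fix p assume p: "p \<in> carrier G"
    obtain n where "m n = m0 \<and> a n p = \<rho> p" using eventually_happens'[OF F'(1) \<rho>[OF p]] by blast
    then show "\<rho> p \<in> carrier (sym_group m0)" using perm[OF p, of n] by (simp add: sym_group_carrier)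
  next
    fix p q assume pq: "p \<in> carrier G" "q \<in> carrier G"
    have "((\<lambda>n. freq (m n) (\<lambda>x. a n p (a n q x) \<noteq> a n (p \<otimes> q) x)) \<longlongrightarrow> 0) F'"
      using asymptotic_hom_filter_mono[OF ah F'(2)] pq unfolding asymptotic_hom_def by blast
    \<comment> \<open>With fewer than \<open>M\<close> points, a frequency below 1 / M means that
      there is no exception at all.\<close>
    moreover have "0 < 1 / real M"
    proof -
      obtain n where "m n < M" using eventually_happens'[OF F'(1) bound'] by blast
      then show ?thesis by simp
    qed
    ultimately have "\<forall>\<^sub>F n in F'. freq (m n) (\<lambda>x. a n p (a n q x) \<noteq> a n (p \<otimes> q) x) < 1 / real M" by (rule order_tendstoD)
    with \<rho>[OF pq(1)] \<rho>[OF pq(2)] \<rho>[OF m_closed[OF pq]] bound'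
    have "\<forall>\<^sub>F n in F'. \<rho> (p \<otimes> q) = \<rho> p \<circ> \<rho> q"
    proof eventually_elim
      case (elim n)
      have "real (card {x \<in> {1..m n}. a n p (a n q x) \<noteq> a n (p \<otimes> q) x}) < m n / M"
        using elim(5) pos[of n] by (simp add: freq_def field_simps)
      also have "\<dots> \<le> 1" using elim(4) by simp
      finally have "card {x \<in> {1..m n}. a n p (a n q x) \<noteq> a n (p \<otimes> q) x} = 0" by simp
      then have "{x \<in> {1..m n}. a n p (a n q x) \<noteq> a n (p \<otimes> q) x} = {}" by simp
      then have in': "a n p (a n q x) = a n (p \<otimes> q) x" if "x \<in> {1..m n}" for x using that by blast
      have "a n (p \<otimes> q) x = a n p (a n q x)" for x
      proof (cases "x \<in> {1..m n}")
        case False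
        then show ?thesis using perm[OF pq(1), of n] perm[OF pq(2), of n] perm[OF m_closed[OF pq], of n]
          by (simp add: permutes_def)
      qed (simp add: in')
      then show ?case using elim(1-3) by (auto simp: fun_eq_iff)
    qed
    then show "\<rho> (p \<otimes> q) = \<rho> p \<otimes>\<^bsub>sym_group m0\<^esub> \<rho> q" using F'(1) by (simp add: sym_group_mult)
  qed
  have "\<forall>\<^sub>F n in F'. \<forall>e\<in>E. m n = m0 \<and> a n e = \<rho> e" using E \<rho> by (intro eventually_ball_finite ballI) auto
  with m0 have "\<forall>\<^sub>F n in F'. \<exists>\<rho>\<in>hom G (sym_group (m n)). \<forall>e\<in>E. freq (m n) (\<lambda>x. \<rho> e x \<noteq> a n e x) = 0"
  proof eventually_elim
    case (elim n)
    have "\<forall>e\<in>E. freq (m n) (\<lambda>x. \<rho> e x \<noteq> a n e x) = 0" using elim(2) by (simp add: freq_def)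
    then show ?case using \<open>\<rho> \<in> hom G (sym_group m0)\<close> elim(1) by blast
  qed
  then have "\<exists>\<^sub>F n in F'. \<exists>\<rho>\<in>hom G (sym_group (m n)). \<forall>e\<in>E. freq (m n) (\<lambda>x. \<rho> e x \<noteq> a n e x) = 0"
    by (rule eventually_frequently[OF F'(1)])
  then show ?thesis using F'(2) unfolding frequently_def by (metis (no_types, lifting) filter_leD)
qed

text \<open>Otherwise the filter could be refined to live on bad indices. Along it either
  \<open>m\<close> tends to infinity, and a further refinement makes all stabilizer frequencies
  converge, or \<open>m\<close> is bounded on a finer filter. Good indices appear in both
  cases.\<close>

theorem (in group) asymptotic_hom_close_hom:
  assumes count: "countable {H. subgroup H G}"
    and pc: "\<And>H. almost_normal G H \<Longrightarrow> profinitely_closed G H"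
    and \<nu>: "invariant_mean G \<nu>"
    and ah: "asymptotic_hom G F m a"
    and E: "finite E" "E \<subseteq> carrier G" and \<epsilon>: "0 < \<epsilon>" "\<epsilon> < 1"
  shows "\<forall>\<^sub>F n in F. \<exists>\<rho>\<in>hom G (sym_group (m n)). \<forall>e\<in>E. freq (m n) (\<lambda>x. \<rho> e x \<noteq> a n e x) \<le> \<epsilon>"
proof (rule ccontr)
  define good where "good = (\<lambda>n. \<exists>\<rho>\<in>hom G (sym_group (m n)). \<forall>e\<in>E. freq (m n) (\<lambda>x. \<rho> e x \<noteq> a n e x) \<le> \<epsilon>)"
  assume "\<not> ?thesis"
  then have bad: "\<exists>\<^sub>F n in F. \<not> good n" by (simp add: frequently_def good_def)
  define F1 where "F1 = inf F (principal {n. \<not> good n})"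
  have F1: "F1 \<noteq> bot" "F1 \<le> F" unfolding F1_def using inf_principal_neq_bot[OF bad] by auto
  have bad1: "\<forall>\<^sub>F n in F1. \<not> good n" unfolding F1_def eventually_inf_principal by simp
  show False
  proof (cases "filterlim m at_top F1")
    case True
    have b: "\<bar>freq (m n) (\<lambda>x. stab G (a n) x \<in> C)\<bar> \<le> 1" for C n
      using freq_le_1[of "m n" "\<lambda>x. stab G (a n) x \<in> C"] by simp
    obtain F' \<mu> where F': "F' \<noteq> bot" "F' \<le> F1" and \<mu>: "\<And>C. ((\<lambda>n. freq (m n) (\<lambda>x. stab G (a n) x \<in> C)) \<longlongrightarrow> \<mu> C) F'"
      by (rule bounded_family_cluster_filter[where u = "\<lambda>C n. freq (m n) (\<lambda>x. stab G (a n) x \<in> C)" and c = "\<lambda>_. 1", OF F1(1) b]) (rule that)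
    have "stab_limit G F' m a \<mu>"
      by (intro stab_limit.intro stab_limit_axioms.intro is_group F'(1) \<mu> asymptotic_hom_filter_mono[OF ah] order_trans[OF F'(2) F1(2)])
    then interpret SL: stab_limit G F' m a \<mu> .
    have "\<forall>\<^sub>F n in F'. good n"
      unfolding good_def by (rule SL.eventually_close_hom[OF count pc \<nu> E \<epsilon> filterlim_mono[OF True order_refl F'(2)]])
    moreover have "\<forall>\<^sub>F n in F'. \<not> good n" using F'(2) bad1 by (rule filter_leD)
    ultimately have "\<forall>\<^sub>F n in F'. False" by eventually_elim simp
    then show False using F'(1) by simp
  next
    case False
    then obtain M where "\<not> (\<forall>\<^sub>F n in F1. M \<le> m n)" unfolding filterlim_at_top by blast
    then have fr: "\<exists>\<^sub>F n in F1. m n < M" by (simp add: frequently_def not_less)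
    define F2 where "F2 = inf F1 (principal {n. m n < M})"
    have F2: "F2 \<noteq> bot" "F2 \<le> F1" unfolding F2_def using inf_principal_neq_bot[OF fr] by auto
    have "\<exists>\<^sub>F n in F2. \<exists>\<rho>\<in>hom G (sym_group (m n)). \<forall>e\<in>E. freq (m n) (\<lambda>x. \<rho> e x \<noteq> a n e x) = 0"
    proof (rule bounded_degree_close_hom[OF F2(1) _ _ E])
      show "asymptotic_hom G F2 m a" using F2(2) F1(2) by (intro asymptotic_hom_filter_mono[OF ah]) auto
      show "\<forall>\<^sub>F n in F2. m n < M" unfolding F2_def eventually_inf_principal by simp
    qed
    then have "\<exists>\<^sub>F n in F2. good n"
    proof (rule frequently_elim1)
      fix n assume "\<exists>\<rho>\<in>hom G (sym_group (m n)). \<forall>e\<in>E. freq (m n) (\<lambda>x. \<rho> e x \<noteq> a n e x) = 0"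
      then show "good n" unfolding good_def using \<epsilon>(1) by (metis less_eq_real_def)
    qed
    moreover have "\<forall>\<^sub>F n in F2. \<not> good n" using F2(2) bad1 by (rule filter_leD)
    ultimately show False by (simp add: frequently_def)
  qed
qed


subsection \<open>Polynomial maps\<close>

definition letter_value :: "('b, 'n) monoid_scheme \<Rightarrow> ('a \<Rightarrow> 'b) \<Rightarrow> 'a \<times> bool \<Rightarrow> 'b"
  where "letter_value K f l = (if snd l then f (fst l) else inv\<^bsub>K\<^esub> (f (fst l)))"

definition word_value :: "('b, 'n) monoid_scheme \<Rightarrow> ('a \<Rightarrow> 'b) \<Rightarrow> ('a \<times> bool) list \<Rightarrow> 'b"
  where "word_value K f w = foldr (\<lambda>l p. letter_value K f l \<otimes>\<^bsub>K\<^esub> p) w \<one>\<^bsub>K\<^esub>"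

text \<open>The universal property of the free group; the point is that evaluation is insensitive to
  the cancellation in \<open>push_letter\<close>.\<close>

lemma (in group) word_value_hom:
  assumes f: "f \<in> X \<rightarrow> carrier G"
  shows "word_value G f \<in> hom (free_group X) G"
proof -
  have lc: "letter_value G f l \<in> carrier G" if "fst l \<in> X" for l
    using f that by (auto simp: letter_value_def Pi_iff)
  have li: "letter_value G f (inv_letter l) = inv (letter_value G f l)" if "fst l \<in> X" for l
    using f that by (auto simp: letter_value_def inv_letter_def Pi_iff)
  have wc: "word_value G f w \<in> carrier G" if "fst ` set w \<subseteq> X" for w
    using that by (induction w) (auto simp: word_value_def lc)
  have cons: "word_value G f (l # w) = letter_value G f l \<otimes> word_value G f w" for l w
    by (simp add: word_value_def)
  have push: "word_value G f (push_letter l w) = letter_value G f l \<otimes> word_value G f w"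
    if "fst l \<in> X" "fst ` set w \<subseteq> X" for l w
  proof (cases w)
    case (Cons k v)
    show ?thesis
    proof (cases "k = inv_letter l")
      case True
      have v: "word_value G f v \<in> carrier G" using that(2) Cons by (intro wc) auto
      have "letter_value G f l \<otimes> word_value G f w = letter_value G f l \<otimes> (inv (letter_value G f l) \<otimes> word_value G f v)"
        using that Cons True by (simp add: cons li)
      also have "\<dots> = word_value G f v" using lc[OF that(1)] v by (simp add: m_assoc[symmetric])
      finally show ?thesis using Cons True by simp
    qed (use Cons in \<open>simp add: cons\<close>)
  qed (simp add: cons)
  have mult: "word_value G f (foldr push_letter u v) = word_value G f u \<otimes> word_value G f v"
    if "fst ` set u \<subseteq> X" "fst ` set v \<subseteq> X" for u v
    using that(1)
  proof (induction u)
    case Nil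
    then show ?case using wc[OF that(2)] by (simp add: word_value_def)
  next
    case (Cons l u)
    have "fst ` set (foldr push_letter u v) \<subseteq> X" using set_foldr_push_letter[of u v] Cons.prems that(2) by fastforce
    then have "word_value G f (foldr push_letter (l # u) v) = letter_value G f l \<otimes> word_value G f (foldr push_letter u v)"
      using Cons.prems by (simp add: push)
    also have "\<dots> = letter_value G f l \<otimes> (word_value G f u \<otimes> word_value G f v)" using Cons by simp
    also have "\<dots> = word_value G f (l # u) \<otimes> word_value G f v"
      using lc[of l] wc[of u] wc[OF that(2)] Cons.prems by (simp add: cons m_assoc)
    finally show ?case .
  qed
  show ?thesis
    by (rule homI) (auto simp: free_group_def wc mult)
qed

lemma pdiffs_Cons: "pdiffs G K (g # gs) f = pdiff G K g (pdiffs G K gs f)"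
  by (simp add: pdiffs_def)

text \<open>Derivatives use only products and inverses in the target, so they are natural for
  homomorphisms.\<close>

lemma pdiffs_hom:
  assumes G: "group G" and K: "group K" and L: "group L" and h: "h \<in> hom K L" and f: "f \<in> carrier G \<rightarrow> carrier K"
    and gs: "set gs \<subseteq> carrier G" and x: "x \<in> carrier G"
  shows "pdiffs G L gs (\<lambda>g. h (f g)) x = h (pdiffs G K gs f x)"
  using gs x
proof (induction gs arbitrary: x)
  case Nil
  then show ?case by (simp add: pdiffs_def)
next
  case (Cons g gs)
  interpret G: group G by (rule G)
  have c: "pdiffs G K gs f y \<in> carrier K" if "y \<in> carrier G" for y
    using pdiffs_closed[OF G K f, of gs] Cons.prems that by auto
  have gx: "g \<otimes>\<^bsub>G\<^esub> x \<in> carrier G" using Cons.prems by simp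
  have "pdiffs G L (g # gs) (\<lambda>g. h (f g)) x = h (pdiffs G K gs f (g \<otimes>\<^bsub>G\<^esub> x)) \<otimes>\<^bsub>L\<^esub> inv\<^bsub>L\<^esub> h (pdiffs G K gs f x)"
    using Cons gx by (simp add: pdiffs_Cons pdiff_def)
  also have "\<dots> = h (pdiffs G K gs f (g \<otimes>\<^bsub>G\<^esub> x) \<otimes>\<^bsub>K\<^esub> inv\<^bsub>K\<^esub> (pdiffs G K gs f x))"
    using c[OF gx] c[OF Cons.prems(2)] h K L
    by (simp add: hom_mult group_hom.hom_inv[OF group_hom.intro[OF K L group_hom_axioms.intro[OF h]], symmetric] group.inv_closed)
  finally show ?case by (simp add: pdiffs_Cons pdiff_def)
qed

text \<open>Polynomiality may be tested at \<open>x = 1\<close>, since the derivative of \<open>h\<close> in direction \<open>g\<close> at \<open>x\<close>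
  is the quotient of its derivatives at \<open>1\<close> in the directions \<open>g x\<close> and \<open>x\<close>.\<close>

lemma polynomial_mapI:
  assumes G: "group G" and K: "group K" and f: "f \<in> carrier G \<rightarrow> carrier K"
    and one: "\<And>gs. length gs = s + 1 \<Longrightarrow> set gs \<subseteq> carrier G \<Longrightarrow> pdiffs G K gs f \<one>\<^bsub>G\<^esub> = \<one>\<^bsub>K\<^esub>"
  shows "polynomial_map G K s f"
  unfolding polynomial_map_def
proof (intro conjI f allI impI)
  fix gs x assume len: "length gs = s + 1" and gs: "set gs \<subseteq> carrier G" and x: "x \<in> carrier G"
  interpret G: group G by (rule G)
  interpret K: group K by (rule K)
  obtain g gs' where gg: "gs = g # gs'" using len by (cases gs) auto
  define h where "h = pdiffs G K gs' f"
  have h: "h y \<in> carrier K" if "y \<in> carrier G" for y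
    using pdiffs_closed[OF G K f, of gs'] gs gg that unfolding h_def by auto
  have eq: "h y = h \<one>\<^bsub>G\<^esub>" if y: "y \<in> carrier G" for y
  proof -
    have "pdiffs G K (y # gs') f \<one>\<^bsub>G\<^esub> = \<one>\<^bsub>K\<^esub>" using len gs gg y by (intro one) auto
    then have "h y \<otimes>\<^bsub>K\<^esub> inv\<^bsub>K\<^esub> (h \<one>\<^bsub>G\<^esub>) = \<one>\<^bsub>K\<^esub>" using y by (simp add: pdiffs_Cons pdiff_def h_def)
    then have "h y = h \<one>\<^bsub>G\<^esub> \<or> False" using h[OF y] h[OF G.one_closed]
      by (metis K.inv_closed K.inv_equality K.inv_inv)
    then show ?thesis by simp
  qed
  have "g \<in> carrier G" using gs gg by simp
  then have "pdiffs G K gs f x = h (g \<otimes>\<^bsub>G\<^esub> x) \<otimes>\<^bsub>K\<^esub> inv\<^bsub>K\<^esub> (h x)" by (simp add: gg pdiffs_Cons pdiff_def h_def)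
  also have "\<dots> = \<one>\<^bsub>K\<^esub>" using eq[of x] eq[of "g \<otimes>\<^bsub>G\<^esub> x"] x \<open>g \<in> carrier G\<close> h[OF G.one_closed] by simp
  finally show "pdiffs G K gs f x = \<one>\<^bsub>K\<^esub>" .
qed

lemma hamming_dist_freq:
  assumes "0 < m" "\<sigma> \<in> carrier (sym_group m)" "\<tau> \<in> carrier (sym_group m)"
  shows "hamming_dist m \<sigma> \<tau> = freq m (\<lambda>x. \<sigma> x \<noteq> \<tau> x)"
proof -
  have p: "\<sigma> permutes {1..m}" using assms(2) by (simp add: sym_group_carrier)
  have "(inv\<^bsub>sym_group m\<^esub> \<sigma> \<otimes>\<^bsub>sym_group m\<^esub> \<tau>) i = i \<longleftrightarrow> \<sigma> i = \<tau> i" for i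
    using assms(2) permutes_inv_eq[OF p, of "\<tau> i" i] by (simp add: sym_group_mult)
  then have "hamming_dist m \<sigma> \<tau> = 1 - freq m (\<lambda>x. \<sigma> x = \<tau> x)" by (simp add: hamming_dist_def freq_def)
  moreover have "freq m (\<lambda>x. \<sigma> x = \<tau> x \<or> \<sigma> x \<noteq> \<tau> x) = freq m (\<lambda>x. \<sigma> x = \<tau> x) + freq m (\<lambda>x. \<sigma> x \<noteq> \<tau> x)"
    by (rule freq_disj_eq) simp
  ultimately show ?thesis using freq_True[OF assms(1)] by simp
qed

lemma freq_comp:
  assumes "\<tau>' permutes {1..m}"
  shows "freq m (\<lambda>x. \<sigma> (\<tau> x) \<noteq> \<sigma>' (\<tau>' x)) \<le> freq m (\<lambda>x. \<tau> x \<noteq> \<tau>' x) + freq m (\<lambda>x. \<sigma> x \<noteq> \<sigma>' x)"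
proof -
  have "freq m (\<lambda>x. \<sigma> (\<tau> x) \<noteq> \<sigma>' (\<tau>' x)) \<le> freq m (\<lambda>x. \<tau> x \<noteq> \<tau>' x \<or> \<sigma> (\<tau>' x) \<noteq> \<sigma>' (\<tau>' x))"
    by (rule freq_mono) auto
  also have "\<dots> \<le> freq m (\<lambda>x. \<tau> x \<noteq> \<tau>' x) + freq m (\<lambda>x. \<sigma> (\<tau>' x) \<noteq> \<sigma>' (\<tau>' x))" by (rule freq_disj_le)
  also have "freq m (\<lambda>x. \<sigma> (\<tau>' x) \<noteq> \<sigma>' (\<tau>' x)) = freq m (\<lambda>x. \<sigma> x \<noteq> \<sigma>' x)"
    using freq_permutes[OF assms, of "\<lambda>x. \<sigma> x \<noteq> \<sigma>' x"] .
  finally show ?thesis .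
qed

lemma freq_inv:
  assumes "\<sigma> permutes {1..m}" "\<sigma>' permutes {1..m}"
  shows "freq m (\<lambda>x. inv_into UNIV \<sigma> x \<noteq> inv_into UNIV \<sigma>' x) = freq m (\<lambda>x. \<sigma> x \<noteq> \<sigma>' x)"
proof -
  have "inv_into UNIV \<sigma> (\<sigma> x) \<noteq> inv_into UNIV \<sigma>' (\<sigma> x) \<longleftrightarrow> \<sigma> x \<noteq> \<sigma>' x" for x
  proof -
    have 1: "inv_into UNIV \<sigma> (\<sigma> x) = x" by (rule permutes_inverses(2)[OF assms(1)])
    have 2: "(inv_into UNIV \<sigma>' (\<sigma> x) = x) = (\<sigma>' x = \<sigma> x)" by (rule permutes_inv_eq[OF assms(2)])
    have "(x = inv_into UNIV \<sigma>' (\<sigma> x)) = (\<sigma> x = \<sigma>' x)" unfolding eq_commute[of x] 2 by (rule eq_commute)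
    then show ?thesis by (simp only: 1 simp_thms)
  qed
  then show ?thesis
    using freq_permutes[OF assms(1), of "\<lambda>x. inv_into UNIV \<sigma> x \<noteq> inv_into UNIV \<sigma>' x"] by simp
qed

text \<open>An iterated derivative at a point is a word in finitely many values of the map, so it
  changes little if each value does. This permits replacing an asymptotically unital sequence by a
  unital one.\<close>

lemma pdiffs_perturb:
  fixes f f' :: "'i \<Rightarrow> 'a \<Rightarrow> nat \<Rightarrow> nat"
  assumes G: "group G"
    and f: "\<And>n. f n \<in> carrier G \<rightarrow> carrier (sym_group (m n))" "\<And>n. f' n \<in> carrier G \<rightarrow> carrier (sym_group (m n))"
    and close: "\<And>g. g \<in> carrier G \<Longrightarrow> ((\<lambda>n. freq (m n) (\<lambda>x. f n g x \<noteq> f' n g x)) \<longlongrightarrow> 0) F"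
    and gs: "set gs \<subseteq> carrier G" and y: "y \<in> carrier G"
  shows "((\<lambda>n. freq (m n) (\<lambda>x. pdiffs G (sym_group (m n)) gs (f n) y x \<noteq> pdiffs G (sym_group (m n)) gs (f' n) y x)) \<longlongrightarrow> 0) F"
  using gs y
proof (induction gs arbitrary: y)
  case Nil
  then show ?case using close by (simp add: pdiffs_def)
next
  case (Cons g gs)
  interpret G: group G by (rule G)
  define h where "h = (\<lambda>n. pdiffs G (sym_group (m n)) gs (f n))"
  define h' where "h' = (\<lambda>n. pdiffs G (sym_group (m n)) gs (f' n))"
  have hc: "h n z \<in> carrier (sym_group (m n))" "h' n z \<in> carrier (sym_group (m n))" if "z \<in> carrier G" for n z
    using pdiffs_closed[OF G sym_group_is_group f(1), of gs n] pdiffs_closed[OF G sym_group_is_group f(2), of gs n] Cons.prems that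
    unfolding h_def h'_def by auto
  have hp: "h n z permutes {1..m n}" "h' n z permutes {1..m n}" if "z \<in> carrier G" for n z
    using hc[OF that] by (simp_all add: sym_group_carrier)
  have gy: "g \<otimes>\<^bsub>G\<^esub> y \<in> carrier G" "y \<in> carrier G" using Cons.prems by auto
  have IH: "((\<lambda>n. freq (m n) (\<lambda>x. h n z x \<noteq> h' n z x)) \<longlongrightarrow> 0) F" if "z \<in> carrier G" for z
    unfolding h_def h'_def using Cons that by auto
  have eq0: "pdiffs G (sym_group (m n)) (g # gs) (f n) y = h n (g \<otimes>\<^bsub>G\<^esub> y) \<otimes>\<^bsub>sym_group (m n)\<^esub> inv\<^bsub>sym_group (m n)\<^esub> (h n y)"
    "pdiffs G (sym_group (m n)) (g # gs) (f' n) y = h' n (g \<otimes>\<^bsub>G\<^esub> y) \<otimes>\<^bsub>sym_group (m n)\<^esub> inv\<^bsub>sym_group (m n)\<^esub> (h' n y)" for n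
    by (simp_all add: pdiffs_Cons pdiff_def h_def h'_def)
  have eq: "pdiffs G (sym_group (m n)) (g # gs) (f n) y x = h n (g \<otimes>\<^bsub>G\<^esub> y) (inv_into UNIV (h n y) x)"
    "pdiffs G (sym_group (m n)) (g # gs) (f' n) y x = h' n (g \<otimes>\<^bsub>G\<^esub> y) (inv_into UNIV (h' n y) x)" for n x
    by (simp_all only: eq0 sym_group_mult comp_apply sym_group_inv_equality[OF hc(1)[OF gy(2)]] sym_group_inv_equality[OF hc(2)[OF gy(2)]])
  show ?case
    unfolding eq
  proof (rule tendsto_sandwich[OF _ _ tendsto_const])
    show "\<forall>\<^sub>F n in F. freq (m n) (\<lambda>x. h n (g \<otimes>\<^bsub>G\<^esub> y) (inv_into UNIV (h n y) x) \<noteq> h' n (g \<otimes>\<^bsub>G\<^esub> y) (inv_into UNIV (h' n y) x))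
        \<le> freq (m n) (\<lambda>x. h n y x \<noteq> h' n y x) + freq (m n) (\<lambda>x. h n (g \<otimes>\<^bsub>G\<^esub> y) x \<noteq> h' n (g \<otimes>\<^bsub>G\<^esub> y) x)"
    proof (intro always_eventually allI)
      fix n
      have "freq (m n) (\<lambda>x. h n (g \<otimes>\<^bsub>G\<^esub> y) (inv_into UNIV (h n y) x) \<noteq> h' n (g \<otimes>\<^bsub>G\<^esub> y) (inv_into UNIV (h' n y) x))
        \<le> freq (m n) (\<lambda>x. inv_into UNIV (h n y) x \<noteq> inv_into UNIV (h' n y) x) + freq (m n) (\<lambda>x. h n (g \<otimes>\<^bsub>G\<^esub> y) x \<noteq> h' n (g \<otimes>\<^bsub>G\<^esub> y) x)"
        by (rule freq_comp[OF permutes_inv[OF hp(2)[OF gy(2)]]])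
      then show "freq (m n) (\<lambda>x. h n (g \<otimes>\<^bsub>G\<^esub> y) (inv_into UNIV (h n y) x) \<noteq> h' n (g \<otimes>\<^bsub>G\<^esub> y) (inv_into UNIV (h' n y) x))
        \<le> freq (m n) (\<lambda>x. h n y x \<noteq> h' n y x) + freq (m n) (\<lambda>x. h n (g \<otimes>\<^bsub>G\<^esub> y) x \<noteq> h' n (g \<otimes>\<^bsub>G\<^esub> y) x)"
        using freq_inv[OF hp[OF gy(2)]] by simp
    qed
    show "((\<lambda>n. freq (m n) (\<lambda>x. h n y x \<noteq> h' n y x) + freq (m n) (\<lambda>x. h n (g \<otimes>\<^bsub>G\<^esub> y) x \<noteq> h' n (g \<otimes>\<^bsub>G\<^esub> y) x)) \<longlongrightarrow> 0) F"
      using tendsto_add[OF IH[OF gy(2)] IH[OF gy(1)]] by simp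
  qed simp
qed

text \<open>Frequencies are invariant under permutations, so almost trivial action is preserved by
  conjugation. Hence it suffices to check the generating relations instead of their normal
  closure.\<close>

lemma (in group) negligible_normal:
  assumes \<phi>: "\<And>n. \<phi> n \<in> hom G (sym_group (m n))"
  shows "{w \<in> carrier G. ((\<lambda>n. freq (m n) (\<lambda>x. \<phi> n w x \<noteq> x)) \<longlongrightarrow> 0) F} \<lhd> G"
proof -
  have p: "\<phi> n w permutes {1..m n}" if "w \<in> carrier G" for n w
    using hom_in_carrier[OF \<phi> that, of n] by (simp add: sym_group_carrier)
  have mult: "\<phi> n (u \<otimes> v) = \<phi> n u \<circ> \<phi> n v" if "u \<in> carrier G" "v \<in> carrier G" for n u v
    using hom_mult[OF \<phi> that, of n] by (simp add: sym_group_mult)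
  have one: "\<phi> n \<one> = id" for n
    using hom_one[OF \<phi> is_group sym_group_is_group, of n] by (simp add: sym_group_one)
  have inv: "\<phi> n (inv u) = inv_into UNIV (\<phi> n u)" if u: "u \<in> carrier G" for n u
  proof -
    have "\<phi> n u \<circ> \<phi> n (inv u) = id" using mult[OF u inv_closed[OF u], of n] u one by simp
    then have "\<phi> n u (\<phi> n (inv u) x) = x" for x by (metis comp_apply id_apply)
    then show ?thesis using permutes_inv_eq[OF p[OF u], of n] by (intro ext) metis
  qed
  have "subgroup {w \<in> carrier G. ((\<lambda>n. freq (m n) (\<lambda>x. \<phi> n w x \<noteq> x)) \<longlongrightarrow> 0) F} G" (is "subgroup ?N G")
  proof (rule subgroupI)
    have "\<one> \<in> ?N" by (simp add: one freq_def)
    then show "?N \<noteq> {}" by blast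
  next
    fix u assume u: "u \<in> ?N"
    have "freq (m n) (\<lambda>x. \<phi> n (inv u) x \<noteq> x) = freq (m n) (\<lambda>x. \<phi> n u x \<noteq> x)" for n
      using freq_inv[OF p permutes_id, of u n] inv u by (simp add: inv_id)
    then show "inv u \<in> ?N" using u by simp
  next
    fix u v assume u: "u \<in> ?N" and v: "v \<in> ?N"
    have le: "freq (m n) (\<lambda>x. \<phi> n (u \<otimes> v) x \<noteq> x) \<le> freq (m n) (\<lambda>x. \<phi> n v x \<noteq> x) + freq (m n) (\<lambda>x. \<phi> n u x \<noteq> x)" for n
      using freq_comp[OF permutes_id, of "m n" "\<phi> n u" "\<phi> n v" id] mult u v by simp
    have lim: "((\<lambda>n. freq (m n) (\<lambda>x. \<phi> n v x \<noteq> x) + freq (m n) (\<lambda>x. \<phi> n u x \<noteq> x)) \<longlongrightarrow> 0) F"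
      using tendsto_add[of "\<lambda>n. freq (m n) (\<lambda>x. \<phi> n v x \<noteq> x)" 0 F "\<lambda>n. freq (m n) (\<lambda>x. \<phi> n u x \<noteq> x)" 0] u v by simp
    have "((\<lambda>n. freq (m n) (\<lambda>x. \<phi> n (u \<otimes> v) x \<noteq> x)) \<longlongrightarrow> 0) F"
      by (rule tendsto_sandwich[OF _ _ tendsto_const lim]) (simp_all add: le)
    then show "u \<otimes> v \<in> ?N" using u v by simp
  qed auto
  moreover have "g \<otimes> w \<otimes> inv g \<in> ?N" if g: "g \<in> carrier G" and w: "w \<in> ?N" for g w
  proof -
    have wc: "w \<in> carrier G" using w by simp
    have "\<phi> n (g \<otimes> w \<otimes> inv g) (\<phi> n g x) \<noteq> \<phi> n g x \<longleftrightarrow> \<phi> n w x \<noteq> x" for n x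
    proof -
      have "\<phi> n (g \<otimes> w \<otimes> inv g) (\<phi> n g x) = \<phi> n (g \<otimes> w \<otimes> inv g \<otimes> g) x"
        using mult[of "g \<otimes> w \<otimes> inv g" g n] g wc by simp
      also have "g \<otimes> w \<otimes> inv g \<otimes> g = g \<otimes> w" using g wc by (simp add: m_assoc)
      also have "\<phi> n (g \<otimes> w) x = \<phi> n g (\<phi> n w x)" using mult[OF g wc, of n] by simp
      finally show ?thesis using permutes_inj[OF p[OF g, of n]] by (simp add: inj_eq)
    qed
    then have "freq (m n) (\<lambda>x. \<phi> n (g \<otimes> w \<otimes> inv g) x \<noteq> x) = freq (m n) (\<lambda>x. \<phi> n w x \<noteq> x)" for n
      using freq_permutes[OF p[OF g], of n "\<lambda>x. \<phi> n (g \<otimes> w \<otimes> inv g) x \<noteq> x"] by simp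
    then show ?thesis using w g by simp
  qed
  ultimately show ?thesis unfolding normal_inv_iff by blast
qed

section \<open>Homomorphisms on the universal polynomial group and the polynomial maps that they
  induce\<close>

lemma group_pol_free: "group (pol_free G)"
  by (simp add: pol_free_def group_free_group)

lemma pol_iota_closed: "pol_iota G \<in> carrier G \<rightarrow> carrier (pol_free G)"
  by (auto simp: pol_iota_def pol_free_def free_group_def reduced_word_Cons)

lemma pol_relations_normal:
  assumes "group G"
  shows "pol_relations G s \<lhd> pol_free G"
  unfolding pol_relations_def
  using pdiffs_closed[OF assms group_pol_free pol_iota_closed] group.is_monoid[OF assms]
  by (intro normal_normal_closure group_pol_free) (auto simp: Pi_iff monoid.one_closed)

lemma pol_relations_contains:
  "length gs = s + 1 \<Longrightarrow> set gs \<subseteq> carrier G \<Longrightarrow> pdiffs G (pol_free G) gs (pol_iota G) \<one>\<^bsub>G\<^esub> \<in> pol_relations G s"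
  unfolding pol_relations_def normal_closure_def by blast

lemma pol_relations_least:
  assumes "N \<lhd> pol_free G"
    and "\<And>gs. length gs = s + 1 \<Longrightarrow> set gs \<subseteq> carrier G \<Longrightarrow> pdiffs G (pol_free G) gs (pol_iota G) \<one>\<^bsub>G\<^esub> \<in> N"
  shows "pol_relations G s \<subseteq> N"
  unfolding pol_relations_def normal_closure_def using assms by (intro Inter_lower) blast

text \<open>The derivatives of order s + 1 of the universal map at the unit are relations, so they
  die under every homomorphism on the quotient.\<close>

lemma unital_polynomial_of_hom:
  assumes G: "group G" and K: "group K" and \<rho>: "\<rho> \<in> hom (Pol s G) K"
  defines "\<rho>' \<equiv> \<lambda>g. \<rho> (pol_relations G s #>\<^bsub>pol_free G\<^esub> pol_iota G g)"
  shows "polynomial_map G K s \<rho>'" "unital_map G K \<rho>'"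
proof -
  interpret G: group G by (rule G)
  interpret Fr: group "pol_free G" by (rule group_pol_free)
  interpret R: normal "pol_relations G s" "pol_free G" by (rule pol_relations_normal[OF G])
  interpret P: group "Pol s G" by (rule group_Pol[OF G])
  define h where "h = (\<lambda>w. \<rho> (pol_relations G s #>\<^bsub>pol_free G\<^esub> w))"
  have h: "h \<in> hom (pol_free G) K"
    using hom_compose[OF R.r_coset_hom_Mod \<rho>[unfolded Pol_def]] by (simp add: h_def comp_def)
  have \<rho>one: "\<rho> (pol_relations G s) = \<one>\<^bsub>K\<^esub>"
    using hom_one[OF \<rho> P.is_group K] by (simp add: Pol_def FactGroup_def)
  have hR: "h r = \<one>\<^bsub>K\<^esub>" if "r \<in> pol_relations G s" for r
    using \<rho>one Fr.coset_join2[OF _ R.subgroup_axioms that] R.subset that by (auto simp: h_def)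
  have \<rho>': "\<rho>' = (\<lambda>g. h (pol_iota G g))" by (simp add: \<rho>'_def h_def)
  have closed: "\<rho>' \<in> carrier G \<rightarrow> carrier K"
    unfolding \<rho>' using pol_iota_closed[of G] hom_in_carrier[OF h] by (auto simp: Pi_iff)
  show "polynomial_map G K s \<rho>'"
  proof (rule polynomial_mapI[OF G K closed])
    fix gs assume gs: "length gs = s + 1" "set gs \<subseteq> carrier G"
    show "pdiffs G K gs \<rho>' \<one>\<^bsub>G\<^esub> = \<one>\<^bsub>K\<^esub>"
      unfolding \<rho>' pdiffs_hom[OF G Fr.is_group K h pol_iota_closed gs(2) G.one_closed]
      by (rule hR[OF pol_relations_contains[OF gs]])
  qed
  show "unital_map G K \<rho>'"
    unfolding unital_map_def \<rho>' using hom_one[OF h Fr.is_group K] by (simp add: pol_iota_def)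
qed

lemma amenable_group_iff: "amenable_group G \<longleftrightarrow> group G \<and> (\<exists>\<mu>. invariant_mean G \<mu>)"
  by (simp only: amenable_group_def invariant_mean_def)

text \<open>At index \<open>n\<close> the best admissible precision is used; it tends to infinity
  because every precision is eventually admissible.\<close>

lemma diagonal_choice:
  fixes d :: "nat \<Rightarrow> 'r \<Rightarrow> nat \<Rightarrow> real"
  assumes nonneg: "\<And>n \<rho> j. 0 \<le> d n \<rho> j"
    and ex: "\<And>n. \<exists>\<rho>. ok n \<rho>"
    and ev: "\<And>k :: nat. \<forall>\<^sub>F n in sequentially. \<exists>\<rho>. ok n \<rho> \<and> (\<forall>j<k. d n \<rho> j \<le> 1 / (k + 1))"
  obtains \<rho> where "\<And>n. ok n (\<rho> n)" "\<And>j. (\<lambda>n. d n (\<rho> n) j) \<longlonglongrightarrow> 0"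
proof -
  define good where "good = (\<lambda>(k :: nat) n. \<exists>\<rho>. ok n \<rho> \<and> (\<forall>j<k. d n \<rho> j \<le> 1 / (k + 1)))"
  \<comment> \<open>The cap \<open>k \<le> n\<close> makes the set finite, and precision 0 is always
    admissible, so the maximum exists.\<close>
  define K where "K = (\<lambda>n. Max {k. k \<le> n \<and> good k n})"
  have fin: "finite {k. k \<le> n \<and> good k n}" for n by simp
  have "good 0 n" for n using ex[of n] by (simp add: good_def)
  then have ne: "{k. k \<le> n \<and> good k n} \<noteq> {}" for n by blast
  have K: "good (K n) n" for n using Max_in[OF fin ne, of n] by (simp add: K_def)
  then obtain \<rho> where \<rho>: "\<And>n. ok n (\<rho> n)" "\<And>n j. j < K n \<Longrightarrow> d n (\<rho> n) j \<le> 1 / (K n + 1)"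
    unfolding good_def by metis
  have Kge: "\<forall>\<^sub>F n in sequentially. k \<le> K n" for k
    using ev[of k] eventually_ge_at_top[of k]
  proof eventually_elim
    case (elim n)
    then show ?case unfolding K_def by (intro Max_ge fin) (simp add: good_def)
  qed
  have "(\<lambda>n. d n (\<rho> n) j) \<longlonglongrightarrow> 0" for j
  proof (rule LIMSEQ_I)
    fix e :: real assume e: "0 < e"
    obtain k0 :: nat where k0: "1 / e < k0" using reals_Archimedean2 by blast
    have "\<forall>\<^sub>F n in sequentially. norm (d n (\<rho> n) j - 0) < e"
      using Kge[of "max k0 (Suc j)"]
    proof eventually_elim
      case (elim n)
      have "d n (\<rho> n) j \<le> 1 / (K n + 1)" using elim by (intro \<rho>(2)) simp
      also have "\<dots> < e"
      proof -
        have "1 / e < real (K n + 1)" using k0 elim by simp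
        then show ?thesis using e by (simp add: field_simps)
      qed
      finally show ?case using nonneg[of n "\<rho> n" j] by simp
    qed
    then show "\<exists>no. \<forall>n\<ge>no. norm (d n (\<rho> n) j - 0) < e" by (simp add: eventually_sequentially)
  qed
  then show thesis using that \<rho>(1) by blast
qed

theorem corollary4p3:
  fixes G :: "('a, 'm) monoid_scheme" and s :: nat
  assumes "group G" and "countable (carrier G)" and "s \<ge> 1"
    and "amenable_group (Pol s G)"
    and "countable {H. subgroup H (Pol s G)}"
    and "\<And>H. almost_normal (Pol s G) H \<Longrightarrow> profinitely_closed (Pol s G) H"
  shows "P_stable s G"
  unfolding P_stable_def
proof (intro allI impI)
  fix m :: "nat \<Rightarrow> nat" and f :: "nat \<Rightarrow> 'a \<Rightarrow> nat \<Rightarrow> nat"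
  assume ap: "almost_polynomial G s m f"
  interpret G: group G by fact
  interpret Fr: group "pol_free G" by (rule group_pol_free)
  define R where "R = pol_relations G s"
  interpret R: normal R "pol_free G" unfolding R_def by (rule pol_relations_normal[OF assms(1)])
  interpret P: group "Pol s G" by (rule group_Pol[OF assms(1)])
  have au: "asymptotically_unital G m f" using ap by (simp add: almost_polynomial_def)
  have m_pos: "0 < m n" and fc: "f n \<in> carrier G \<rightarrow> carrier (sym_group (m n))" for n
    using au by (simp_all add: asymptotically_unital_def)
  have idc: "id \<in> carrier (sym_group k)" for k by (simp add: sym_group_carrier permutes_id)
  have f_one: "(\<lambda>n. freq (m n) (\<lambda>x. f n \<one>\<^bsub>G\<^esub> x \<noteq> x)) \<longlonglongrightarrow> 0"
  proof -
    have "hamming_dist (m n) (f n \<one>\<^bsub>G\<^esub>) \<one>\<^bsub>sym_group (m n)\<^esub> = freq (m n) (\<lambda>x. f n \<one>\<^bsub>G\<^esub> x \<noteq> x)" for n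
      using hamming_dist_freq[OF m_pos funcset_mem[OF fc G.one_closed] idc, of n] by (simp add: sym_group_one)
    then show ?thesis using au by (simp add: asymptotically_unital_def)
  qed
  \<comment> \<open>Words are evaluated at \<open>f n\<close>. A generator gives
    \<open>f n g\<close>, but the unit of \<open>G\<close> corresponds to the empty word and gives
    the identity. The resulting \<open>f'\<close> thus differs from \<open>f\<close> at most at the
    unit, where asymptotic unitality makes the difference negligible.\<close>
  define \<phi> where "\<phi> = (\<lambda>n. word_value (sym_group (m n)) (f n))"
  have \<phi>: "\<phi> n \<in> hom (pol_free G) (sym_group (m n))" for n
    unfolding \<phi>_def pol_free_def using fc[of n] by (intro group.word_value_hom sym_group_is_group) auto
  have \<phi>p: "\<phi> n w permutes {1..m n}" if "w \<in> carrier (pol_free G)" for n w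
    using hom_in_carrier[OF \<phi> that, of n] by (simp add: sym_group_carrier)
  have \<phi>mult: "\<phi> n (u \<otimes>\<^bsub>pol_free G\<^esub> v) x = \<phi> n u (\<phi> n v x)" if "u \<in> carrier (pol_free G)" "v \<in> carrier (pol_free G)" for n u v x
    using hom_mult[OF \<phi> that, of n] by (simp add: sym_group_mult)
  define f' where "f' = (\<lambda>n g. \<phi> n (pol_iota G g))"
  have iotac: "pol_iota G g \<in> carrier (pol_free G)" if "g \<in> carrier G" for g
    using pol_iota_closed[of G] that by blast
  have f'c: "f' n \<in> carrier G \<rightarrow> carrier (sym_group (m n))" for n
    unfolding f'_def using iotac hom_in_carrier[OF \<phi>] by blast
  have f'_f: "(\<lambda>n. freq (m n) (\<lambda>x. f' n g x \<noteq> f n g x)) \<longlonglongrightarrow> 0" if g: "g \<in> carrier G" for g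
  proof (cases "g = \<one>\<^bsub>G\<^esub>")
    case True
    have "f' n g = id" for n
      using hom_one[OF \<phi> Fr.is_group sym_group_is_group, of n] True by (simp add: f'_def pol_iota_def sym_group_one)
    moreover have "(\<lambda>x. x \<noteq> f n \<one>\<^bsub>G\<^esub> x) = (\<lambda>x. f n \<one>\<^bsub>G\<^esub> x \<noteq> x)" for n by auto
    ultimately show ?thesis using f_one True by simp
  next
    case False
    have "f' n g = f n g" for n
      using False by (simp add: f'_def pol_iota_def \<phi>_def word_value_def letter_value_def sym_group_mult sym_group_one)
    then show ?thesis by (simp add: freq_def)
  qed
  define N where "N = {w \<in> carrier (pol_free G). (\<lambda>n. freq (m n) (\<lambda>x. \<phi> n w x \<noteq> x)) \<longlonglongrightarrow> 0}"
  have N: "N \<lhd> pol_free G" unfolding N_def by (rule Fr.negligible_normal[OF \<phi>])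
  have "R \<subseteq> N"
    unfolding R_def
  proof (rule pol_relations_least[OF N])
    fix gs assume gs: "length gs = s + 1" "set gs \<subseteq> carrier G"
    let ?w = "pdiffs G (pol_free G) gs (pol_iota G) \<one>\<^bsub>G\<^esub>"
    have wc: "?w \<in> carrier (pol_free G)"
      using pdiffs_closed[OF assms(1) Fr.is_group pol_iota_closed gs(2)] by auto
    have w: "\<phi> n ?w = pdiffs G (sym_group (m n)) gs (f' n) \<one>\<^bsub>G\<^esub>" for n
      unfolding f'_def using pdiffs_hom[OF assms(1) Fr.is_group sym_group_is_group \<phi> pol_iota_closed gs(2) G.one_closed] by simp
    have c: "pdiffs G (sym_group (m n)) gs (f n) \<one>\<^bsub>G\<^esub> \<in> carrier (sym_group (m n))" for n
      using pdiffs_closed[OF assms(1) sym_group_is_group fc gs(2)] by auto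
    have "(\<lambda>n. hamming_dist (m n) (pdiffs G (sym_group (m n)) gs (f n) \<one>\<^bsub>G\<^esub>) \<one>\<^bsub>sym_group (m n)\<^esub>) \<longlonglongrightarrow> 0"
      using ap gs by (simp add: almost_polynomial_def)
    then have "(\<lambda>n. freq (m n) (\<lambda>x. pdiffs G (sym_group (m n)) gs (f n) \<one>\<^bsub>G\<^esub> x \<noteq> x)) \<longlonglongrightarrow> 0"
      using hamming_dist_freq[OF m_pos c idc] by (simp add: sym_group_one)
    moreover have "(\<lambda>n. freq (m n) (\<lambda>x. pdiffs G (sym_group (m n)) gs (f' n) \<one>\<^bsub>G\<^esub> x \<noteq> pdiffs G (sym_group (m n)) gs (f n) \<one>\<^bsub>G\<^esub> x)) \<longlonglongrightarrow> 0"
      by (rule pdiffs_perturb[OF assms(1) f'c fc f'_f gs(2) G.one_closed])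
    ultimately have "(\<lambda>n. freq (m n) (\<lambda>x. pdiffs G (sym_group (m n)) gs (f n) \<one>\<^bsub>G\<^esub> x \<noteq> x \<or>
      pdiffs G (sym_group (m n)) gs (f' n) \<one>\<^bsub>G\<^esub> x \<noteq> pdiffs G (sym_group (m n)) gs (f n) \<one>\<^bsub>G\<^esub> x)) \<longlonglongrightarrow> 0"
      by (rule negligible_disj)
    then have "(\<lambda>n. freq (m n) (\<lambda>x. \<phi> n ?w x \<noteq> x)) \<longlonglongrightarrow> 0"
      by (rule negligible_mono) (auto simp: w)
    then show "?w \<in> N" using wc by (simp add: N_def)
  qed
  then have \<phi>R: "(\<lambda>n. freq (m n) (\<lambda>x. \<phi> n r x \<noteq> x)) \<longlonglongrightarrow> 0" if "r \<in> R" for r using that by (auto simp: N_def)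
  \<comment> \<open>A section of the quotient map, in general not multiplicative. Words of the same
    class differ by a relation, and relations act almost trivially; hence \<open>a\<close> is an
    asymptotic homomorphism.\<close>
  define \<tau> where "\<tau> = (\<lambda>p. SOME w. w \<in> carrier (pol_free G) \<and> R #>\<^bsub>pol_free G\<^esub> w = p)"
  have \<tau>: "\<tau> p \<in> carrier (pol_free G)" "R #>\<^bsub>pol_free G\<^esub> \<tau> p = p" if "p \<in> carrier (Pol s G)" for p
  proof -
    have "\<exists>w. w \<in> carrier (pol_free G) \<and> R #>\<^bsub>pol_free G\<^esub> w = p"
      using that by (auto simp: Pol_def FactGroup_def RCOSETS_def R_def)
    then have "\<tau> p \<in> carrier (pol_free G) \<and> R #>\<^bsub>pol_free G\<^esub> \<tau> p = p" unfolding \<tau>_def by (rule someI_ex)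
    then show "\<tau> p \<in> carrier (pol_free G)" "R #>\<^bsub>pol_free G\<^esub> \<tau> p = p" by auto
  qed
  define a where "a = (\<lambda>n p. \<phi> n (\<tau> p))"
  have same: "(\<lambda>n. freq (m n) (\<lambda>x. \<phi> n u x \<noteq> \<phi> n v x)) \<longlonglongrightarrow> 0"
    if uv: "u \<in> carrier (pol_free G)" "v \<in> carrier (pol_free G)" "R #>\<^bsub>pol_free G\<^esub> u = R #>\<^bsub>pol_free G\<^esub> v" for u v
  proof -
    define r where "r = u \<otimes>\<^bsub>pol_free G\<^esub> inv\<^bsub>pol_free G\<^esub> v"
    have r: "r \<in> R" using Fr.rcos_eq_iff[OF R.subgroup_axioms uv(1,2)] uv(3) by (simp add: r_def)
    have "r \<otimes>\<^bsub>pol_free G\<^esub> v = u" using uv by (simp add: r_def Fr.m_assoc)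
    moreover have "r \<in> carrier (pol_free G)" using r R.subset by blast
    ultimately have "\<phi> n u x = \<phi> n r (\<phi> n v x)" for n x using \<phi>mult[of r v n x] uv(2) by simp
    then have "freq (m n) (\<lambda>x. \<phi> n u x \<noteq> \<phi> n v x) = freq (m n) (\<lambda>x. \<phi> n r x \<noteq> x)" for n
      using freq_permutes[OF \<phi>p[OF uv(2)], of n "\<lambda>x. \<phi> n r x \<noteq> x"] by simp
    then show ?thesis using \<phi>R[OF r] by simp
  qed
  have ah: "asymptotic_hom (Pol s G) sequentially m a"
    unfolding asymptotic_hom_def
  proof (intro conjI allI ballI)
    show "0 < m n" for n by (rule m_pos)
    show "a n p permutes {1..m n}" if "p \<in> carrier (Pol s G)" for n p
      unfolding a_def by (rule \<phi>p[OF \<tau>(1)[OF that]])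
    fix p q assume p: "p \<in> carrier (Pol s G)" and q: "q \<in> carrier (Pol s G)"
    have pq: "p \<otimes>\<^bsub>Pol s G\<^esub> q \<in> carrier (Pol s G)" using p q by simp
    have "R #>\<^bsub>pol_free G\<^esub> (\<tau> p \<otimes>\<^bsub>pol_free G\<^esub> \<tau> q) = p \<otimes>\<^bsub>Pol s G\<^esub> q"
      using R.rcos_sum[OF \<tau>(1)[OF p] \<tau>(1)[OF q]] \<tau>(2)[OF p] \<tau>(2)[OF q] by (simp add: Pol_def FactGroup_def R_def)
    then have "(\<lambda>n. freq (m n) (\<lambda>x. \<phi> n (\<tau> p \<otimes>\<^bsub>pol_free G\<^esub> \<tau> q) x \<noteq> \<phi> n (\<tau> (p \<otimes>\<^bsub>Pol s G\<^esub> q)) x)) \<longlonglongrightarrow> 0"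
      using \<tau> p q pq by (intro same) auto
    then show "(\<lambda>n. freq (m n) (\<lambda>x. a n p (a n q x) \<noteq> a n (p \<otimes>\<^bsub>Pol s G\<^esub> q) x)) \<longlonglongrightarrow> 0"
      using \<phi>mult[OF \<tau>(1)[OF p] \<tau>(1)[OF q]] by (simp add: a_def)
  qed
  obtain \<nu> where \<nu>: "invariant_mean (Pol s G) \<nu>"
    using assms(4) unfolding amenable_group_iff by blast
  define \<pi> where "\<pi> = (\<lambda>g. R #>\<^bsub>pol_free G\<^esub> pol_iota G g)"
  have \<pi>: "\<pi> g \<in> carrier (Pol s G)" if "g \<in> carrier G" for g
    using iotac[OF that] by (auto simp: \<pi>_def Pol_def FactGroup_def RCOSETS_def R_def)
  have a_f: "(\<lambda>n. freq (m n) (\<lambda>x. a n (\<pi> g) x \<noteq> f n g x)) \<longlonglongrightarrow> 0" if g: "g \<in> carrier G" for g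
  proof -
    have "(\<lambda>n. freq (m n) (\<lambda>x. a n (\<pi> g) x \<noteq> f' n g x)) \<longlonglongrightarrow> 0"
      unfolding a_def f'_def using \<tau>[OF \<pi>[OF g]] iotac[OF g] by (intro same) (simp_all add: \<pi>_def)
    from negligible_disj[OF this f'_f[OF g]] show ?thesis by (rule negligible_mono) auto
  qed
  define g where "g = from_nat_into (carrier G)"
  have gc: "g j \<in> carrier G" for j unfolding g_def using G.one_closed by (intro from_nat_into) auto
  define ok where "ok = (\<lambda>n \<rho>. polynomial_map G (sym_group (m n)) s \<rho> \<and> unital_map G (sym_group (m n)) \<rho>)"
  have ok: "ok n (\<lambda>g. \<rho> (\<pi> g))" if "\<rho> \<in> hom (Pol s G) (sym_group (m n))" for n \<rho>
    using unital_polynomial_of_hom[OF assms(1) sym_group_is_group that] by (simp add: ok_def \<pi>_def R_def)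
  define d where "d = (\<lambda>n \<rho> j. freq (m n) (\<lambda>x. \<rho> (g j) x \<noteq> f n (g j) x))"
  obtain \<rho> where \<rho>: "\<And>n. ok n (\<rho> n)" "\<And>j. (\<lambda>n. d n (\<rho> n) j) \<longlonglongrightarrow> 0"
  proof (rule diagonal_choice[of d ok])
    show "0 \<le> d n \<rho> j" for n \<rho> j by (simp add: d_def)
    show "\<exists>\<rho>. ok n \<rho>" for n
    proof -
      \<comment> \<open>The trivial homomorphism serves the indices at which nothing better is
        known.\<close>
      have "(\<lambda>p. id) \<in> hom (Pol s G) (sym_group (m n))" by (simp add: hom_def idc sym_group_mult)
      from ok[OF this] show ?thesis by blast
    qed
    fix k :: nat
    \<comment> \<open>Half of the precision 1 / (k + 1) is spent on the homomorphism near
      \<open>a n\<close>, half on the distance between \<open>a n\<close> and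
      \<open>f n\<close>.\<close>
    define \<epsilon> where "\<epsilon> = 1 / (2 * (real k + 1))"
    have \<epsilon>: "0 < \<epsilon>" "\<epsilon> < 1" "2 * \<epsilon> = 1 / (k + 1)" by (simp_all add: \<epsilon>_def field_simps)
    have "\<forall>\<^sub>F n in sequentially. \<exists>\<rho>\<in>hom (Pol s G) (sym_group (m n)). \<forall>e\<in>(\<lambda>j. \<pi> (g j)) ` {..<k}. freq (m n) (\<lambda>x. \<rho> e x \<noteq> a n e x) \<le> \<epsilon>"
      using gc \<pi> by (intro P.asymptotic_hom_close_hom[OF assms(5,6) \<nu> ah _ _ \<epsilon>(1,2)]) auto
    moreover have "\<forall>\<^sub>F n in sequentially. \<forall>j\<in>{..<k}. freq (m n) (\<lambda>x. a n (\<pi> (g j)) x \<noteq> f n (g j) x) < \<epsilon>"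
      using order_tendstoD(2)[OF a_f[OF gc] \<epsilon>(1)] by (intro eventually_ball_finite ballI) auto
    ultimately show "\<forall>\<^sub>F n in sequentially. \<exists>\<rho>. ok n \<rho> \<and> (\<forall>j<k. d n \<rho> j \<le> 1 / (k + 1))"
    proof eventually_elim
      case (elim n)
      then obtain \<rho> where \<rho>: "\<rho> \<in> hom (Pol s G) (sym_group (m n))"
        "\<And>j. j < k \<Longrightarrow> freq (m n) (\<lambda>x. \<rho> (\<pi> (g j)) x \<noteq> a n (\<pi> (g j)) x) \<le> \<epsilon>" by auto
      have "d n (\<lambda>g. \<rho> (\<pi> g)) j \<le> 1 / (k + 1)" if j: "j < k" for j
      proof -
        have "d n (\<lambda>g. \<rho> (\<pi> g)) j \<le> freq (m n) (\<lambda>x. \<rho> (\<pi> (g j)) x \<noteq> a n (\<pi> (g j)) x \<or> a n (\<pi> (g j)) x \<noteq> f n (g j) x)"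
          unfolding d_def by (rule freq_mono) auto
        also have "\<dots> \<le> freq (m n) (\<lambda>x. \<rho> (\<pi> (g j)) x \<noteq> a n (\<pi> (g j)) x) + freq (m n) (\<lambda>x. a n (\<pi> (g j)) x \<noteq> f n (g j) x)"
          by (rule freq_disj_le)
        also have "\<dots> \<le> \<epsilon> + \<epsilon>" using \<rho>(2)[OF j] elim(2) j by (intro add_mono) (auto simp: less_imp_le)
        finally show ?thesis using \<epsilon>(3) by simp
      qed
      then show ?case using ok[OF \<rho>(1)] by blast
    qed
  qed blast
  show "\<exists>\<rho>. (\<forall>n. polynomial_map G (sym_group (m n)) s (\<rho> n) \<and> unital_map G (sym_group (m n)) (\<rho> n)) \<and>
      (\<forall>g\<in>carrier G. (\<lambda>n. hamming_dist (m n) (\<rho> n g) (f n g)) \<longlonglongrightarrow> 0)"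
  proof (intro exI conjI allI ballI)
    show "polynomial_map G (sym_group (m n)) s (\<rho> n)" "unital_map G (sym_group (m n)) (\<rho> n)" for n
      using \<rho>(1)[of n] by (simp_all add: ok_def)
    fix h assume h: "h \<in> carrier G"
    then obtain j where j: "h = g j" using from_nat_into_surj[OF assms(2) h] by (auto simp: g_def)
    have "\<rho> n h \<in> carrier (sym_group (m n))" for n using \<rho>(1)[of n] h by (auto simp: ok_def polynomial_map_def)
    then have "hamming_dist (m n) (\<rho> n h) (f n h) = d n (\<rho> n) j" for n
      using hamming_dist_freq[OF m_pos _ funcset_mem[OF fc h]] j by (simp add: d_def)
    then show "(\<lambda>n. hamming_dist (m n) (\<rho> n h) (f n h)) \<longlonglongrightarrow> 0" using \<rho>(2)[of j] by simp
  qed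
qed

end
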